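(* Let $X$ and $Y$ be coverable uniform spaces and let $f:X\to Y$ be a basepoint-preserving cover. Then there is a unique basepoint-preserving cover $f_B:\widetilde{Y}\to X$ such that $f\circ f_B=\phi$, where $\phi:\widetilde{Y}\to Y$ is the universal cover of $Y$.
   Context: All entourages are taken to be symmetric; $B(x,E)=\{y:(x,y)\in E\}$. Each space has a fixed basepoint $*$. For an entourage $E$ of a uniform space $X$, an $E$-chain from $p$ to $q$ is a finite sequence $\{x_0=p,\dots,x_n=q\}$ with $(x_i,x_{i+1})\in E$ for all $i$. Two $E$-chains with the same endpoints are $E$-homotopic if one is obtained from the other in finitely many steps, each adding or removing a single point, always keeping the endpoints fixed and keeping an $E$-chain at each stage (in particular $\{p\}$ and $\{p,p\}$ are $E$-homotopic); $[\alpha]_E$ is the class of $\alpha$. $X_E$ is the set of $E$-homotopy classes of $E$-chains starting at $*$, with basepoint $[*]_E$. For an entourage $D\subset E$ let $D^*$ be the set of pairs $([*=x_0,\dots,x_n,y]_E,[*=x_0,\dots,x_n,z]_E)$ with $(y,z)\in D$; $X_E$ carries the uniformity with base $\{D^*:D\subset E\}$. The endpoint map is $\phi_{XE}:X_E\to X$, and for $D\subset E$, $\phi_{ED}:X_D\to X_E$ is $[\alpha]_D\mapsto[\alpha]_E$. $\widetilde{X}=\varprojlim X_E$ (over all entourages, ordered by reverse inclusion, with the inverse limit uniformity and basepoint $([*]_E)_E$), with projections $\phi_E:\widetilde{X}\to X_E$ and $\phi:\widetilde{X}\to X=X_{X\times X}$. $X$ is coverable if its uniformity has a base, containing $X\times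 X$, of entourages $E$ for which $\phi_E$ is surjective; then $\phi:\widetilde X\to X$ is called the universal cover of $X$. Group actions and covers. A group $G$ acting on a uniform space $X$ by uniform homeomorphisms acts isomorphically if the uniformity of $X$ has a base of entourages $E$ with $(g\times g)(E)=E$ for all $g\in G$; it acts discretely if there is an entourage $E$ such that $(g(x),x)\in E$ for some $x\in X$ implies $g=1$; it acts prodiscretely if the action is an inverse limit of discrete actions, i.e. $X=\varprojlim X_\alpha$ (with the inverse limit uniformity, projections surjective), $G=\varprojlim G_\alpha$ over the same directed set, each $G_\alpha$ acts discretely on $X_\alpha$ by uniform homeomorphisms, the bonding maps $X_\beta\to X_\alpha$ (uniformly continuous) are equivariant with respect to the bonding homomorphisms $G_\beta\to G_\alpha$, and $G$ acts coordinatewise. $X/G$ carries the quotient uniformity, with base the images of entourages of $X$. A cover is a map which, up to uniform homeomorphism of the target, is the quotient map $X\to X/G$ of a prodiscrete isomorphic action; $G$ is its covering group. *)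

theory Defs
  imports Complex_Main "HOL-Algebra.Group_Action" "HOL-Algebra.Product_Groups"
begin

text \<open>
  The type class of uniform spaces cannot be used, because the spaces below (chain spaces, inverse
  limits, orbit spaces) depend on entourages and on group actions, not only on types.

  All entourages are symmetric: a uniformity is represented by the set of its symmetric members,
  which determines it.
\<close>

record 'a uspace = "'a partial_object" +
  entourages :: "('a \<times> 'a) set set"

definition uniform_structure :: "'a uspace \<Rightarrow> bool" where
  "uniform_structure X \<longleftrightarrow>
     (\<forall>E\<in>entourages X. E \<subseteq> carrier X \<times> carrier X \<and> sym E \<and> Id_on (carrier X) \<subseteq> E) \<and>
     carrier X \<times> carrier X \<in> entourages X \<and>
     (\<forall>D\<in>entourages X. \<forall>E\<in>entourages X. D \<inter> E \<in> entourages X) \<and>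
     (\<forall>D\<in>entourages X. \<forall>E. D \<subseteq> E \<and> E \<subseteq> carrier X \<times> carrier X \<and> sym E \<longrightarrow> E \<in> entourages X) \<and>
     (\<forall>E\<in>entourages X. \<exists>D\<in>entourages X. D O D \<subseteq> E)"

definition entourage_base :: "'a uspace \<Rightarrow> ('a \<times> 'a) set set \<Rightarrow> bool" where
  "entourage_base X B \<longleftrightarrow> B \<subseteq> entourages X \<and> (\<forall>V\<in>entourages X. \<exists>E\<in>B. E \<subseteq> V)"

definition uspace_of_base :: "'a set \<Rightarrow> ('a \<times> 'a) set set \<Rightarrow> 'a uspace" where
  "uspace_of_base S B =
     \<lparr>carrier = S, entourages = {E. E \<subseteq> S \<times> S \<and> sym E \<and> (\<exists>D\<in>B. D \<subseteq> E)}\<rparr>"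

definition unif_cont :: "'a uspace \<Rightarrow> 'b uspace \<Rightarrow> ('a \<Rightarrow> 'b) \<Rightarrow> bool" where
  "unif_cont X Y f \<longleftrightarrow> f \<in> carrier X \<rightarrow> carrier Y \<and>
     (\<forall>V\<in>entourages Y. \<exists>U\<in>entourages X. \<forall>(x, y)\<in>U. (f x, f y) \<in> V)"

definition unif_homeo :: "'a uspace \<Rightarrow> 'b uspace \<Rightarrow> ('a \<Rightarrow> 'b) \<Rightarrow> bool" where
  "unif_homeo X Y f \<longleftrightarrow> bij_betw f (carrier X) (carrier Y) \<and>
     unif_cont X Y f \<and> unif_cont Y X (inv_into (carrier X) f)"

lemma uniform_structure_uniformity:
  "uniform_structure
     \<lparr>carrier = UNIV,
      entourages = {E :: ('a::uniform_space \<times> 'a) set. sym E \<and> eventually (\<lambda>z. z \<in> E) uniformity}\<rparr>"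
proof -
  let ?U = "{E :: ('a \<times> 'a) set. sym E \<and> eventually (\<lambda>z. z \<in> E) uniformity}"
  have refl: "Id_on UNIV \<subseteq> E" if "E \<in> ?U" for E
    using that uniformity_refl[of "\<lambda>z. z \<in> E"] by auto
  have root: "\<exists>D\<in>?U. D O D \<subseteq> E" if "E \<in> ?U" for E
  proof -
    from that have "eventually (\<lambda>z. z \<in> E) uniformity" by simp
    then obtain P where P: "eventually P uniformity"
      "\<And>x y z. P (x, y) \<Longrightarrow> P (y, z) \<Longrightarrow> (x, z) \<in> E"
      using uniformity_transE by blast
    let ?D = "{(x, y). P (x, y) \<and> P (y, x)}"
    have "eventually (\<lambda>z. z \<in> ?D) uniformity"
      using eventually_conj[OF P(1) uniformity_sym[OF P(1)]] by (simp add: case_prod_unfold)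
    moreover have "sym ?D" by (auto simp: sym_def)
    ultimately show ?thesis using P(2) by (intro bexI[of _ ?D]) auto
  qed
  show ?thesis
    unfolding uniform_structure_def
    using refl root
    by (auto simp: sym_def eventually_conj_iff elim!: eventually_mono)
qed


definition entourage_chain :: "'a uspace \<Rightarrow> ('a \<times> 'a) set \<Rightarrow> 'a \<Rightarrow> 'a \<Rightarrow> 'a list \<Rightarrow> bool" where
  "entourage_chain X E p q xs \<longleftrightarrow> xs \<noteq> [] \<and> set xs \<subseteq> carrier X \<and> hd xs = p \<and> last xs = q \<and>
     successively (\<lambda>x y. (x, y) \<in> E) xs"

definition chain_insert :: "'a uspace \<Rightarrow> ('a \<times> 'a) set \<Rightarrow> 'a list \<Rightarrow> 'a list \<Rightarrow> bool" where
  "chain_insert X E xs ys \<longleftrightarrow>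
     (\<exists>p q. entourage_chain X E p q xs \<and> entourage_chain X E p q ys) \<and>
     (\<exists>us z vs. xs = us @ vs \<and> ys = us @ z # vs)"

definition chain_homotopic :: "'a uspace \<Rightarrow> ('a \<times> 'a) set \<Rightarrow> 'a list \<Rightarrow> 'a list \<Rightarrow> bool" where
  "chain_homotopic X E = equivclp (chain_insert X E)"

definition chain_class :: "'a uspace \<Rightarrow> ('a \<times> 'a) set \<Rightarrow> 'a list \<Rightarrow> 'a list set" where
  "chain_class X E xs = {ys. chain_homotopic X E xs ys}"

definition star_entourage ::
    "'a uspace \<Rightarrow> 'a \<Rightarrow> ('a \<times> 'a) set \<Rightarrow> ('a \<times> 'a) set \<Rightarrow> ('a list set \<times> 'a list set) set" where
  "star_entourage X p E D =
     {(chain_class X E (xs @ [y]), chain_class X E (xs @ [z])) | xs y z.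
        xs \<noteq> [] \<and> entourage_chain X E p y (xs @ [y]) \<and> entourage_chain X E p z (xs @ [z]) \<and> (y, z) \<in> D}"

definition chain_space :: "'a uspace \<Rightarrow> 'a \<Rightarrow> ('a \<times> 'a) set \<Rightarrow> 'a list set uspace" where
  "chain_space X p E =
     uspace_of_base {chain_class X E xs | xs q. entourage_chain X E p q xs}
       {star_entourage X p E D | D. D \<in> entourages X \<and> D \<subseteq> E}"

text \<open>
  The maps on homotopy classes induced by the identity on chains and by the endpoint. In
  \<open>chain_bonding\<close>, for \<open>D \<subseteq> E\<close>, all the classes united are equal.
\<close>

definition chain_bonding :: "'a uspace \<Rightarrow> ('a \<times> 'a) set \<Rightarrow> 'a list set \<Rightarrow> 'a list set" where
  "chain_bonding X E C = (\<Union>xs\<in>C. chain_class X E xs)"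

definition endpoint :: "'a list set \<Rightarrow> 'a" where
  "endpoint C = the_elem (last ` C)"

text \<open>
  Inverse limits over a set \<open>I\<close> preordered by \<open>leq\<close>; for \<open>leq i j\<close> the bonding map \<open>b i j\<close> goes from
  index \<open>j\<close> to index \<open>i\<close>. The uniformity is the one induced by the product.
\<close>

definition threads ::
    "'i set \<Rightarrow> ('i \<Rightarrow> 'i \<Rightarrow> bool) \<Rightarrow> ('i \<Rightarrow> 'x set) \<Rightarrow> ('i \<Rightarrow> 'i \<Rightarrow> 'x \<Rightarrow> 'x) \<Rightarrow> ('i \<Rightarrow> 'x) set" where
  "threads I leq S b =
     {c \<in> (\<Pi>\<^sub>E i\<in>I. S i). \<forall>i\<in>I. \<forall>j\<in>I. leq i j \<longrightarrow> b i j (c j) = c i}"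

definition uspace_limit ::
    "'i set \<Rightarrow> ('i \<Rightarrow> 'i \<Rightarrow> bool) \<Rightarrow> ('i \<Rightarrow> 'x uspace) \<Rightarrow> ('i \<Rightarrow> 'i \<Rightarrow> 'x \<Rightarrow> 'x) \<Rightarrow> ('i \<Rightarrow> 'x) uspace" where
  "uspace_limit I leq S b =
     (let T = threads I leq (\<lambda>i. carrier (S i)) b in
      uspace_of_base T
        {{(c, d) \<in> T \<times> T. \<forall>i\<in>J. (c i, d i) \<in> V i} | J V.
           finite J \<and> J \<subseteq> I \<and> (\<forall>i\<in>J. V i \<in> entourages (S i))})"

definition group_limit ::
    "'i set \<Rightarrow> ('i \<Rightarrow> 'i \<Rightarrow> bool) \<Rightarrow> ('i \<Rightarrow> 'h monoid) \<Rightarrow> ('i \<Rightarrow> 'i \<Rightarrow> 'h \<Rightarrow> 'h) \<Rightarrow> ('i \<Rightarrow> 'h) monoid" where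
  "group_limit I leq H \<theta> =
     (product_group I H) \<lparr>carrier := threads I leq (\<lambda>i. carrier (H i)) \<theta>\<rparr>"

definition tilde :: "'a uspace \<Rightarrow> 'a \<Rightarrow> (('a \<times> 'a) set \<Rightarrow> 'a list set) uspace" where
  "tilde X p =
     uspace_limit (entourages X) (\<lambda>E D. D \<subseteq> E) (chain_space X p) (\<lambda>E D. chain_bonding X E)"

definition tilde_base :: "'a uspace \<Rightarrow> 'a \<Rightarrow> ('a \<times> 'a) set \<Rightarrow> 'a list set" where
  "tilde_base X p = (\<lambda>E\<in>entourages X. chain_class X E [p])"

text \<open>
  The projection to the coordinate \<open>carrier X \<times> carrier X\<close>, where homotopy classes of chains
  correspond to points of \<open>X\<close> by the endpoint map.
\<close>

definition tilde_proj :: "'a uspace \<Rightarrow> (('a \<times> 'a) set \<Rightarrow> 'a list set) \<Rightarrow> 'a" where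
  "tilde_proj X c = endpoint (c (carrier X \<times> carrier X))"

definition coverable :: "'a uspace \<Rightarrow> 'a \<Rightarrow> bool" where
  "coverable X p \<longleftrightarrow>
     (\<exists>B. entourage_base X B \<and> carrier X \<times> carrier X \<in> B \<and>
          (\<forall>E\<in>B. (\<lambda>c. c E) ` carrier (tilde X p) = carrier (chain_space X p E)))"


definition acts_uniformly :: "('g, 'm) monoid_scheme \<Rightarrow> 'a uspace \<Rightarrow> ('g \<Rightarrow> 'a \<Rightarrow> 'a) \<Rightarrow> bool" where
  "acts_uniformly G X a \<longleftrightarrow>
     group_action G (carrier X) a \<and> (\<forall>g\<in>carrier G. unif_homeo X X (a g))"

definition acts_isomorphically :: "('g, 'm) monoid_scheme \<Rightarrow> 'a uspace \<Rightarrow> ('g \<Rightarrow> 'a \<Rightarrow> 'a) \<Rightarrow> bool" where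
  "acts_isomorphically G X a \<longleftrightarrow> acts_uniformly G X a \<and>
     (\<exists>B. entourage_base X B \<and> (\<forall>E\<in>B. \<forall>g\<in>carrier G. map_prod (a g) (a g) ` E = E))"

definition acts_discretely :: "('g, 'm) monoid_scheme \<Rightarrow> 'a uspace \<Rightarrow> ('g \<Rightarrow> 'a \<Rightarrow> 'a) \<Rightarrow> bool" where
  "acts_discretely G X a \<longleftrightarrow> acts_uniformly G X a \<and>
     (\<exists>E\<in>entourages X. \<forall>g\<in>carrier G. (\<exists>x\<in>carrier X. (a g x, x) \<in> E) \<longrightarrow> g = \<one>\<^bsub>G\<^esub>)"

definition directed_set :: "'i set \<Rightarrow> ('i \<Rightarrow> 'i \<Rightarrow> bool) \<Rightarrow> bool" where
  "directed_set I leq \<longleftrightarrow> I \<noteq> {} \<and> (\<forall>i\<in>I. leq i i) \<and>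
     (\<forall>i\<in>I. \<forall>j\<in>I. \<forall>k\<in>I. leq i j \<and> leq j k \<longrightarrow> leq i k) \<and>
     (\<forall>i\<in>I. \<forall>j\<in>I. \<exists>k\<in>I. leq i k \<and> leq j k)"

definition compatible_bonding ::
    "'i set \<Rightarrow> ('i \<Rightarrow> 'i \<Rightarrow> bool) \<Rightarrow> ('i \<Rightarrow> 'x set) \<Rightarrow> ('i \<Rightarrow> 'i \<Rightarrow> 'x \<Rightarrow> 'x) \<Rightarrow> bool" where
  "compatible_bonding I leq S b \<longleftrightarrow>
     (\<forall>i\<in>I. \<forall>x\<in>S i. b i i x = x) \<and>
     (\<forall>i\<in>I. \<forall>j\<in>I. \<forall>k\<in>I. leq i j \<and> leq j k \<longrightarrow> (\<forall>x\<in>S k. b i j (b j k x) = b i k x))"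

text \<open>
  \<open>(S, b)\<close> is an inverse system of uniform spaces, \<open>(H, \<theta>)\<close> an inverse system of groups and \<open>a i\<close> an
  action of \<open>H i\<close> on \<open>S i\<close>.
\<close>

definition discrete_action_system ::
    "'i set \<Rightarrow> ('i \<Rightarrow> 'i \<Rightarrow> bool) \<Rightarrow> ('i \<Rightarrow> 'x uspace) \<Rightarrow> ('i \<Rightarrow> 'i \<Rightarrow> 'x \<Rightarrow> 'x) \<Rightarrow>
     ('i \<Rightarrow> 'h monoid) \<Rightarrow> ('i \<Rightarrow> 'i \<Rightarrow> 'h \<Rightarrow> 'h) \<Rightarrow> ('i \<Rightarrow> 'h \<Rightarrow> 'x \<Rightarrow> 'x) \<Rightarrow> bool" where
  "discrete_action_system I leq S b H \<theta> a \<longleftrightarrow>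
     directed_set I leq \<and>
     (\<forall>i\<in>I. uniform_structure (S i)) \<and>
     compatible_bonding I leq (\<lambda>i. carrier (S i)) b \<and>
     (\<forall>i\<in>I. \<forall>j\<in>I. leq i j \<longrightarrow> unif_cont (S j) (S i) (b i j)) \<and>
     (\<forall>i\<in>I. group (H i)) \<and>
     compatible_bonding I leq (\<lambda>i. carrier (H i)) \<theta> \<and>
     (\<forall>i\<in>I. \<forall>j\<in>I. leq i j \<longrightarrow> \<theta> i j \<in> hom (H j) (H i)) \<and>
     (\<forall>i\<in>I. acts_discretely (H i) (S i) (a i)) \<and>
     (\<forall>i\<in>I. \<forall>j\<in>I. leq i j \<longrightarrow>
        (\<forall>h\<in>carrier (H j). \<forall>x\<in>carrier (S j). b i j (a j h x) = a i (\<theta> i j h) (b i j x)))"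

text \<open>
  An existential quantifier cannot range over types. The first argument therefore records the types
  supplying the indices, the points of the spaces and the elements of the groups of the system.
  The identifications with the limits are the maps \<open>\<Phi>\<close> and \<open>\<Psi>\<close>, so that \<open>\<lambda>x. \<Phi> x i\<close> is the
  projection to \<open>S i\<close>.
\<close>

definition acts_prodiscretely ::
    "('i \<times> 'x \<times> 'h) itself \<Rightarrow> ('g, 'm) monoid_scheme \<Rightarrow> 'a uspace \<Rightarrow> ('g \<Rightarrow> 'a \<Rightarrow> 'a) \<Rightarrow> bool" where
  "acts_prodiscretely (U :: ('i \<times> 'x \<times> 'h) itself) G X act \<longleftrightarrow>
     group G \<and> acts_uniformly G X act \<and>
     (\<exists>(I :: 'i set) leq (S :: 'i \<Rightarrow> 'x uspace) b (H :: 'i \<Rightarrow> 'h monoid) \<theta> a \<Phi> \<Psi>.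
        discrete_action_system I leq S b H \<theta> a \<and>
        unif_homeo X (uspace_limit I leq S b) \<Phi> \<and>
        (\<forall>i\<in>I. (\<lambda>x. \<Phi> x i) ` carrier X = carrier (S i)) \<and>
        \<Psi> \<in> iso G (group_limit I leq H \<theta>) \<and>
        (\<forall>g\<in>carrier G. \<forall>x\<in>carrier X. \<forall>i\<in>I. \<Phi> (act g x) i = a i (\<Psi> g i) (\<Phi> x i)))"

definition orbit_space :: "('g, 'm) monoid_scheme \<Rightarrow> 'a uspace \<Rightarrow> ('g \<Rightarrow> 'a \<Rightarrow> 'a) \<Rightarrow> 'a set uspace" where
  "orbit_space G X act =
     uspace_of_base (orbits G (carrier X) act)
       {map_prod (orbit G act) (orbit G act) ` E | E. E \<in> entourages X}"

text \<open>The last component of the first argument is the type of the elements of the covering group.\<close>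

definition is_cover ::
    "('i \<times> 'x \<times> 'h \<times> 'g) itself \<Rightarrow> 'a uspace \<Rightarrow> 'b uspace \<Rightarrow> ('a \<Rightarrow> 'b) \<Rightarrow> bool" where
  "is_cover (U :: ('i \<times> 'x \<times> 'h \<times> 'g) itself) X Y f \<longleftrightarrow>
     (\<exists>(G :: 'g monoid) act h.
        acts_isomorphically G X act \<and>
        acts_prodiscretely TYPE('i \<times> 'x \<times> 'h) G X act \<and>
        unif_homeo (orbit_space G X act) Y h \<and>
        (\<forall>x\<in>carrier X. f x = h (orbit G act x)))"

end

theory Submission
  imports Defs
begin

text \<open>
  The lift is \<open>f\<^sub>B = \<phi>\<^sub>X \<circ> F\<^sup>-\<^sup>1\<close>, where \<open>F\<close> is the map from \<open>tilde X p\<close> to \<open>tilde Y q\<close> that applies \<open>f\<close> to chains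
  (\<open>tilde_map\<close>) and \<open>\<phi>\<^sub>X\<close> is the endpoint map of \<open>tilde X p\<close>. Three facts make this work: \<open>F\<close> is a uniform
  homeomorphism, \<open>\<phi>\<^sub>X\<close> is a cover, and lifts on \<open>tilde Y q\<close> are determined by one value.

  The first fact (\<open>f_tilde_homeo\<close>) rests on lifting chains from \<open>Y\<close> to \<open>X\<close>. If \<open>D\<close> is an entourage of \<open>X\<close>
  invariant under the covering group \<open>G\<close>, every chain in the image of \<open>D\<close> lifts to a \<open>D\<close>-chain. As \<open>G\<close>
  is only an inverse limit of discretely acting groups, the lift is not unique, but for small
  \<open>D\<close> two lifts differ point by point by elements of the kernel of the projection of \<open>G\<close> to one of
  these groups. Far enough in the inverse system the orbits of this kernel are smaller than any given entourage \<open>E\<close>. Hence \<open>D\<close>-chains with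
  homotopic images are \<open>E\<close>-homotopic, up to a last step in \<open>E\<close> that joins their endpoints
  (\<open>homotopy_lifting\<close>). In the limit over \<open>E\<close> the ambiguity of the endpoint disappears: an element of
  \<open>G\<close> that is trivial in every discrete level is trivial, which makes \<open>F\<close> injective
  (\<open>fibre_separated\<close>), and a compatible family of elements of the levels comes from an element of \<open>G\<close>,
  which makes \<open>F\<close> surjective (\<open>fibre_complete\<close>).

  For the second fact (\<open>universal_cover_is_cover\<close>), the classes of \<open>E\<close>-loops act on the space of classes of
  \<open>E\<close>-chains by concatenation. The action is discrete, because a loop that moves a class by less than
  \<open>E\<close> fixes it and then cancels. The limit of these actions over a base as in the
  definition of a coverable space has the fibres of \<open>\<phi>\<^sub>X\<close> as orbits. Covers may be composed with uniform
  homeomorphisms of their domain (\<open>is_cover_comp_homeo\<close>), so \<open>f\<^sub>B\<close> is a cover.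

  Uniqueness holds because \<open>tilde Y q\<close> is chain connected (\<open>tilde_chain_connected\<close>; coverability
  of \<open>Y\<close> enters here) and two lifts stay related along a sufficiently fine chain (\<open>lifts_agree\<close>).
\<close>

section \<open>Uniform structures given by symmetric entourages\<close>

locale unif_space =
  fixes X :: "'a uspace"
  assumes uniform_structure: "uniform_structure X"
begin

lemma entourage_props:
  "E \<in> entourages X \<Longrightarrow> E \<subseteq> carrier X \<times> carrier X \<and> sym E \<and> Id_on (carrier X) \<subseteq> E"
  using uniform_structure by (simp add: uniform_structure_def)

lemma entourage_carrier:
  assumes "E \<in> entourages X" and "(x, y) \<in> E"
  shows "x \<in> carrier X" and "y \<in> carrier X"
  using entourage_props[OF assms(1)] assms(2) by auto

lemma entourage_sym: "E \<in> entourages X \<Longrightarrow> (x, y) \<in> E \<Longrightarrow> (y, x) \<in> E"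
  using entourage_props by (meson symD)

lemma entourage_refl: "E \<in> entourages X \<Longrightarrow> x \<in> carrier X \<Longrightarrow> (x, x) \<in> E"
  using entourage_props by (meson Id_onI subsetD)

lemma entourage_top: "carrier X \<times> carrier X \<in> entourages X"
  using uniform_structure by (simp add: uniform_structure_def)

lemma entourage_Int: "D \<in> entourages X \<Longrightarrow> E \<in> entourages X \<Longrightarrow> D \<inter> E \<in> entourages X"
proof -
  have "\<forall>D\<in>entourages X. \<forall>E\<in>entourages X. D \<inter> E \<in> entourages X"
    using uniform_structure unfolding uniform_structure_def by (elim conjE)
  then show "D \<in> entourages X \<Longrightarrow> E \<in> entourages X \<Longrightarrow> D \<inter> E \<in> entourages X"
    by simp
qed

lemma entourage_superset:
  "D \<in> entourages X \<Longrightarrow> D \<subseteq> E \<Longrightarrow> E \<subseteq> carrier X \<times> carrier X \<Longrightarrow> sym E \<Longrightarrow> E \<in> entourages X"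
proof -
  have "\<forall>D\<in>entourages X. \<forall>E. D \<subseteq> E \<and> E \<subseteq> carrier X \<times> carrier X \<and> sym E \<longrightarrow> E \<in> entourages X"
    using uniform_structure unfolding uniform_structure_def by (elim conjE)
  then show "D \<in> entourages X \<Longrightarrow> D \<subseteq> E \<Longrightarrow> E \<subseteq> carrier X \<times> carrier X \<Longrightarrow> sym E \<Longrightarrow> E \<in> entourages X"
    by simp
qed

lemma entourage_half:
  assumes "E \<in> entourages X"
  obtains D where "D \<in> entourages X" and "D \<subseteq> E"
    and "\<And>x y z. (x, y) \<in> D \<Longrightarrow> (y, z) \<in> D \<Longrightarrow> (x, z) \<in> E"
proof -
  obtain D where D: "D \<in> entourages X" "D O D \<subseteq> E"
    using uniform_structure assms unfolding uniform_structure_def by metis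
  moreover have "D \<subseteq> E"
  proof (rule subrelI)
    fix x y assume "(x, y) \<in> D"
    then show "(x, y) \<in> E"
      using D(2) entourage_refl[OF D(1)] entourage_carrier(1)[OF D(1)] by blast
  qed
  ultimately show thesis
    using that by blast
qed

lemma entourage_third:
  assumes "E \<in> entourages X"
  obtains D where "D \<in> entourages X" and "D \<subseteq> E"
    and "\<And>x y z. (x, y) \<in> D \<Longrightarrow> (y, z) \<in> D \<Longrightarrow> (x, z) \<in> E"
    and "\<And>w x y z. (w, x) \<in> D \<Longrightarrow> (x, y) \<in> D \<Longrightarrow> (y, z) \<in> D \<Longrightarrow> (w, z) \<in> E"
proof -
  obtain C where C: "C \<in> entourages X" "C \<subseteq> E"
    "\<And>x y z. (x, y) \<in> C \<Longrightarrow> (y, z) \<in> C \<Longrightarrow> (x, z) \<in> E"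
    using entourage_half[OF assms] by blast
  obtain D where D: "D \<in> entourages X" "D \<subseteq> C"
    "\<And>x y z. (x, y) \<in> D \<Longrightarrow> (y, z) \<in> D \<Longrightarrow> (x, z) \<in> C"
    using entourage_half[OF C(1)] by blast
  show thesis
    by (rule that[of D]) (use C D in blast)+
qed

end

lemma carrier_uspace_of_base [simp]: "carrier (uspace_of_base S B) = S"
  by (simp add: uspace_of_base_def)

lemma entourages_uspace_of_base:
  "E \<in> entourages (uspace_of_base S B) \<longleftrightarrow> E \<subseteq> S \<times> S \<and> sym E \<and> (\<exists>D\<in>B. D \<subseteq> E)"
  by (simp add: uspace_of_base_def)

lemma unif_contI:
  assumes "\<And>x. x \<in> carrier X \<Longrightarrow> f x \<in> carrier Y"
    and "\<And>V. V \<in> entourages Y \<Longrightarrow> \<exists>U\<in>entourages X. \<forall>x y. (x, y) \<in> U \<longrightarrow> (f x, f y) \<in> V"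
  shows "unif_cont X Y f"
proof -
  have "f \<in> carrier X \<rightarrow> carrier Y" using assms(1) by (rule Pi_I)
  moreover have "\<exists>U\<in>entourages X. \<forall>(x, y)\<in>U. (f x, f y) \<in> V" if "V \<in> entourages Y" for V
    using assms(2)[OF that] by (metis (no_types, lifting) case_prodI2)
  ultimately show ?thesis
    unfolding unif_cont_def by (intro conjI ballI)
qed

lemma unif_contD:
  assumes "unif_cont X Y f"
  shows "x \<in> carrier X \<Longrightarrow> f x \<in> carrier Y"
    and "V \<in> entourages Y \<Longrightarrow> \<exists>U\<in>entourages X. \<forall>x y. (x, y) \<in> U \<longrightarrow> (f x, f y) \<in> V"
proof -
  show "f x \<in> carrier Y" if "x \<in> carrier X"
    using assms that unfolding unif_cont_def by blast
  assume "V \<in> entourages Y"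
  then obtain U where "U \<in> entourages X" "\<forall>(x, y)\<in>U. (f x, f y) \<in> V"
    using assms unfolding unif_cont_def by blast
  then show "\<exists>U\<in>entourages X. \<forall>x y. (x, y) \<in> U \<longrightarrow> (f x, f y) \<in> V"
    by (intro bexI[of _ U]) auto
qed

lemma unif_cont_comp:
  assumes f: "unif_cont X Y f" and g: "unif_cont Y Z g"
  shows "unif_cont X Z (\<lambda>x. g (f x))"
proof (rule unif_contI)
  show "g (f x) \<in> carrier Z" if "x \<in> carrier X" for x
    using that unif_contD(1)[OF f] unif_contD(1)[OF g] by blast
  fix V assume "V \<in> entourages Z"
  then obtain W where "W \<in> entourages Y" "\<forall>x y. (x, y) \<in> W \<longrightarrow> (g x, g y) \<in> V"
    using unif_contD(2)[OF g] by blast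
  then show "\<exists>U\<in>entourages X. \<forall>x y. (x, y) \<in> U \<longrightarrow> (g (f x), g (f y)) \<in> V"
    using unif_contD(2)[OF f] by metis
qed

lemma unif_cont_cong:
  assumes "uniform_structure X" and "unif_cont X Y f" and "\<And>x. x \<in> carrier X \<Longrightarrow> f x = g x"
  shows "unif_cont X Y g"
proof -
  interpret unif_space X by unfold_locales fact
  show ?thesis
  proof (rule unif_contI)
    show "g x \<in> carrier Y" if "x \<in> carrier X" for x
      using that unif_contD(1)[OF assms(2)] assms(3) by metis
    fix V assume "V \<in> entourages Y"
    then obtain U where "U \<in> entourages X" "\<forall>x y. (x, y) \<in> U \<longrightarrow> (f x, f y) \<in> V"
      using unif_contD(2)[OF assms(2)] by blast
    then show "\<exists>U\<in>entourages X. \<forall>x y. (x, y) \<in> U \<longrightarrow> (g x, g y) \<in> V"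
      using assms(3) entourage_carrier by metis
  qed
qed

lemma unif_homeoI:
  assumes X: "uniform_structure X" and Y: "uniform_structure Y"
    and f: "unif_cont X Y f" and g: "unif_cont Y X g"
    and gf: "\<And>x. x \<in> carrier X \<Longrightarrow> g (f x) = x" and fg: "\<And>y. y \<in> carrier Y \<Longrightarrow> f (g y) = y"
  shows "unif_homeo X Y f"
proof -
  have bij: "bij_betw f (carrier X) (carrier Y)"
    by (rule bij_betw_byWitness[where f' = g])
      (use gf fg unif_contD(1)[OF f] unif_contD(1)[OF g] in auto)
  have "inv_into (carrier X) f y = g y" if "y \<in> carrier Y" for y
    using that bij fg unif_contD(1)[OF g that] by (metis bij_betw_def inv_into_f_f)
  then have "unif_cont Y X (inv_into (carrier X) f)"
    by (intro unif_cont_cong[OF Y g]) simp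
  with bij f show ?thesis
    unfolding unif_homeo_def by simp
qed

lemma unif_homeoE:
  assumes "unif_homeo X Y f"
  obtains g where "unif_cont X Y f" "unif_cont Y X g"
    "\<And>x. x \<in> carrier X \<Longrightarrow> g (f x) = x" "\<And>y. y \<in> carrier Y \<Longrightarrow> f (g y) = y"
proof -
  have bij: "bij_betw f (carrier X) (carrier Y)"
    using assms unfolding unif_homeo_def by blast
  show thesis
    by (rule that[of "inv_into (carrier X) f"])
      (use assms bij_betw_inv_into_left[OF bij] bij_betw_inv_into_right[OF bij]
        in \<open>auto simp: unif_homeo_def\<close>)
qed

section \<open>Chains and their homotopies\<close>

lemma entourage_chainD:
  assumes "entourage_chain X E p q xs"
  shows "xs \<noteq> []" "set xs \<subseteq> carrier X" "hd xs = p" "last xs = q" "p \<in> carrier X" "q \<in> carrier X"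
  using assms unfolding entourage_chain_def by auto

lemma entourage_chain_mono: "entourage_chain X D p q xs \<Longrightarrow> D \<subseteq> E \<Longrightarrow> entourage_chain X E p q xs"
  unfolding entourage_chain_def by (auto elim: successively_mono)

lemma entourage_chain_append_iff:
  assumes "xs \<noteq> []" and "ys \<noteq> []"
  shows "entourage_chain X E p q (xs @ ys) \<longleftrightarrow>
    entourage_chain X E p (last xs) xs \<and> entourage_chain X E (hd ys) q ys \<and> (last xs, hd ys) \<in> E"
  using assms unfolding entourage_chain_def by (auto simp: successively_append_iff)

lemma entourage_chain_Cons_iff:
  "entourage_chain X E p q (x # ys) \<longleftrightarrow>
    x = p \<and> x \<in> carrier X \<and> (if ys = [] then x = q else entourage_chain X E (hd ys) q ys \<and> (x, hd ys) \<in> E)"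
  unfolding entourage_chain_def by (auto simp: successively_Cons)

lemma entourage_chain_Nil [simp]: "\<not> entourage_chain X E p q []"
  by (simp add: entourage_chain_def)

lemma entourage_chain_singleton [simp]:
  "entourage_chain X E p q [x] \<longleftrightarrow> x = p \<and> x = q \<and> x \<in> carrier X"
  by (auto simp: entourage_chain_Cons_iff)

lemma entourage_chain_snoc_iff:
  "xs \<noteq> [] \<Longrightarrow> entourage_chain X E p q (xs @ [y]) \<longleftrightarrow>
    entourage_chain X E p (last xs) xs \<and> y = q \<and> y \<in> carrier X \<and> (last xs, y) \<in> E"
  by (subst entourage_chain_append_iff) auto

lemma entourage_chain_rev:
  "entourage_chain X E p q xs \<Longrightarrow> sym E \<Longrightarrow> entourage_chain X E q p (rev xs)"
  unfolding entourage_chain_def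
  by (auto simp: hd_rev last_rev sym_def elim: successively_mono)

lemma chain_homotopic_refl [simp]: "chain_homotopic X E xs xs"
  by (simp add: chain_homotopic_def)

lemma chain_homotopic_sym: "chain_homotopic X E xs ys \<Longrightarrow> chain_homotopic X E ys xs"
  by (simp add: chain_homotopic_def equivclp_sym)

lemma chain_homotopic_trans [trans]:
  "chain_homotopic X E xs ys \<Longrightarrow> chain_homotopic X E ys zs \<Longrightarrow> chain_homotopic X E xs zs"
  unfolding chain_homotopic_def by (rule equivclp_trans)

lemma chain_homotopic_insert:
  assumes "entourage_chain X E p q (us @ vs)" and "entourage_chain X E p q (us @ z # vs)"
  shows "chain_homotopic X E (us @ vs) (us @ z # vs)"
  unfolding chain_homotopic_def
  by (rule r_into_equivclp) (use assms in \<open>auto simp: chain_insert_def\<close>)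

lemma chain_insertE:
  assumes "chain_insert X E xs ys"
  obtains p q us z vs where "entourage_chain X E p q xs" "entourage_chain X E p q ys"
    "xs = us @ vs" "ys = us @ z # vs"
  using assms unfolding chain_insert_def by metis

lemma chain_homotopic_chain_iff:
  assumes "chain_homotopic X E xs ys"
  shows "entourage_chain X E p q xs \<longleftrightarrow> entourage_chain X E p q ys"
  using assms unfolding chain_homotopic_def
proof (induction rule: equivclp_induct)
  case (step us vs)
  have "entourage_chain X E p q as \<longleftrightarrow> entourage_chain X E p q bs" if "chain_insert X E as bs" for as bs
    using that by (rule chain_insertE) (metis entourage_chainD(3,4))
  then show ?case
    using step by blast
qed simp

lemma chain_homotopic_map:
  assumes "chain_homotopic X D xs ys"
    and "\<And>zs p q. entourage_chain X D p q zs \<Longrightarrow> entourage_chain Y E (f p) (f q) (map f zs)"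
  shows "chain_homotopic Y E (map f xs) (map f ys)"
  using assms(1) unfolding chain_homotopic_def
proof (induction rule: equivclp_induct)
  case (step y z)
  have "chain_insert Y E (map f a) (map f b)" if "chain_insert X D a b" for a b
  proof -
    obtain p q us w vs where ab: "entourage_chain X D p q a" "entourage_chain X D p q b"
      "a = us @ vs" "b = us @ w # vs"
      using \<open>chain_insert X D a b\<close> by (elim chain_insertE)
    then have "map f a = map f us @ map f vs" "map f b = map f us @ f w # map f vs"
      by simp_all
    then show ?thesis
      unfolding chain_insert_def using assms(2)[OF ab(1)] assms(2)[OF ab(2)] by metis
  qed
  then show ?case
    using step by (meson equivclp_into_equivclp)
qed simp

lemma chain_homotopic_mono:
  "chain_homotopic X D xs ys \<Longrightarrow> D \<subseteq> E \<Longrightarrow> chain_homotopic X E xs ys"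
  using chain_homotopic_map[of X D xs ys X E id] by (auto intro: entourage_chain_mono)

lemma chain_homotopic_append:
  assumes "chain_homotopic X E xs ys" and "entourage_chain X E p q (as @ xs @ bs)"
  shows "chain_homotopic X E (as @ xs @ bs) (as @ ys @ bs)"
proof -
  have chain: "entourage_chain X E r s (as @ us @ bs) \<longleftrightarrow> entourage_chain X E r s (as @ vs @ bs)"
    if "chain_insert X E us vs" for us vs r s
  proof -
    obtain k l where *: "entourage_chain X E k l us" "entourage_chain X E k l vs"
      using \<open>chain_insert X E us vs\<close> by (elim chain_insertE)
    then show ?thesis
      unfolding entourage_chain_def by (auto simp: successively_append_iff hd_append last_append)
  qed
  have "equivclp (chain_insert X E) (as @ xs @ bs) (as @ ys @ bs) \<and> entourage_chain X E p q (as @ ys @ bs)"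
    using assms unfolding chain_homotopic_def
  proof (induction rule: equivclp_induct)
    case (step us vs)
    have *: "entourage_chain X E p q (as @ us @ bs)" "entourage_chain X E p q (as @ vs @ bs)"
      using step(2,3,4) chain by blast+
    have "chain_insert X E (as @ us @ bs) (as @ vs @ bs)"
      if "chain_insert X E us vs" "entourage_chain X E p q (as @ us @ bs)"
        "entourage_chain X E p q (as @ vs @ bs)" for us vs
    proof -
      obtain cs z ds where "us = cs @ ds" "vs = cs @ z # ds"
        using \<open>chain_insert X E us vs\<close> unfolding chain_insert_def by blast
      then show ?thesis
        unfolding chain_insert_def using that(2,3)
        by (metis (no_types) append.assoc append_Cons)
    qed
    then show ?case
      using step * by (meson equivclp_into_equivclp)
  qed auto
  then show ?thesis unfolding chain_homotopic_def ..
qed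

lemma chain_homotopic_append_right:
  "chain_homotopic X E xs ys \<Longrightarrow> entourage_chain X E p q (xs @ bs) \<Longrightarrow>
    chain_homotopic X E (xs @ bs) (ys @ bs)"
  using chain_homotopic_append[of X E xs ys p q "[]"] by simp

lemma chain_homotopic_append_left:
  "chain_homotopic X E xs ys \<Longrightarrow> entourage_chain X E p q (as @ xs) \<Longrightarrow>
    chain_homotopic X E (as @ xs) (as @ ys)"
  using chain_homotopic_append[of X E xs ys p q as "[]"] by simp

lemma chain_class_self [simp]: "xs \<in> chain_class X E xs"
  by (simp add: chain_class_def)

lemma chain_class_eq_iff: "chain_class X E xs = chain_class X E ys \<longleftrightarrow> chain_homotopic X E xs ys"
  unfolding chain_class_def by (auto intro: chain_homotopic_sym chain_homotopic_trans)

lemma chain_class_eqI: "ys \<in> chain_class X E xs \<Longrightarrow> chain_class X E ys = chain_class X E xs"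
  using chain_class_eq_iff[of X E xs ys] by (auto simp: chain_class_def)

lemma chain_class_chain_iff:
  "ys \<in> chain_class X E xs \<Longrightarrow> entourage_chain X E p q ys \<longleftrightarrow> entourage_chain X E p q xs"
  unfolding chain_class_def using chain_homotopic_chain_iff by fastforce

lemma endpoint_chain_class:
  assumes "entourage_chain X E p q xs"
  shows "endpoint (chain_class X E xs) = q"
proof -
  have "last ys = q" if "ys \<in> chain_class X E xs" for ys
    using that assms chain_class_chain_iff entourage_chainD(4) by metis
  then have "last ` chain_class X E xs = (\<lambda>_. q) ` chain_class X E xs"
    by (intro image_cong) auto
  also have "\<dots> = {q}"
    using chain_class_self by (rule image_constant)
  finally have "last ` chain_class X E xs = {q}" .
  then show ?thesis
    by (simp add: endpoint_def)
qed

lemma chain_bonding_class: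
  "D \<subseteq> E \<Longrightarrow> chain_bonding X E (chain_class X D xs) = chain_class X E xs"
proof -
  assume "D \<subseteq> E"
  then have "chain_class X E ys = chain_class X E xs" if "ys \<in> chain_class X D xs" for ys
    using that chain_homotopic_mono[of X D xs ys E] chain_class_eq_iff[of X E xs ys]
    by (simp add: chain_class_def)
  then show ?thesis
    unfolding chain_bonding_def using chain_class_self by fast
qed

context unif_space
begin

lemma chain_homotopic_snoc_last:
  assumes "E \<in> entourages X" and "entourage_chain X E p q xs"
  shows "chain_homotopic X E (xs @ [q]) xs"
proof -
  note c = entourage_chainD[OF assms(2)]
  have "entourage_chain X E p q (xs @ [q])"
    using c assms by (auto simp: entourage_chain_snoc_iff entourage_refl)
  then show ?thesis
    using chain_homotopic_insert[of X E p q xs "[]" q] assms by (auto intro: chain_homotopic_sym)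
qed

lemma chain_homotopic_Cons_hd:
  assumes "E \<in> entourages X" and "entourage_chain X E p q xs"
  shows "chain_homotopic X E (p # xs) xs"
proof -
  note c = entourage_chainD[OF assms(2)]
  have "entourage_chain X E p q (p # xs)"
    using c assms by (auto simp: entourage_chain_Cons_iff entourage_refl)
  then show ?thesis
    using chain_homotopic_insert[of X E p q "[]" xs p] assms by (auto intro: chain_homotopic_sym)
qed

lemma chain_homotopic_skip:
  assumes "entourage_chain X E p y (xs @ [y])" and "(y, z) \<in> E" and "(last xs, z) \<in> E" and "xs \<noteq> []"
    and "z \<in> carrier X"
  shows "chain_homotopic X E (xs @ [y, z]) (xs @ [z])"
proof -
  have "entourage_chain X E p z (xs @ [z])" "entourage_chain X E p z (xs @ [y, z])"
    using assms entourage_chain_snoc_iff[of "xs @ [y]" X E p z z] 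
    by (auto simp: entourage_chain_snoc_iff)
  then show ?thesis
    using chain_homotopic_insert[of X E p z xs "[z]" y] by (auto intro: chain_homotopic_sym)
qed

text \<open>Walking along a chain and back is contractible: cancel from the turning point outwards.\<close>

lemma chain_homotopic_backtrack:
  assumes "E \<in> entourages X" and "entourage_chain X E p q xs"
  shows "chain_homotopic X E (xs @ rev xs) [p]"
  using assms(2)
proof (induction xs arbitrary: p)
  case (Cons x xs)
  have x: "x = p" "p \<in> carrier X" using Cons.prems by (auto simp: entourage_chain_Cons_iff)
  have pp: "chain_homotopic X E [p, p] [p]"
    using chain_homotopic_snoc_last[OF assms(1), of p p "[p]"] x by simp
  show ?case
  proof (cases "xs = []")
    case False
    then have xs: "entourage_chain X E (hd xs) q xs" and px: "(p, hd xs) \<in> E"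
      using Cons.prems x by (auto simp: entourage_chain_Cons_iff)
    have xp: "(hd xs, p) \<in> E" using entourage_sym[OF assms(1) px] .
    have hd: "hd xs \<in> carrier X" using entourage_chainD[OF xs] by simp
    have qq: "(q, q) \<in> E" using entourage_refl[OF assms(1)] entourage_chainD[OF xs] by blast
    have rev: "entourage_chain X E q (hd xs) (rev xs)"
      using entourage_chain_rev[OF xs] entourage_sym[OF assms(1)] by (auto simp: sym_def)
    have long: "entourage_chain X E p p ([p] @ (xs @ rev xs) @ [p])"
      using False xs rev px xp qq hd x entourage_chainD[OF xs] entourage_chainD[OF rev]
      by (simp add: entourage_chain_append_iff entourage_chain_Cons_iff last_rev hd_rev)
    have "chain_homotopic X E ([p] @ (xs @ rev xs) @ [p]) ([p] @ [hd xs] @ [p])"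
      by (rule chain_homotopic_append[OF Cons.IH[OF xs] long])
    also have "chain_homotopic X E ([p] @ [hd xs] @ [p]) [p, p]"
      using chain_homotopic_skip[of E p "hd xs" "[p]" p] px xp x hd entourage_refl[OF assms(1)]
      by (auto simp: entourage_chain_Cons_iff)
    also note pp
    finally show ?thesis using x by simp
  qed (use pp x in simp)
qed simp

end

section \<open>Chain spaces and their limits\<close>

lemma uniform_structure_of_base:
  assumes ne: "B \<noteq> {}"
    and B: "\<And>D. D \<in> B \<Longrightarrow> D \<subseteq> S \<times> S \<and> sym D \<and> Id_on S \<subseteq> D"
    and Int: "\<And>D D'. D \<in> B \<Longrightarrow> D' \<in> B \<Longrightarrow> \<exists>D''\<in>B. D'' \<subseteq> D \<and> D'' \<subseteq> D'"
    and half: "\<And>D. D \<in> B \<Longrightarrow> \<exists>D'\<in>B. D' O D' \<subseteq> D"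
  shows "uniform_structure (uspace_of_base S B)"
proof -
  let ?U = "uspace_of_base S B"
  have "D \<inter> E \<in> entourages ?U" if "D \<in> entourages ?U" "E \<in> entourages ?U" for D E
  proof -
    have DE: "D \<subseteq> S \<times> S" "sym D" "E \<subseteq> S \<times> S" "sym E" "\<exists>D'\<in>B. D' \<subseteq> D" "\<exists>E'\<in>B. E' \<subseteq> E"
      using that by (simp_all add: entourages_uspace_of_base)
    then obtain D' E' where "D' \<in> B" "E' \<in> B" "D' \<subseteq> D" "E' \<subseteq> E" by blast
    then obtain C where "C \<in> B" "C \<subseteq> D \<inter> E"
      using Int[of D' E'] by (meson le_inf_iff order_trans)
    then show ?thesis
      using DE sym_Int[OF DE(2,4)] unfolding entourages_uspace_of_base by blast
  qed
  moreover have "\<exists>D\<in>entourages ?U. D O D \<subseteq> E" if "E \<in> entourages ?U" for E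
  proof -
    obtain D where "D \<in> B" "D \<subseteq> E" using \<open>E \<in> entourages ?U\<close> unfolding entourages_uspace_of_base by blast
    moreover then obtain D' where D': "D' \<in> B" "D' O D' \<subseteq> D" using half by blast
    moreover have "D' \<in> entourages ?U"
      using D'(1) B[OF D'(1)] unfolding entourages_uspace_of_base by blast
    ultimately show ?thesis by (meson order_trans)
  qed
  moreover have "E \<subseteq> S \<times> S \<and> sym E \<and> Id_on S \<subseteq> E" if "E \<in> entourages ?U" for E
  proof -
    obtain D where "D \<in> B" "D \<subseteq> E"
      using \<open>E \<in> entourages ?U\<close> by (auto simp: entourages_uspace_of_base)
    then have "Id_on S \<subseteq> E" using B[of D] by (meson order_trans)
    then show ?thesis using that by (simp add: entourages_uspace_of_base)
  qed
  moreover have "S \<times> S \<in> entourages ?U"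
  proof -
    obtain D where "D \<in> B" using ne by blast
    then show ?thesis using B[of D] by (auto simp: entourages_uspace_of_base sym_def)
  qed
  moreover have "E \<in> entourages ?U"
    if "D \<in> entourages ?U" "D \<subseteq> E" "E \<subseteq> S \<times> S" "sym E" for D E
    using that unfolding entourages_uspace_of_base by (meson order_trans)
  ultimately show ?thesis
    unfolding uniform_structure_def carrier_uspace_of_base by meson
qed

lemma uspace_limit_carrier:
  "carrier (uspace_limit I leq S b) = threads I leq (\<lambda>i. carrier (S i)) b"
  by (simp add: uspace_limit_def Let_def)

lemma uniform_structure_limit:
  assumes S: "\<And>i. i \<in> I \<Longrightarrow> uniform_structure (S i)"
  shows "uniform_structure (uspace_limit I leq S b)"
proof -
  let ?T = "threads I leq (\<lambda>i. carrier (S i)) b"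
  let ?cyl = "\<lambda>J V. {(c, d) \<in> ?T \<times> ?T. \<forall>i\<in>J. (c i, d i) \<in> V i}"
  have S': "unif_space (S i)" if "i \<in> I" for i
    using S[OF that] by unfold_locales
  have T: "c i \<in> carrier (S i)" if "c \<in> ?T" "i \<in> I" for c i
    using that by (auto simp: threads_def)
  show ?thesis
    unfolding uspace_limit_def Let_def
  proof (rule uniform_structure_of_base, goal_cases)
    case 1 show ?case by blast
  next
    case (2 D)
    then obtain J V where JV: "finite J" "J \<subseteq> I" "\<forall>i\<in>J. V i \<in> entourages (S i)" "D = ?cyl J V"
      by blast
    have "(c i, c i) \<in> V i" if "c \<in> ?T" "i \<in> J" for c i
      using that T[of c i] JV unif_space.entourage_refl[OF S'] by blast
    moreover have "(d i, c i) \<in> V i" if "(c i, d i) \<in> V i" "i \<in> J" for c d i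
      using that JV unif_space.entourage_sym[OF S'] by blast
    ultimately show ?case
      unfolding JV(4) by (auto simp: sym_def)
  next
    case (3 D D')
    then obtain J V J' V' where JV: "finite J" "J \<subseteq> I" "\<forall>i\<in>J. V i \<in> entourages (S i)" "D = ?cyl J V"
      "finite J'" "J' \<subseteq> I" "\<forall>i\<in>J'. V' i \<in> entourages (S i)" "D' = ?cyl J' V'"
      by blast
    define W where "W i = (if i \<in> J then if i \<in> J' then V i \<inter> V' i else V i else V' i)" for i
    have "W i \<in> entourages (S i)" if "i \<in> J \<union> J'" for i
      using that JV unif_space.entourage_Int[OF S'] by (auto simp: W_def)
    moreover have "?cyl (J \<union> J') W \<subseteq> D \<and> ?cyl (J \<union> J') W \<subseteq> D'"
    proof -
      have "(c i, d i) \<in> V i" if "\<forall>i\<in>J \<union> J'. (c i, d i) \<in> W i" "i \<in> J" for c d i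
        using that by (auto simp: W_def split: if_splits dest: bspec[of _ _ i])
      moreover have "(c i, d i) \<in> V' i" if "\<forall>i\<in>J \<union> J'. (c i, d i) \<in> W i" "i \<in> J'" for c d i
        using that by (auto simp: W_def split: if_splits dest: bspec[of _ _ i])
      ultimately show ?thesis
        unfolding JV(4,8) by blast
    qed
    ultimately show ?case
      using JV by (intro bexI[of _ "?cyl (J \<union> J') W"] CollectI exI[of _ "J \<union> J'"] exI[of _ W]) auto
  next
    case (4 D)
    then obtain J V where JV: "finite J" "J \<subseteq> I" "\<forall>i\<in>J. V i \<in> entourages (S i)" "D = ?cyl J V"
      by blast
    have "\<forall>i\<in>J. \<exists>W\<in>entourages (S i). W O W \<subseteq> V i"
      using JV(2,3) S unfolding uniform_structure_def by (meson subsetD)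
    then obtain W where W: "\<forall>i\<in>J. W i \<in> entourages (S i) \<and> W i O W i \<subseteq> V i"
      by metis
    have "?cyl J W O ?cyl J W \<subseteq> D"
    proof (rule subrelI)
      fix c e assume "(c, e) \<in> ?cyl J W O ?cyl J W"
      then obtain d where d: "(c, d) \<in> ?cyl J W" "(d, e) \<in> ?cyl J W" by blast
      then have "(c i, e i) \<in> V i" if "i \<in> J" for i
        using that W by blast
      then show "(c, e) \<in> D" unfolding JV(4) using d by blast
    qed
    then show ?case
      using W JV(1,2) by (intro bexI[of _ "?cyl J W"] CollectI exI[of _ J] exI[of _ W]) auto
  qed
qed

context unif_space
begin

text \<open>
  For two chains, the pair of their classes lies in the entourage \<open>D\<^sup>*\<close> exactly if the second chain
  is, up to homotopy, the first one continued by a single step in \<open>D\<close>.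
\<close>

lemma star_entourage_iff:
  assumes E: "E \<in> entourages X" and D: "D \<in> entourages X" "D \<subseteq> E"
    and as: "entourage_chain X E p a as" and bs: "entourage_chain X E p b bs"
  shows "(chain_class X E as, chain_class X E bs) \<in> star_entourage X p E D \<longleftrightarrow>
    (a, b) \<in> D \<and> chain_homotopic X E (as @ [b]) bs"
proof
  assume "(chain_class X E as, chain_class X E bs) \<in> star_entourage X p E D"
  then obtain xs y z where *: "xs \<noteq> []" "entourage_chain X E p y (xs @ [y])"
    "entourage_chain X E p z (xs @ [z])" "(y, z) \<in> D"
    "chain_class X E as = chain_class X E (xs @ [y])" "chain_class X E bs = chain_class X E (xs @ [z])"
    unfolding star_entourage_def by blast
  have h: "chain_homotopic X E as (xs @ [y])" "chain_homotopic X E bs (xs @ [z])"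
    using *(5,6) by (simp_all add: chain_class_eq_iff)
  have "y = a" "z = b"
    using chain_homotopic_chain_iff[OF h(1)] chain_homotopic_chain_iff[OF h(2)] as bs *(2,3)
      entourage_chainD(4) by metis+
  have b: "b \<in> carrier X" "(a, b) \<in> E" using entourage_chainD[OF bs] *(4) D \<open>y = a\<close> \<open>z = b\<close> by auto
  have "chain_homotopic X E (as @ [b]) ((xs @ [y]) @ [b])"
    using h(1) as b entourage_chainD[OF as]
    by (intro chain_homotopic_append_right[of X E _ _ p b]) (auto simp: entourage_chain_snoc_iff)
  also have "chain_homotopic X E ((xs @ [y]) @ [b]) (xs @ [z])"
    using chain_homotopic_skip[OF *(2), of z] *(1,3) b \<open>z = b\<close> \<open>y = a\<close>
    by (auto simp: entourage_chain_snoc_iff)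
  also have "chain_homotopic X E (xs @ [z]) bs" using h(2) by (rule chain_homotopic_sym)
  finally show "(a, b) \<in> D \<and> chain_homotopic X E (as @ [b]) bs"
    using *(4) \<open>y = a\<close> \<open>z = b\<close> by simp
next
  assume *: "(a, b) \<in> D \<and> chain_homotopic X E (as @ [b]) bs"
  have "chain_class X E as = chain_class X E (as @ [a])"
    using chain_homotopic_snoc_last[OF E as] by (simp add: chain_class_eq_iff chain_homotopic_sym)
  moreover have "chain_class X E bs = chain_class X E (as @ [b])"
    using * by (simp add: chain_class_eq_iff chain_homotopic_sym)
  moreover have "entourage_chain X E p a (as @ [a])" "entourage_chain X E p b (as @ [b])"
    using as bs * D entourage_chainD[OF as] entourage_chainD[OF bs] entourage_refl[OF E]
    by (auto simp: entourage_chain_snoc_iff)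
  ultimately show "(chain_class X E as, chain_class X E bs) \<in> star_entourage X p E D"
    using * entourage_chainD(1)[OF as] unfolding star_entourage_def by blast
qed

end

lemma carrier_chain_space:
  "carrier (chain_space X p E) = {chain_class X E xs | xs q. entourage_chain X E p q xs}"
  by (simp add: chain_space_def)

lemma chain_class_in_space [intro]:
  "entourage_chain X E p q xs \<Longrightarrow> chain_class X E xs \<in> carrier (chain_space X p E)"
  by (auto simp: carrier_chain_space)

lemma star_entourage_subset:
  "star_entourage X p E D \<subseteq> carrier (chain_space X p E) \<times> carrier (chain_space X p E)"
  by (auto simp: star_entourage_def)

lemma star_entourage_mono: "D \<subseteq> D' \<Longrightarrow> star_entourage X p E D \<subseteq> star_entourage X p E D'"
  unfolding star_entourage_def by blast

context unif_space
begin

lemma sym_star_entourage: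
  assumes "D \<in> entourages X"
  shows "sym (star_entourage X p E D)"
  unfolding star_entourage_def sym_def using entourage_sym[OF assms] by blast

lemma star_entourage_in_entourages:
  assumes "D \<in> entourages X" and "D \<subseteq> E"
  shows "star_entourage X p E D \<in> entourages (chain_space X p E)"
  unfolding chain_space_def entourages_uspace_of_base
  using star_entourage_subset[of X p E D] sym_star_entourage assms
  by (auto simp: carrier_chain_space)

lemma entourages_chain_spaceE:
  assumes "V \<in> entourages (chain_space X p E)"
  obtains D where "D \<in> entourages X" "D \<subseteq> E" "star_entourage X p E D \<subseteq> V"
  using assms unfolding chain_space_def entourages_uspace_of_base by blast

lemma uniform_structure_chain_space:
  assumes E: "E \<in> entourages X"
  shows "uniform_structure (chain_space X p E)"
  unfolding chain_space_def
proof (rule uniform_structure_of_base, goal_cases)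
  case 1 show ?case using E by blast
next
  case (2 V)
  then obtain D where D: "V = star_entourage X p E D" "D \<in> entourages X" "D \<subseteq> E" by blast
  have "(chain_class X E xs, chain_class X E xs) \<in> V" if xs: "entourage_chain X E p q xs" for xs q
    unfolding D(1) star_entourage_iff[OF E D(2,3) xs xs]
    using chain_homotopic_snoc_last[OF E xs] entourage_refl[OF D(2)] entourage_chainD[OF xs] by blast
  then show ?case
    using star_entourage_subset[of X p E D] sym_star_entourage[OF D(2)] D(1)
    unfolding carrier_chain_space by blast
next
  case (3 V V')
  then obtain D D' where D: "V = star_entourage X p E D" "D \<in> entourages X" "D \<subseteq> E"
    "V' = star_entourage X p E D'" "D' \<in> entourages X" "D' \<subseteq> E" by blast
  have "star_entourage X p E (D \<inter> D') \<subseteq> V \<and> star_entourage X p E (D \<inter> D') \<subseteq> V'"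
    using D star_entourage_mono[of "D \<inter> D'"] by simp
  moreover have "D \<inter> D' \<in> entourages X \<and> D \<inter> D' \<subseteq> E"
    using D entourage_Int by blast
  ultimately show ?case by blast
next
  case (4 V)
  then obtain D where D: "V = star_entourage X p E D" "D \<in> entourages X" "D \<subseteq> E" by blast
  obtain C where C: "C \<in> entourages X" "C \<subseteq> D"
    "\<And>x y z. (x, y) \<in> C \<Longrightarrow> (y, z) \<in> C \<Longrightarrow> (x, z) \<in> D"
    using entourage_half[OF D(2)] by blast
  have CE: "C \<subseteq> E" using C D by blast
  have "star_entourage X p E C O star_entourage X p E C \<subseteq> V"
  proof (rule subrelI)
    fix A B assume "(A, B) \<in> star_entourage X p E C O star_entourage X p E C"
    then obtain M where M: "(A, M) \<in> star_entourage X p E C" "(M, B) \<in> star_entourage X p E C"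
      by blast
    obtain as a ms m bs b where as: "entourage_chain X E p a as" "A = chain_class X E as"
      and ms: "entourage_chain X E p m ms" "M = chain_class X E ms"
      and bs: "entourage_chain X E p b bs" "B = chain_class X E bs"
      using M star_entourage_subset[of X p E C] unfolding carrier_chain_space by blast
    have *: "(a, m) \<in> C" "chain_homotopic X E (as @ [m]) ms" "(m, b) \<in> C"
      "chain_homotopic X E (ms @ [b]) bs"
      using M star_entourage_iff[OF E C(1) CE as(1) ms(1)] star_entourage_iff[OF E C(1) CE ms(1) bs(1)]
      by (simp_all add: as(2) ms(2) bs(2))
    have ab: "(a, b) \<in> D" using C(3) * by blast
    have b: "b \<in> carrier X" "m \<in> carrier X" using entourage_carrier(2)[OF C(1)] * by blast+
    have asm: "entourage_chain X E p m (as @ [m])"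
      using as * CE b entourage_chainD[OF as(1)] by (auto simp: entourage_chain_snoc_iff)
    have "chain_homotopic X E (as @ [b]) ((as @ [m]) @ [b])"
      using chain_homotopic_skip[OF asm, of b] ab D(3) * CE b entourage_chainD[OF as(1)]
      by (auto intro: chain_homotopic_sym)
    also have "chain_homotopic X E ((as @ [m]) @ [b]) (ms @ [b])"
      using asm b * CE
      by (intro chain_homotopic_append_right[of X E _ _ p b], blast, subst entourage_chain_snoc_iff) auto
    also note *(4)
    finally show "(A, B) \<in> V"
      using ab star_entourage_iff[OF E D(2,3) as(1) bs(1)] by (simp add: as(2) bs(2) D(1))
  qed
  then show ?case using C CE by blast
qed

lemma entourage_finite_Inter:
  assumes "finite J" and "\<And>i. i \<in> J \<Longrightarrow> D i \<in> entourages X"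
  shows "\<exists>C\<in>entourages X. \<forall>i\<in>J. C \<subseteq> D i"
  using assms
proof (induction J)
  case empty then show ?case using entourage_top by blast
next
  case (insert j J)
  then obtain C where "C \<in> entourages X" "\<forall>i\<in>J. C \<subseteq> D i" by blast
  then show ?case using insert.prems entourage_Int[of C "D j"] by (intro bexI[of _ "C \<inter> D j"]) auto
qed

end

text \<open>
  The inverse limit of the chain spaces over the entourages of a base. Over all entourages it is the
  space \<open>tilde X p\<close>; over a base consisting of entourages onto whose chain spaces this limit projects
  surjectively, it displays the action of the loop classes as an inverse limit of discrete actions.
\<close>

definition chain_limit ::
    "'a uspace \<Rightarrow> 'a \<Rightarrow> ('a \<times> 'a) set set \<Rightarrow> (('a \<times> 'a) set \<Rightarrow> 'a list set) uspace" where
  "chain_limit X p B =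
     uspace_limit B (\<lambda>E D. D \<subseteq> E) (chain_space X p) (\<lambda>E D. chain_bonding X E)"

lemma tilde_eq_chain_limit: "tilde X p = chain_limit X p (entourages X)"
  by (simp add: tilde_def chain_limit_def)

locale chain_system = unif_space X for X :: "'a uspace" +
  fixes p :: 'a and B :: "('a \<times> 'a) set set"
  assumes basepoint: "p \<in> carrier X" and base: "entourage_base X B"
begin

lemma base_entourage: "E \<in> B \<Longrightarrow> E \<in> entourages X"
  using base by (auto simp: entourage_base_def)

lemma base_below: "V \<in> entourages X \<Longrightarrow> \<exists>E\<in>B. E \<subseteq> V"
  using base by (auto simp: entourage_base_def)

lemma base_directed: "D \<in> B \<Longrightarrow> E \<in> B \<Longrightarrow> \<exists>C\<in>B. C \<subseteq> D \<and> C \<subseteq> E"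
  using base_below[of "D \<inter> E"] base_entourage entourage_Int by auto

abbreviation points where "points \<equiv> carrier (chain_limit X p B)"

lemma points_iff:
  "c \<in> points \<longleftrightarrow> c \<in> (\<Pi>\<^sub>E E\<in>B. carrier (chain_space X p E)) \<and>
     (\<forall>E\<in>B. \<forall>D\<in>B. D \<subseteq> E \<longrightarrow> chain_bonding X E (c D) = c E)"
  by (simp add: chain_limit_def uspace_limit_carrier threads_def)

lemma points_extensional: "c \<in> points \<Longrightarrow> c \<in> extensional B"
  by (simp add: points_iff PiE_iff)

lemma coordinate_in_space: "c \<in> points \<Longrightarrow> E \<in> B \<Longrightarrow> c E \<in> carrier (chain_space X p E)"
  by (auto simp: points_iff PiE_iff)

lemma coordinate_chain:
  assumes "c \<in> points" and "E \<in> B" and "xs \<in> c E"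
  shows "c E = chain_class X E xs" and "entourage_chain X E p (last xs) xs"
proof -
  obtain ys q where ys: "entourage_chain X E p q ys" "c E = chain_class X E ys"
    using coordinate_in_space[OF assms(1,2)] by (auto simp: carrier_chain_space)
  then show "c E = chain_class X E xs"
    using assms(3) chain_class_eqI by metis
  show "entourage_chain X E p (last xs) xs"
    using assms(3) ys chain_class_chain_iff entourage_chainD(4) by metis
qed

lemma coordinate_nonempty:
  assumes "c \<in> points" and "E \<in> B"
  obtains xs where "xs \<in> c E"
  using coordinate_in_space[OF assms] chain_class_self unfolding carrier_chain_space by blast

lemma coordinates_nonempty:
  assumes "c \<in> points" and "d \<in> points" and "E \<in> B"
  obtains xs ys where "xs \<in> c E" and "ys \<in> d E"
proof -
  obtain xs where "xs \<in> c E" using coordinate_nonempty[OF assms(1,3)] .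
  moreover obtain ys where "ys \<in> d E" using coordinate_nonempty[OF assms(2,3)] .
  ultimately show thesis by (rule that)
qed

lemma coordinate_mono:
  assumes "c \<in> points" and "D \<in> B" and "E \<in> B" and "D \<subseteq> E" and "xs \<in> c D"
  shows "xs \<in> c E"
proof -
  have "c E = chain_bonding X E (chain_class X D xs)"
    using assms coordinate_chain(1)[OF assms(1,2,5)] unfolding points_iff by metis
  then show ?thesis
    using chain_bonding_class[OF assms(4)] by auto
qed

lemma pointsI:
  assumes ext: "c \<in> extensional B"
    and cls: "\<And>E. E \<in> B \<Longrightarrow> c E \<in> carrier (chain_space X p E)"
    and mono: "\<And>D E. D \<in> B \<Longrightarrow> E \<in> B \<Longrightarrow> D \<subseteq> E \<Longrightarrow> \<exists>xs\<in>c D. xs \<in> c E"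
  shows "c \<in> points"
proof -
  have "chain_bonding X E (c D) = c E" if DE: "D \<in> B" "E \<in> B" "D \<subseteq> E" for D E
  proof -
    obtain xs where xs: "xs \<in> c D" "xs \<in> c E" using mono[OF DE] by blast
    then have "c D = chain_class X D xs" "c E = chain_class X E xs"
      using cls[OF DE(1)] cls[OF DE(2)] chain_class_eqI unfolding carrier_chain_space by blast+
    then show ?thesis using chain_bonding_class[OF DE(3)] by metis
  qed
  then show ?thesis using ext cls by (auto simp: points_iff PiE_iff)
qed

lemma points_eqI:
  assumes "c \<in> points" and "d \<in> points" and "\<And>E. E \<in> B \<Longrightarrow> \<exists>xs. xs \<in> c E \<and> xs \<in> d E"
  shows "c = d"
proof (rule extensionalityI[of _ B])
  show "c E = d E" if "E \<in> B" for E
    using assms(3)[OF that] coordinate_chain(1)[OF assms(1) that] coordinate_chain(1)[OF assms(2) that]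
    by metis
qed (use assms points_extensional in auto)

lemma last_coordinate_eq:
  assumes "c \<in> points" and "D \<in> B" and "E \<in> B" and "xs \<in> c D" and "ys \<in> c E"
  shows "last xs = last ys"
proof -
  obtain C where C: "C \<in> B" "C \<subseteq> D" "C \<subseteq> E" using base_directed assms by blast
  obtain zs where zs: "zs \<in> c C" using coordinate_nonempty[OF assms(1) C(1)] .
  have "last zs = last us" if "U \<in> B" "C \<subseteq> U" "us \<in> c U" for U us
  proof -
    have "zs \<in> chain_class X U us"
      using coordinate_mono[OF assms(1) C(1) that(1,2) zs] coordinate_chain(1)[OF assms(1) that(1,3)]
      by simp
    then show ?thesis
      using coordinate_chain(2)[OF assms(1) that(1,3)] chain_class_chain_iff entourage_chainD(4) by metis
  qed
  then show ?thesis using C assms by metis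
qed

definition near :: "('a \<times> 'a) set \<Rightarrow> ((('a \<times> 'a) set \<Rightarrow> 'a list set) \<times> (('a \<times> 'a) set \<Rightarrow> 'a list set)) set"
  where "near E = {(c, d) \<in> points \<times> points. (c E, d E) \<in> star_entourage X p E E}"

lemma near_iff:
  assumes "c \<in> points" and "d \<in> points" and "E \<in> B" and "xs \<in> c E" and "ys \<in> d E"
  shows "(c, d) \<in> near E \<longleftrightarrow>
    (last xs, last ys) \<in> E \<and> chain_homotopic X E (xs @ [last ys]) ys"
  using assms coordinate_chain[OF assms(1,3,4)] coordinate_chain[OF assms(2,3,5)]
    star_entourage_iff[OF base_entourage[OF assms(3)] base_entourage[OF assms(3)]]
  by (simp add: near_def)

lemma near_points: "(c, d) \<in> near E \<Longrightarrow> c \<in> points \<and> d \<in> points"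
  by (simp add: near_def)

lemma sym_near: "E \<in> B \<Longrightarrow> sym (near E)"
  using sym_star_entourage[OF base_entourage, of E p E] by (auto simp: near_def sym_def)

lemma near_coarser:
  assumes D: "D \<in> B" and E: "E \<in> B" and V: "D \<subseteq> V" "V \<subseteq> E" "V \<in> entourages X"
    and cd: "(c, d) \<in> near D"
  shows "(c E, d E) \<in> star_entourage X p E V"
proof -
  have c: "c \<in> points" and d: "d \<in> points" using near_points[OF cd] by auto
  obtain xs ys where xs: "xs \<in> c D" and ys: "ys \<in> d D"
    using coordinates_nonempty[OF c d D] .
  have DE: "D \<subseteq> E" using V by simp
  have "(last xs, last ys) \<in> D" "chain_homotopic X D (xs @ [last ys]) ys"
    using near_iff[OF c d D xs ys] cd by auto
  then have "(last xs, last ys) \<in> V" "chain_homotopic X E (xs @ [last ys]) ys"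
    using V DE chain_homotopic_mono by blast+
  moreover note xs' = coordinate_mono[OF c D E DE xs] and ys' = coordinate_mono[OF d D E DE ys]
  moreover note cE = coordinate_chain[OF c E xs'] and dE = coordinate_chain[OF d E ys']
  ultimately show ?thesis
    using star_entourage_iff[OF base_entourage[OF E] V(3,2) cE(2) dE(2)] unfolding cE(1) dE(1) by blast
qed

lemma near_mono: "D \<in> B \<Longrightarrow> E \<in> B \<Longrightarrow> D \<subseteq> E \<Longrightarrow> near D \<subseteq> near E"
  using near_coarser[of D E E] base_entourage near_points unfolding near_def by blast

text \<open>
  A finite family of coordinates can be replaced by a single finer one, since the index set is
  directed; hence the sets \<open>near E\<close> form a base.
\<close>

lemma entourages_limit_iff:
  "W \<in> entourages (chain_limit X p B) \<longleftrightarrow>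
     W \<subseteq> points \<times> points \<and> sym W \<and> (\<exists>E\<in>B. near E \<subseteq> W)" (is "?L \<longleftrightarrow> ?R")
proof -
  define cyl where "cyl J V = {(c, d) \<in> points \<times> points. \<forall>i\<in>J. (c i, d i) \<in> V i}"
    for J and V :: "('a \<times> 'a) set \<Rightarrow> ('a list set \<times> 'a list set) set"
  have L: "?L \<longleftrightarrow> W \<subseteq> points \<times> points \<and> sym W \<and>
      (\<exists>J V. finite J \<and> J \<subseteq> B \<and> (\<forall>E\<in>J. V E \<in> entourages (chain_space X p E)) \<and> cyl J V \<subseteq> W)"
    unfolding cyl_def chain_limit_def uspace_limit_def Let_def
      entourages_uspace_of_base carrier_uspace_of_base by blast
  show ?thesis
  proof
    assume ?L
    then obtain J V where J: "finite J" "J \<subseteq> B" "\<forall>E\<in>J. V E \<in> entourages (chain_space X p E)"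
      "cyl J V \<subseteq> W" using L by blast
    have "\<forall>E\<in>J. \<exists>D\<in>entourages X. D \<subseteq> E \<and> star_entourage X p E D \<subseteq> V E"
      using J(3) entourages_chain_spaceE by metis
    then obtain D where D: "\<forall>E\<in>J. D E \<in> entourages X \<and> D E \<subseteq> E \<and> star_entourage X p E (D E) \<subseteq> V E"
      by metis
    then obtain C where "C \<in> entourages X" "\<forall>E\<in>J. C \<subseteq> D E"
      using entourage_finite_Inter[OF J(1), of D] by blast
    then obtain C' where C: "C' \<in> B" "\<forall>E\<in>J. C' \<subseteq> D E"
      using base_below by (meson order_trans)
    have "near C' \<subseteq> cyl J V"
    proof (rule subrelI)
      fix c d assume cd: "(c, d) \<in> near C'"
      have "(c E, d E) \<in> V E" if "E \<in> J" for E
        using near_coarser[OF C(1) _ _ _ _ cd, of E "D E"] C D J(2) that by blast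
      then show "(c, d) \<in> cyl J V" using near_points[OF cd] by (simp add: cyl_def)
    qed
    then show ?R using L \<open>?L\<close> C(1) J(4) by blast
  next
    assume ?R
    then obtain E where E: "E \<in> B" "near E \<subseteq> W" by blast
    have "near E = cyl {E} (\<lambda>E. star_entourage X p E E)"
      by (auto simp: near_def cyl_def)
    moreover have "star_entourage X p E E \<in> entourages (chain_space X p E)"
      using star_entourage_in_entourages base_entourage[OF E(1)] by blast
    ultimately show ?L
      unfolding L using \<open>?R\<close> E
      by (intro conjI exI[of _ "{E}"] exI[of _ "\<lambda>E. star_entourage X p E E"]) auto
  qed
qed

lemma near_entourage: "E \<in> B \<Longrightarrow> near E \<in> entourages (chain_limit X p B)"
  unfolding entourages_limit_iff
proof (intro conjI bexI[of _ E])
  show "near E \<subseteq> points \<times> points" by (auto simp: near_def)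
qed (simp_all add: sym_near)

lemma uniform_structure_chain_limit: "uniform_structure (chain_limit X p B)"
  unfolding chain_limit_def
  by (rule uniform_structure_limit) (use base_entourage uniform_structure_chain_space in blast)

end

text \<open>The coordinate \<open>carrier X \<times> carrier X\<close> used by \<open>tilde_proj\<close> is only one of many: every coordinate
  has the same endpoint.\<close>

lemma (in chain_system) tilde_proj_eq:
  assumes "carrier X \<times> carrier X \<in> B" and "c \<in> points" and "E \<in> B" and "xs \<in> c E"
  shows "tilde_proj X c = last xs"
proof -
  obtain ys where ys: "ys \<in> c (carrier X \<times> carrier X)"
    using coordinate_nonempty[OF assms(2,1)] .
  then have "tilde_proj X c = last ys"
    using coordinate_chain[OF assms(2,1) ys] endpoint_chain_class unfolding tilde_proj_def by metis
  also have "\<dots> = last xs"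
    using last_coordinate_eq[OF assms(2,1,3) ys assms(4)] .
  finally show ?thesis .
qed

section \<open>Lifting chains and homotopies\<close>

text \<open>
  The data needed to lift homotopies of chains along \<open>f\<close>. For a cover with group \<open>G\<close>, the relation \<open>R\<close> is
  being in the same orbit of the kernel of the projection of \<open>G\<close> to one of the groups acting
  discretely, and \<open>D\<close> is an invariant entourage. Lifts of \<open>D\<close>-steps are then not unique, but
  unique up to \<open>R\<close>, while \<open>R\<close> itself is invisible at the scale \<open>E\<close>.
\<close>

locale lifting_scale = X: unif_space X + Y: unif_space Y
  for X :: "'a uspace" and Y :: "'b uspace" +
  fixes f :: "'a \<Rightarrow> 'b" and E E0 D R :: "('a \<times> 'a) set"
  assumes f_closed: "x \<in> carrier X \<Longrightarrow> f x \<in> carrier Y"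
    and E: "E \<in> entourages X" and E0: "E0 \<in> entourages X" and D: "D \<in> entourages X"
    and image_D: "map_prod f f ` D \<in> entourages Y"
    and E0_E0: "(x, y) \<in> E0 \<Longrightarrow> (y, z) \<in> E0 \<Longrightarrow> (x, z) \<in> E"
    and D_D: "(x, y) \<in> D \<Longrightarrow> (y, z) \<in> D \<Longrightarrow> (x, z) \<in> E0"
    and R_E0: "R \<subseteq> E0"
    and R_refl: "x \<in> carrier X \<Longrightarrow> (x, x) \<in> R"
    and R_sym: "(x, y) \<in> R \<Longrightarrow> (y, x) \<in> R"
    and R_trans: "(x, y) \<in> R \<Longrightarrow> (y, z) \<in> R \<Longrightarrow> (x, z) \<in> R"
    and R_fibre: "(x, y) \<in> R \<Longrightarrow> f x = f y"
    and D_D_D: "(w, x) \<in> D \<Longrightarrow> (x, y) \<in> D \<Longrightarrow> (y, z) \<in> D \<Longrightarrow> f w = f z \<Longrightarrow> (w, z) \<in> R"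
    and R_D: "(x, y) \<in> D \<Longrightarrow> (x, x') \<in> R \<Longrightarrow> \<exists>y'. (x', y') \<in> D \<and> (y, y') \<in> R"
    and lift_step: "(x, y) \<in> D \<Longrightarrow> x' \<in> carrier X \<Longrightarrow> f x' = f x \<Longrightarrow> \<exists>y'. (x', y') \<in> D \<and> f y' = f y"
begin

lemma E0_subset: "E0 \<subseteq> E"
  using E0_E0 X.entourage_refl[OF E0] X.entourage_carrier[OF E0] by (meson subrelI)

lemma D_subset: "D \<subseteq> E0"
  using D_D X.entourage_refl[OF D] X.entourage_carrier[OF D] by (meson subrelI)

lemma D_fibre: "(x, y) \<in> D \<Longrightarrow> f x = f y \<Longrightarrow> (x, y) \<in> R"
  using D_D_D X.entourage_refl[OF D] X.entourage_carrier[OF D] by metis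

lemma D_D_fibre: "(x, y) \<in> D \<Longrightarrow> (y, z) \<in> D \<Longrightarrow> f x = f z \<Longrightarrow> (x, z) \<in> R"
  using D_D_D X.entourage_refl[OF D] X.entourage_carrier[OF D] by metis

lemma lift_chain:
  assumes "entourage_chain Y (map_prod f f ` D) (f x) r ys" and "x \<in> carrier X"
  shows "\<exists>xs. entourage_chain X D x (last xs) xs \<and> map f xs = ys"
  using assms
proof (induction ys arbitrary: x)
  case (Cons y ys)
  show ?case
  proof (cases "ys = []")
    case True
    then show ?thesis
      using Cons.prems by (intro exI[of _ "[x]"]) (auto simp: entourage_chain_Cons_iff)
  next
    case False
    then have ys: "entourage_chain Y (map_prod f f ` D) (hd ys) r ys" "y = f x"
      "(f x, hd ys) \<in> map_prod f f ` D"
      using Cons.prems by (auto simp: entourage_chain_Cons_iff)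
    then obtain a b where ab: "(a, b) \<in> D" "f a = f x" "f b = hd ys" by auto
    obtain b' where b': "(x, b') \<in> D" "f b' = hd ys"
      using lift_step[OF ab(1) Cons.prems(2)] ab by auto
    obtain xs where xs: "entourage_chain X D b' (last xs) xs" "map f xs = ys"
      using Cons.IH[of b'] ys(1) b' X.entourage_carrier(2)[OF D b'(1)] by auto
    then show ?thesis
      using entourage_chainD[OF xs(1)] b' Cons.prems(2) ys(2)
      by (intro exI[of _ "x # xs"]) (auto simp: entourage_chain_Cons_iff)
  qed
qed simp

text \<open>
  Related starting points stay related: \<open>R_D\<close> transports the next step of one lift to the other, where
  it differs from the step actually taken by a pair in \<open>D O D\<close> over a single point of \<open>Y\<close>.
\<close>

lemma lifts_related:
  assumes "entourage_chain X D a b xs" and "entourage_chain X D a' b' xs'"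
    and "map f xs = map f xs'" and "(a, a') \<in> R"
  shows "list_all2 (\<lambda>x y. (x, y) \<in> R) xs xs'"
  using assms
proof (induction xs arbitrary: a a' xs')
  case (Cons x xs)
  then obtain x' ys where xs': "xs' = x' # ys" "map f xs = map f ys" by (cases xs') auto
  have x: "x = a" "x' = a'" using Cons.prems by (auto simp: xs'(1) entourage_chain_Cons_iff)
  show ?case
  proof (cases "xs = []")
    case False
    then have ys: "ys \<noteq> []" using xs'(2) by auto
    have c: "entourage_chain X D (hd xs) b xs" "(a, hd xs) \<in> D"
      "entourage_chain X D (hd ys) b' ys" "(a', hd ys) \<in> D"
      using Cons.prems False ys x by (auto simp: xs'(1) entourage_chain_Cons_iff)
    obtain w where w: "(a', w) \<in> D" "(hd xs, w) \<in> R" using R_D[OF c(2) Cons.prems(4)] by blast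
    have "f (hd xs) = f (hd ys)"
      using xs'(2) False ys by (metis hd_map)
    then have "(w, hd ys) \<in> R"
      using D_D_fibre[of w a' "hd ys"] w c(4) R_fibre[OF w(2)] X.entourage_sym[OF D w(1)] by simp
    then have "(hd xs, hd ys) \<in> R" using w R_trans by blast
    then show ?thesis
      using Cons.IH[OF c(1,3) xs'(2)] Cons.prems(4) x xs'(1) by simp
  qed (use xs' x Cons.prems in auto)
qed simp

text \<open>
  The detour at the end of \<open>xs\<close> from its last point to that of \<open>xs'\<close> is exchanged for the detour one step
  earlier, and so on down to the common first point. The two detours have the same shortcut, a step in
  \<open>E0 O E0\<close>.
\<close>

lemma related_homotopic:
  assumes "list_all2 (\<lambda>x y. (x, y) \<in> R) xs xs'"
    and "entourage_chain X E0 a b xs" and "entourage_chain X E0 a b' xs'"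
  shows "chain_homotopic X E (xs @ [b']) xs'"
  using assms
proof (induction xs arbitrary: b b' xs' rule: rev_induct)
  case (snoc u us)
  obtain u' us' where xs': "xs' = us' @ [u']" "list_all2 (\<lambda>x y. (x, y) \<in> R) us us'" "(u, u') \<in> R"
    using snoc.prems(1) by (auto simp: list_all2_append1 list_all2_Cons1)
  have u: "u = b" "u' = b'" using snoc.prems entourage_chainD(4) xs'(1) by fastforce+
  have bb': "(b, b') \<in> E0" "b' \<in> carrier X" "b \<in> carrier X"
    using xs'(3) u R_E0 X.entourage_carrier[OF E0] by blast+
  show ?case
  proof (cases "us = []")
    case True
    then have "us' = []" "a = b" "a = b'" using xs' snoc.prems u by auto
    then show ?thesis
      using X.chain_homotopic_snoc_last[OF E, of b b "[b]"] True u xs' bb' by simp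
  next
    case False
    then have ne: "us' \<noteq> []" using xs' by auto
    have c: "entourage_chain X E0 a (last us) us" "(last us, b) \<in> E0"
      "entourage_chain X E0 a (last us') us'" "(last us', b') \<in> E0"
      using snoc.prems False ne u xs'(1) by (auto simp: entourage_chain_snoc_iff)
    have l: "(last us, last us') \<in> R"
      using xs'(2) False ne by (metis last_conv_nth list_all2_conv_all_nth diff_less length_greater_0_conv zero_less_one)
    have lE: "(last us, b') \<in> E" using E0_E0 c(2) bb'(1) by blast
    have cE: "entourage_chain X E a (last us) us"
      using entourage_chain_mono[OF c(1) E0_subset] .
    have l'E: "(last us, last us') \<in> E" "(last us', b') \<in> E" "last us' \<in> carrier X"
      using l R_E0 c E0_subset X.entourage_carrier[OF E0] by blast+
    have "chain_homotopic X E (us @ [b, b']) (us @ [b'])"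
      using X.chain_homotopic_skip[of E a b us b'] False cE lE bb' c(2) E0_subset
      by (auto simp: entourage_chain_snoc_iff)
    also have "chain_homotopic X E (us @ [b']) (us @ [last us', b'])"
      using X.chain_homotopic_skip[of E a "last us'" us b'] False cE lE bb' l'E
      by (auto simp: entourage_chain_snoc_iff intro: chain_homotopic_sym)
    also have "chain_homotopic X E (us @ [last us', b']) (us' @ [b'])"
      using chain_homotopic_append_right[OF snoc.IH[OF xs'(2) c(1,3)], of a b' "[b']"] False cE l'E bb'
      using entourage_chain_snoc_iff[of "us @ [last us']" X E a b' b']
      by (auto simp: entourage_chain_snoc_iff)
    finally show ?thesis using u xs'(1) by simp
  qed
qed simp

text \<open>
  Lifts of homotopic chains may end at different points, so they can be compared only after
  one of them is continued to the endpoint of the other.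
\<close>

definition deformable :: "'a list \<Rightarrow> 'a list \<Rightarrow> bool" where
  "deformable xs ys \<longleftrightarrow> (last xs, last ys) \<in> R \<and> chain_homotopic X E (xs @ [last ys]) ys"

lemma deformable_sym:
  assumes xs: "entourage_chain X E a b xs" and "deformable xs ys"
  shows "deformable ys xs"
proof -
  have R: "(last xs, last ys) \<in> R" and h: "chain_homotopic X E (xs @ [last ys]) ys"
    using assms by (auto simp: deformable_def)
  note c = entourage_chainD[OF xs]
  have RE: "(last xs, last ys) \<in> E" "(last ys, last xs) \<in> E" "last ys \<in> carrier X"
    using R R_sym R_E0 E0_subset X.entourage_carrier[OF E] by blast+
  have "chain_homotopic X E (ys @ [last xs]) ((xs @ [last ys]) @ [last xs])"
    using RE xs c entourage_chain_snoc_iff[of "xs @ [last ys]" X E a "last xs" "last xs"]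
    by (intro chain_homotopic_sym[OF chain_homotopic_append_right[OF h, of a "last xs"]])
      (auto simp: entourage_chain_snoc_iff)
  also have "chain_homotopic X E ((xs @ [last ys]) @ [last xs]) (xs @ [last xs])"
    using X.chain_homotopic_skip[of E a "last ys" xs "last xs"] RE xs c X.entourage_refl[OF E]
    by (auto simp: entourage_chain_snoc_iff)
  also have "chain_homotopic X E (xs @ [last xs]) xs"
    using X.chain_homotopic_snoc_last[OF E xs] c by simp
  finally show ?thesis
    using R_sym[OF R] by (simp add: deformable_def)
qed

lemma deformable_trans:
  assumes xs: "entourage_chain X E a b xs" and "deformable xs ys" and "deformable ys zs"
  shows "deformable xs zs"
proof -
  have R: "(last xs, last ys) \<in> R" "(last ys, last zs) \<in> R" 
    and h: "chain_homotopic X E (xs @ [last ys]) ys" "chain_homotopic X E (ys @ [last zs]) zs"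
    using assms by (auto simp: deformable_def)
  note c = entourage_chainD[OF xs]
  have R3: "(last xs, last zs) \<in> R" using R R_trans by blast
  have RE: "(last xs, last ys) \<in> E" "(last ys, last zs) \<in> E" "(last xs, last zs) \<in> E"
      "last ys \<in> carrier X" "last zs \<in> carrier X"
    using R R3 R_E0 E0_subset X.entourage_carrier[OF E] by blast+
  have "chain_homotopic X E (xs @ [last zs]) ((xs @ [last ys]) @ [last zs])"
    using X.chain_homotopic_skip[of E a "last ys" xs "last zs"] RE xs c
    by (auto simp: entourage_chain_snoc_iff intro: chain_homotopic_sym)
  also have "chain_homotopic X E ((xs @ [last ys]) @ [last zs]) (ys @ [last zs])"
    using RE xs c entourage_chain_snoc_iff[of "xs @ [last ys]" X E a "last zs" "last zs"]
    by (intro chain_homotopic_append_right[OF h(1), of a "last zs"])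
      (auto simp: entourage_chain_snoc_iff)
  also note h(2)
  finally show ?thesis using R3 by (simp add: deformable_def)
qed

text \<open>
  The elementary step. Deleting the inserted point from the lift of the longer chain leaves a chain
  whose steps are in \<open>D O D\<close>; it is pointwise related to the lift of the shorter chain.
\<close>

lemma deformable_insert:
  assumes xs: "entourage_chain X D a b xs" "map f xs = us @ vs"
    and xs': "entourage_chain X D a b' xs'" "map f xs' = us @ z # vs"
    and ends: "last (us @ vs) = last (us @ z # vs)" and us: "us \<noteq> []"
  shows "deformable xs' xs"
proof -
  obtain as bs where ab: "xs = as @ bs" "map f as = us" "map f bs = vs"
    using xs(2) by (auto simp: map_eq_append_conv)
  obtain as' c bs' where ab': "xs' = as' @ c # bs'" "map f as' = us" "f c = z" "map f bs' = vs"
    using xs'(2) by (auto simp: map_eq_append_conv)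
  have ne: "as \<noteq> []" "as' \<noteq> []" using us ab ab' by auto
  have as': "entourage_chain X D a (last as') as'" "(last as', c) \<in> D"
    using xs'(1) ne unfolding ab'(1) by (auto simp: entourage_chain_append_iff)
  have as: "entourage_chain X D a (last as) as"
    using xs(1) ne unfolding ab(1) by (cases "bs = []") (auto simp: entourage_chain_append_iff entourage_chainD)
  have refl: "(a, a) \<in> R" using entourage_chainD[OF as] R_refl by blast
  have rel: "list_all2 (\<lambda>x y. (x, y) \<in> R) as' as"
    using lifts_related[OF as'(1) as] refl ab ab' by simp
  then have lR: "(last as', last as) \<in> R"
    using ne by (metis last_conv_nth list_all2_conv_all_nth diff_less length_greater_0_conv zero_less_one)
  have E_chain: "entourage_chain X E a (last xs') xs'"
    using entourage_chain_mono[OF xs'(1)] D_subset E0_subset entourage_chainD(4)[OF xs'(1)] by blast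
  have lb: "last xs = b" "last xs' = b'"
    using entourage_chainD(4)[OF xs(1)] entourage_chainD(4)[OF xs'(1)] by auto
  show ?thesis
  proof (cases "bs = []")
    case True
    then have "bs' = []" using ab ab' by auto
    have "f c = f (last as')"
      using ends True \<open>bs' = []\<close> ab ab' us ne R_fibre[OF lR] by (auto simp: last_map)
    then have cR: "(c, last as') \<in> R"
      using D_fibre[OF X.entourage_sym[OF D as'(2)]] by simp
    have "deformable xs' as'"
    proof -
      have "chain_homotopic X E (as' @ [c, last as']) (as' @ [last as'])"
        using X.chain_homotopic_skip[of E a c as' "last as'"] E_chain ne ab'(1) \<open>bs' = []\<close>
          X.entourage_refl[OF E] entourage_chainD[OF as'(1)] X.entourage_sym[OF D as'(2)]
          D_subset E0_subset by auto
      also have "chain_homotopic X E (as' @ [last as']) as'"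
        using X.chain_homotopic_snoc_last[OF E, of a "last as'" as'] as'(1) 
          entourage_chain_mono[of X D a "last as'" as' E] D_subset E0_subset by blast
      finally show ?thesis
        using cR by (simp add: deformable_def ab'(1) \<open>bs' = []\<close>)
    qed
    moreover have "deformable as' as"
      using related_homotopic[OF rel, of a "last as'" "last as"] as as'(1) lR
        entourage_chain_mono[OF _ D_subset] by (auto simp: deformable_def)
    ultimately show ?thesis
      using deformable_trans[OF E_chain] ab(1) True by simp
  next
    case False
    then have ne': "bs' \<noteq> []" using ab ab' by auto
    have bs: "entourage_chain X D (hd bs) b bs" "(last as, hd bs) \<in> D"
      using xs(1) ne False unfolding ab(1) by (auto simp: entourage_chain_append_iff)
    have bs': "entourage_chain X D (hd bs') b' bs'" "(c, hd bs') \<in> D"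
      using xs'(1) ne ne' unfolding ab'(1)
      by (auto simp: entourage_chain_append_iff entourage_chain_Cons_iff)
    have D2: "(last as', hd bs') \<in> E0" using D_D as'(2) bs'(2) by blast
    \<comment> \<open>the step of the shorter lift after \<open>as\<close>, transported to start where \<open>as'\<close> ends\<close>
    obtain w where w: "(last as', w) \<in> D" "(hd bs, w) \<in> R"
      using R_D[OF bs(2) R_sym[OF lR]] by blast
    have "f (hd bs) = f (hd bs')" using ab ab' False ne' by (metis hd_map)
    then have "(hd bs', w) \<in> R"
      using D_D_D[of "hd bs'" c "last as'" w] w R_fibre[OF w(2)]
        X.entourage_sym[OF D as'(2)] X.entourage_sym[OF D bs'(2)] by simp
    then have "(hd bs', hd bs) \<in> R" using w(2) R_sym R_trans by blast
    then have "list_all2 (\<lambda>x y. (x, y) \<in> R) bs' bs"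
      using lifts_related[OF bs'(1) bs(1)] ab ab' by simp
    then have rel': "list_all2 (\<lambda>x y. (x, y) \<in> R) (as' @ bs') (as @ bs)"
      using rel by (simp add: list_all2_appendI)
    have chains: "entourage_chain X E0 a b' (as' @ bs')" "entourage_chain X E0 a b (as @ bs)"
      using as'(1) bs'(1) D2 ne ne' xs(1) ab(1) D_subset
      by (auto simp: entourage_chain_append_iff intro: entourage_chain_mono)
    have endR: "(b', b) \<in> R"
    proof -
      have "last (as' @ bs') = b'" "last (as @ bs) = b"
        using entourage_chainD(4)[OF chains(1)] entourage_chainD(4)[OF chains(2)] by simp_all
      then show ?thesis
        using rel' ne by (metis append_is_Nil_conv last_conv_nth list_all2_conv_all_nth diff_less length_greater_0_conv zero_less_one)
    qed
    then have b: "(b', b) \<in> E" "b \<in> carrier X"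
      using R_E0 E0_subset X.entourage_carrier[OF E] by blast+
    have "chain_homotopic X E (as' @ c # bs') (as' @ bs')"
      using chain_homotopic_insert[of X E a b' as' bs' c] E_chain ab'(1) lb
        entourage_chain_mono[OF chains(1) E0_subset] by (auto intro: chain_homotopic_sym)
    then have "chain_homotopic X E ((as' @ c # bs') @ [b]) ((as' @ bs') @ [b])"
      using E_chain b lb unfolding ab'(1)
      by (intro chain_homotopic_append_right[of X E _ _ a b], blast, subst entourage_chain_snoc_iff) auto
    also have "chain_homotopic X E ((as' @ bs') @ [b]) (as @ bs)"
      by (rule related_homotopic[OF rel' chains])
    finally show ?thesis
      using endR lb by (simp add: deformable_def ab(1) ab'(1))
  qed
qed

text \<open>
  An insertion in front of the first point of a chain must repeat this point, so it is also an
  insertion after it.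
\<close>

lemma deformable_chain_insert:
  assumes xs: "entourage_chain X D a b xs" and xs': "entourage_chain X D a b' xs'"
    and ins: "chain_insert Y F (map f xs) (map f xs')"
  shows "deformable xs' xs"
proof -
  obtain r s us z vs where *: "entourage_chain Y F r s (map f xs)" "entourage_chain Y F r s (map f xs')"
    "map f xs = us @ vs" "map f xs' = us @ z # vs"
    using ins by (rule chain_insertE)
  have ends: "last (us @ vs) = last (us @ z # vs)" "hd (us @ vs) = hd (us @ z # vs)" "us @ vs \<noteq> []"
    using *(1,2) entourage_chainD unfolding *(3,4) by metis+
  show ?thesis
  proof (cases "us = []")
    case True
    then obtain ws where "vs = z # ws" using ends by (cases vs) auto
    then show ?thesis
      using deformable_insert[OF xs, of "[z]" ws b' xs' z] xs' True *(3,4) ends by simp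
  next
    case False
    then show ?thesis
      using deformable_insert[OF xs *(3) xs' *(4) ends(1)] by blast
  qed
qed

text \<open>
  By induction over the elementary steps of the homotopy, comparing arbitrary lifts of the intermediate
  chains.
\<close>

theorem homotopy_lifting:
  assumes xs: "entourage_chain X D a b xs" and xs': "entourage_chain X D a b' xs'"
    and h: "chain_homotopic Y (map_prod f f ` D) (map f xs) (map f xs')"
  shows "deformable xs xs'"
proof -
  have E_chain: "entourage_chain X E r s zs" if "entourage_chain X D r s zs" for r s zs
    using entourage_chain_mono[OF that] D_subset E0_subset by blast
  have fxs: "entourage_chain Y (map_prod f f ` D) (f a) (f b) (map f xs)"
    using xs f_closed unfolding entourage_chain_def
    by (auto simp: hd_map last_map successively_map elim!: successively_mono)
  have "\<forall>c zs. entourage_chain X D a c zs \<longrightarrow> map f zs = ys \<longrightarrow> deformable xs zs"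
    if "chain_homotopic Y (map_prod f f ` D) (map f xs) ys" for ys
    using that unfolding chain_homotopic_def
  proof (induction rule: equivclp_induct)
    case base
    have "deformable xs zs" if zs: "entourage_chain X D a c zs" "map f zs = map f xs" for c zs
    proof -
      have a: "a \<in> carrier X" using entourage_chainD[OF xs] by blast
      have rel: "list_all2 (\<lambda>x y. (x, y) \<in> R) xs zs"
        using lifts_related[OF xs zs(1)] zs(2) R_refl[OF a] by simp
      moreover have "(last xs, last zs) \<in> R"
        using rel entourage_chainD(1)[OF xs] entourage_chainD(1)[OF zs(1)]
        by (metis last_conv_nth list_all2_conv_all_nth diff_less length_greater_0_conv zero_less_one)
      ultimately show ?thesis
        using related_homotopic[of xs zs a b "last zs"] xs zs(1) entourage_chain_mono[OF _ D_subset]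
          entourage_chainD(4)[OF zs(1)]
        by (auto simp: deformable_def)
    qed
    then show ?case by blast
  next
    case (step ys ys')
    have hy: "chain_homotopic Y (map_prod f f ` D) (map f xs) ys"
      using step(1) by (simp add: chain_homotopic_def)
    have "entourage_chain Y (map_prod f f ` D) (f a) (f b) ys"
      using fxs chain_homotopic_chain_iff[OF hy] by simp
    then obtain ws where ws: "entourage_chain X D a (last ws) ws" "map f ws = ys"
      using lift_chain entourage_chainD(5)[OF xs] by blast
    have dw: "deformable xs ws" using step(3) ws by blast
    have "deformable xs zs" if zs: "entourage_chain X D a c zs" "map f zs = ys'" for c zs
    proof -
      have "deformable ws zs"
        using step(2) deformable_chain_insert[OF zs(1) ws(1)] deformable_chain_insert[OF ws(1) zs(1)]
          deformable_sym[OF E_chain[OF zs(1)]] zs(2) ws(2) by blast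
      then show ?thesis using deformable_trans[OF E_chain[OF xs] dw] by blast
    qed
    then show ?case by blast
  qed
  then show ?thesis using h xs' by blast
qed

end

section \<open>Covers as quotients by prodiscrete actions\<close>

context group_action
begin

lemma action_one: "x \<in> E \<Longrightarrow> \<phi> \<one> x = x"
  using id_eq_one by (metis restrict_apply')

lemma action_closed: "g \<in> carrier G \<Longrightarrow> x \<in> E \<Longrightarrow> \<phi> g x \<in> E"
  using surj_prop by blast

lemma action_inv:
  assumes "g \<in> carrier G" and "x \<in> E"
  shows "\<phi> (inv g) (\<phi> g x) = x" and "\<phi> g (\<phi> (inv g) x) = x"
proof -
  interpret group G using group_hom group_hom.axioms(1) by blast
  show "\<phi> (inv g) (\<phi> g x) = x" "\<phi> g (\<phi> (inv g) x) = x"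
    using composition_rule[of x "inv g" g] composition_rule[of x g "inv g"] assms
    by (simp_all add: action_one)
qed

lemma orbit_eq_iff:
  assumes "x \<in> E" and "y \<in> E"
  shows "orbit G \<phi> x = orbit G \<phi> y \<longleftrightarrow> (\<exists>g\<in>carrier G. y = \<phi> g x)"
proof -
  interpret group G using group_hom group_hom.axioms(1) by blast
  show ?thesis
  proof
    assume eq: "orbit G \<phi> x = orbit G \<phi> y"
    have "y \<in> orbit G \<phi> y"
      unfolding orbit_def using action_one[OF assms(2)] by (metis (mono_tags, lifting) mem_Collect_eq one_closed)
    then have "y \<in> orbit G \<phi> x" by (simp only: eq)
    then show "\<exists>g\<in>carrier G. y = \<phi> g x" unfolding orbit_def by blast
  next
    assume "\<exists>g\<in>carrier G. y = \<phi> g x"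
    then obtain g where g: "g \<in> carrier G" "y = \<phi> g x" by blast
    have "\<phi> h y = \<phi> (h \<otimes> g) x" if "h \<in> carrier G" for h
      using composition_rule[OF assms(1) that g(1)] g(2) by simp
    moreover have "\<phi> h x = \<phi> (h \<otimes> inv g) y" if "h \<in> carrier G" for h
      using composition_rule[OF assms(2) that, of "inv g"] g action_inv(1)[OF g(1) assms(1)] by simp
    ultimately show "orbit G \<phi> x = orbit G \<phi> y"
      unfolding orbit_def using g(1) by (auto; metis m_closed inv_closed)
  qed
qed

end

text \<open>
  Intrinsic description of quotient maps: up to a uniform homeomorphism of the target, the map to the
  orbit space is determined by having the orbits as fibres and the images of entourages as entourages.
\<close>

lemma quotient_map_props:
  assumes X: "uniform_structure X" and Y: "uniform_structure Y"
    and act: "group_action G (carrier X) act"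
    and h: "unif_homeo (orbit_space G X act) Y h"
    and f': "\<forall>x\<in>carrier X. f x = h (orbit G act x)"
  shows "unif_cont X Y f" and "f ` carrier X = carrier Y"
    and "\<And>x y. x \<in> carrier X \<Longrightarrow> y \<in> carrier X \<Longrightarrow> f x = f y \<longleftrightarrow> (\<exists>g\<in>carrier G. y = act g x)"
    and "\<And>D. D \<in> entourages X \<Longrightarrow> map_prod f f ` D \<in> entourages Y"
proof -
  interpret X: unif_space X by unfold_locales fact
  interpret Y: unif_space Y by unfold_locales fact
  interpret group_action G "carrier X" act by fact
  have f: "f x = h (orbit G act x)" if "x \<in> carrier X" for x
    using f' that by blast
  let ?Q = "orbit_space G X act" and ?o = "orbit G act"
  have Qc: "carrier ?Q = ?o ` carrier X"
    by (auto simp: orbit_space_def orbits_def)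
  have Qe: "W \<in> entourages ?Q \<longleftrightarrow> W \<subseteq> carrier ?Q \<times> carrier ?Q \<and> sym W \<and>
      (\<exists>D\<in>entourages X. map_prod ?o ?o ` D \<subseteq> W)" for W
    unfolding orbit_space_def entourages_uspace_of_base carrier_uspace_of_base by blast
  obtain k where hk: "unif_cont ?Q Y h" "unif_cont Y ?Q k"
    "\<And>x. x \<in> carrier ?Q \<Longrightarrow> k (h x) = x" "\<And>y. y \<in> carrier Y \<Longrightarrow> h (k y) = y"
    using h by (rule unif_homeoE) blast
  have fY: "f x \<in> carrier Y" if "x \<in> carrier X" for x
    using that f Qc unif_contD(1)[OF hk(1)] by auto
  show "unif_cont X Y f"
  proof (rule unif_contI)
    fix V assume "V \<in> entourages Y"
    then obtain W where W: "W \<in> entourages ?Q" "\<forall>x y. (x, y) \<in> W \<longrightarrow> (h x, h y) \<in> V"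
      using unif_contD(2)[OF hk(1)] by blast
    then obtain D where D: "D \<in> entourages X" "map_prod ?o ?o ` D \<subseteq> W"
      using Qe by blast
    have "(f x, f y) \<in> V" if "(x, y) \<in> D" for x y
      using that W(2) D(2) f X.entourage_carrier[OF D(1) that] by auto
    then show "\<exists>D\<in>entourages X. \<forall>x y. (x, y) \<in> D \<longrightarrow> (f x, f y) \<in> V"
      using D(1) by blast
  qed (rule fY)
  show "f ` carrier X = carrier Y"
  proof
    show "carrier Y \<subseteq> f ` carrier X"
    proof
      fix y assume y: "y \<in> carrier Y"
      then obtain x where "x \<in> carrier X" "k y = ?o x"
        using unif_contD(1)[OF hk(2)] Qc by blast
      then show "y \<in> f ` carrier X" using f hk(4)[OF y] by (metis image_eqI)
    qed
  qed (use fY in blast)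
  show "f x = f y \<longleftrightarrow> (\<exists>g\<in>carrier G. y = act g x)" if "x \<in> carrier X" "y \<in> carrier X" for x y
  proof -
    have "f x = f y \<longleftrightarrow> ?o x = ?o y"
      using that f hk(3) Qc by (metis image_eqI)
    then show ?thesis using orbit_eq_iff[OF that] by simp
  qed
  show "map_prod f f ` D \<in> entourages Y" if D: "D \<in> entourages X" for D
  proof -
    let ?W = "map_prod ?o ?o ` D"
    have "?W \<in> entourages ?Q"
      unfolding Qe Qc using D X.entourage_carrier[OF D] X.entourage_sym[OF D]
      by (auto simp: sym_def)
    then obtain U where U: "U \<in> entourages Y" "\<forall>x y. (x, y) \<in> U \<longrightarrow> (k x, k y) \<in> ?W"
      using unif_contD(2)[OF hk(2)] by blast
    have "U \<subseteq> map_prod f f ` D"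
    proof (rule subrelI)
      fix x y assume xy: "(x, y) \<in> U"
      then obtain u v where uv: "(u, v) \<in> D" "k x = ?o u" "k y = ?o v" using U(2) by fastforce
      then have "x = f u" "y = f v"
        using f hk(4) X.entourage_carrier[OF D uv(1)] Y.entourage_carrier[OF U(1) xy] by metis+
      then show "(x, y) \<in> map_prod f f ` D" using uv(1) by force
    qed
    moreover have "map_prod f f ` D \<subseteq> carrier Y \<times> carrier Y"
      using fY X.entourage_carrier[OF D] by auto
    moreover have "sym (map_prod f f ` D)"
      using X.entourage_sym[OF D] by (auto simp: sym_def)
    ultimately show ?thesis using Y.entourage_superset[OF U(1)] by blast
  qed
qed

locale action_limit =
  fixes I :: "'i set" and leq and S :: "'i \<Rightarrow> 'x uspace" and b
    and H :: "'i \<Rightarrow> 'h monoid" and \<theta> and a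
  assumes system: "discrete_action_system I leq S b H \<theta> a"
begin

lemma directed: "directed_set I leq"
  using system unfolding discrete_action_system_def by blast

lemma level_uniform: "i \<in> I \<Longrightarrow> uniform_structure (S i)"
  using system unfolding discrete_action_system_def by blast

lemma level_group: "i \<in> I \<Longrightarrow> group (H i)"
  using system unfolding discrete_action_system_def by blast

lemma level_hom: "i \<in> I \<Longrightarrow> j \<in> I \<Longrightarrow> leq i j \<Longrightarrow> group_hom (H j) (H i) (\<theta> i j)"
  using system level_group unfolding discrete_action_system_def group_hom_def group_hom_axioms_def by blast

lemma level_discrete: "i \<in> I \<Longrightarrow> acts_discretely (H i) (S i) (a i)"
  using system unfolding discrete_action_system_def by blast

lemma level_unif: "i \<in> I \<Longrightarrow> acts_uniformly (H i) (S i) (a i)"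
  using level_discrete by (simp add: acts_discretely_def)

lemma level_action: "i \<in> I \<Longrightarrow> group_action (H i) (carrier (S i)) (a i)"
  using level_unif by (simp add: acts_uniformly_def)

lemma level_equivariant: "i \<in> I \<Longrightarrow> j \<in> I \<Longrightarrow> leq i j \<Longrightarrow> h \<in> carrier (H j) \<Longrightarrow> x \<in> carrier (S j) \<Longrightarrow>
    b i j (a j h x) = a i (\<theta> i j h) (b i j x)"
  using system unfolding discrete_action_system_def by blast

lemma finite_upper_bound: "finite J \<Longrightarrow> J \<subseteq> I \<Longrightarrow> \<exists>i\<in>I. \<forall>j\<in>J. leq j i"
proof (induction J rule: finite_induct)
  case empty then show ?case using directed unfolding directed_set_def by blast
next
  case (insert j J)
  have trans: "leq k m" if "k \<in> I" "l \<in> I" "m \<in> I" "leq k l" "leq l m" for k l m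
    using directed that unfolding directed_set_def by blast
  obtain i where i: "i \<in> I" "\<forall>j\<in>J. leq j i" using insert by auto
  moreover have "j \<in> I" "J \<subseteq> I" using insert.prems by auto
  moreover have "\<forall>i\<in>I. \<forall>j\<in>I. \<exists>k\<in>I. leq i k \<and> leq j k"
    using directed unfolding directed_set_def by blast
  ultimately obtain k where k: "k \<in> I" "leq i k" "leq j k" by blast
  have "leq l k" if "l \<in> J" for l
    using trans[of l i k] i k that \<open>J \<subseteq> I\<close> by blast
  then show ?case using k by blast
qed

end

text \<open>
  The assumptions from \<open>invariant_below\<close> to \<open>equivariant\<close> come from the definitions of a prodiscrete and of an
  isomorphic action; the last three describe its quotient map as in \<open>quotient_map_props\<close>.
\<close>

locale prodiscrete_quotient = X: unif_space X + Y: unif_space Y + group_action G "carrier X" act +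
    lim: action_limit I leq S b H \<theta> a
  for X :: "'a uspace" and Y :: "'b uspace" and G :: "'g monoid" and act
    and I :: "'i set" and leq and S :: "'i \<Rightarrow> 'x uspace" and b and H :: "'i \<Rightarrow> 'h monoid" and \<theta> and a +
  fixes \<Phi> and \<Psi> and f :: "'a \<Rightarrow> 'b"
  assumes invariant_below: "V \<in> entourages X \<Longrightarrow>
      \<exists>D\<in>entourages X. D \<subseteq> V \<and> (\<forall>g\<in>carrier G. \<forall>x y. (x, y) \<in> D \<longrightarrow> (act g x, act g y) \<in> D)"
    and homeo: "unif_homeo X (uspace_limit I leq S b) \<Phi>"
    and iso: "\<Psi> \<in> iso G (group_limit I leq H \<theta>)"
    and equivariant: "g \<in> carrier G \<Longrightarrow> x \<in> carrier X \<Longrightarrow> i \<in> I \<Longrightarrow> \<Phi> (act g x) i = a i (\<Psi> g i) (\<Phi> x i)"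
    and f_closed: "x \<in> carrier X \<Longrightarrow> f x \<in> carrier Y"
    and f_eq_iff: "x \<in> carrier X \<Longrightarrow> y \<in> carrier X \<Longrightarrow> f x = f y \<longleftrightarrow> (\<exists>g\<in>carrier G. y = act g x)"
    and f_image: "D \<in> entourages X \<Longrightarrow> map_prod f f ` D \<in> entourages Y"
begin

sublocale group G
  using group_hom group_hom.axioms(1) by blast

lemma \<Phi>_threads: "x \<in> carrier X \<Longrightarrow> \<Phi> x \<in> threads I leq (\<lambda>i. carrier (S i)) b"
  using homeo by (auto simp: unif_homeo_def uspace_limit_carrier dest: bij_betwE)

lemma \<Phi>_closed: "x \<in> carrier X \<Longrightarrow> i \<in> I \<Longrightarrow> \<Phi> x i \<in> carrier (S i)"
  using \<Phi>_threads[of x] by (auto simp: threads_def)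

lemma \<Psi>_threads: "g \<in> carrier G \<Longrightarrow> \<Psi> g \<in> threads I leq (\<lambda>i. carrier (H i)) \<theta>"
  using iso by (auto simp: iso_def hom_def group_limit_def)

lemma \<Psi>_closed: "g \<in> carrier G \<Longrightarrow> i \<in> I \<Longrightarrow> \<Psi> g i \<in> carrier (H i)"
  using \<Psi>_threads[of g] by (auto simp: threads_def)

lemma \<Psi>_mult: "g \<in> carrier G \<Longrightarrow> h \<in> carrier G \<Longrightarrow> i \<in> I \<Longrightarrow>
    \<Psi> (g \<otimes>\<^bsub>G\<^esub> h) i = \<Psi> g i \<otimes>\<^bsub>H i\<^esub> \<Psi> h i"
  using iso by (auto simp: iso_def hom_def group_limit_def)

lemma \<Psi>_hom: "i \<in> I \<Longrightarrow> group_hom G (H i) (\<lambda>g. \<Psi> g i)"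
  using lim.level_group \<Psi>_closed \<Psi>_mult is_group
  by (auto simp: group_hom_def group_hom_axioms_def hom_def)

lemma \<Psi>_trivial:
  assumes g: "g \<in> carrier G" and "\<And>i. i \<in> I \<Longrightarrow> \<Psi> g i = \<one>\<^bsub>H i\<^esub>"
  shows "g = \<one>\<^bsub>G\<^esub>"
proof -
  have "\<Psi> g i = \<Psi> \<one>\<^bsub>G\<^esub> i" if "i \<in> I" for i
    using assms(2)[OF that] group_hom.hom_one[OF \<Psi>_hom[OF that]] by simp
  then have "\<Psi> g = \<Psi> \<one>\<^bsub>G\<^esub>"
    using \<Psi>_threads[OF g] \<Psi>_threads[of "\<one>\<^bsub>G\<^esub>"]
    by (intro extensionalityI[of _ I]) (auto simp: threads_def PiE_iff)
  then show ?thesis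
    using iso g by (auto simp: iso_def bij_betw_def inj_on_def)
qed

lemma \<Psi>_surj:
  assumes "h \<in> threads I leq (\<lambda>i. carrier (H i)) \<theta>"
  obtains g where "g \<in> carrier G" "\<Psi> g = h"
proof -
  have "\<Psi> ` carrier G = threads I leq (\<lambda>i. carrier (H i)) \<theta>"
    using iso by (auto simp: iso_def bij_betw_def group_limit_def)
  then show thesis using assms that by (metis imageE)
qed

lemma coordinate_entourage:
  assumes i: "i \<in> I" and V: "V \<in> entourages (S i)"
  shows "\<exists>W\<in>entourages X. \<forall>x y. (x, y) \<in> W \<longrightarrow> (\<Phi> x i, \<Phi> y i) \<in> V"
proof -
  interpret Si: unif_space "S i" by unfold_locales (rule lim.level_uniform[OF i])
  let ?T = "threads I leq (\<lambda>i. carrier (S i)) b"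
  define U where "U = {(c, d) \<in> ?T \<times> ?T. \<forall>j\<in>{i}. (c j, d j) \<in> (\<lambda>_. V) j}"
  have "\<exists>J W. U = {(c, d) \<in> ?T \<times> ?T. \<forall>j\<in>J. (c j, d j) \<in> W j} \<and>
      finite J \<and> J \<subseteq> I \<and> (\<forall>j\<in>J. W j \<in> entourages (S j))"
    unfolding U_def using i V by (intro exI[of _ "{i}"] exI[of _ "\<lambda>_. V"]) auto
  moreover have "sym U" "U \<subseteq> ?T \<times> ?T"
    using Si.entourage_sym[OF V] by (auto simp: U_def sym_def)
  ultimately have "U \<in> entourages (uspace_limit I leq S b)"
    unfolding uspace_limit_def Let_def entourages_uspace_of_base by blast
  then obtain W where W: "W \<in> entourages X" "\<forall>x y. (x, y) \<in> W \<longrightarrow> (\<Phi> x, \<Phi> y) \<in> U"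
    using homeo unif_contD(2) unfolding unif_homeo_def by metis
  moreover have "(c i, d i) \<in> V" if "(c, d) \<in> U" for c d
    using that by (simp add: U_def)
  ultimately show ?thesis by (intro bexI[of _ W]) simp_all
qed

text \<open>Discreteness of the action of \<open>H i\<close>, pulled back to \<open>X\<close>.\<close>

lemma discrete_below:
  assumes i: "i \<in> I"
  shows "\<exists>W\<in>entourages X. \<forall>g\<in>carrier G. \<forall>x\<in>carrier X. (act g x, x) \<in> W \<longrightarrow> \<Psi> g i = \<one>\<^bsub>H i\<^esub>"
proof -
  obtain V where V: "V \<in> entourages (S i)"
    "\<forall>h\<in>carrier (H i). (\<exists>x\<in>carrier (S i). (a i h x, x) \<in> V) \<longrightarrow> h = \<one>\<^bsub>H i\<^esub>"
    using lim.level_discrete[OF i] by (auto simp: acts_discretely_def)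
  obtain W where W: "W \<in> entourages X" "\<forall>x y. (x, y) \<in> W \<longrightarrow> (\<Phi> x i, \<Phi> y i) \<in> V"
    using coordinate_entourage[OF i V(1)] by blast
  have "\<Psi> g i = \<one>\<^bsub>H i\<^esub>" if g: "g \<in> carrier G" and x: "x \<in> carrier X" and "(act g x, x) \<in> W" for g x
  proof -
    have "(a i (\<Psi> g i) (\<Phi> x i), \<Phi> x i) \<in> V"
      using that W(2) equivariant[OF g x i] by metis
    then show ?thesis using V(2) \<Psi>_closed[OF g i] \<Phi>_closed[OF x i] by blast
  qed
  then show ?thesis using W(1) by blast
qed

text \<open>By directedness, a single coordinate controls any given entourage.\<close>

lemma coordinate_below:
  assumes V: "V \<in> entourages X"
  shows "\<exists>i\<in>I. \<forall>x\<in>carrier X. \<forall>y\<in>carrier X. \<Phi> x i = \<Phi> y i \<longrightarrow> (x, y) \<in> V"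
proof -
  let ?T = "threads I leq (\<lambda>i. carrier (S i)) b"
  obtain k where k: "unif_cont (uspace_limit I leq S b) X k" "\<And>x. x \<in> carrier X \<Longrightarrow> k (\<Phi> x) = x"
    using homeo by (rule unif_homeoE) blast
  obtain U where U: "U \<in> entourages (uspace_limit I leq S b)" "\<forall>c d. (c, d) \<in> U \<longrightarrow> (k c, k d) \<in> V"
    using unif_contD(2)[OF k(1) V] by blast
  obtain J W where JW: "finite J" "J \<subseteq> I" "\<forall>j\<in>J. W j \<in> entourages (S j)"
    "{(c, d) \<in> ?T \<times> ?T. \<forall>j\<in>J. (c j, d j) \<in> W j} \<subseteq> U"
    using U(1) unfolding uspace_limit_def Let_def entourages_uspace_of_base by blast
  obtain i where i: "i \<in> I" "\<forall>j\<in>J. leq j i" using lim.finite_upper_bound[OF JW(1,2)] by blast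
  have "(x, y) \<in> V" if x: "x \<in> carrier X" and y: "y \<in> carrier X" and eq: "\<Phi> x i = \<Phi> y i" for x y
  proof -
    have "(\<Phi> x j, \<Phi> y j) \<in> W j" if j: "j \<in> J" for j
    proof -
      have jI: "j \<in> I" using j JW(2) by blast
      have "b j i (\<Phi> x i) = \<Phi> x j" "b j i (\<Phi> y i) = \<Phi> y j"
        using \<Phi>_threads[OF x] \<Phi>_threads[OF y] i j jI by (simp_all add: threads_def)
      moreover interpret Sj: unif_space "S j" by unfold_locales (rule lim.level_uniform[OF jI])
      have "W j \<in> entourages (S j)" using JW(3) j by blast
      ultimately show ?thesis using eq Sj.entourage_refl[of "W j" "\<Phi> y j"] \<Phi>_closed[OF y jI] by metis
    qed
    then have "(\<Phi> x, \<Phi> y) \<in> U" using JW(4) \<Phi>_threads x y by blast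
    then show ?thesis using U(2) k(2) x y by metis
  qed
  then show ?thesis using i by blast
qed

text \<open>
  First a level \<open>i\<close> is chosen whose coordinate controls \<open>E0\<close>, so that the orbits of the kernel of \<open>\<lambda>g. \<Psi> g i\<close>
  are \<open>E0\<close>-small; then \<open>D\<close> is chosen so small that three steps in \<open>D\<close> between points of one orbit of \<open>G\<close>
  are given by elements of this kernel.
\<close>

theorem lifting_scale_exists:
  assumes E: "E \<in> entourages X"
  shows "\<exists>E0 D R. lifting_scale X Y f E E0 D R"
proof -
  obtain E0 where E0: "E0 \<in> entourages X" "E0 \<subseteq> E"
    "\<And>x y z. (x, y) \<in> E0 \<Longrightarrow> (y, z) \<in> E0 \<Longrightarrow> (x, z) \<in> E"
    using X.entourage_half[OF E] by blast
  obtain i where i: "i \<in> I" "\<forall>x\<in>carrier X. \<forall>y\<in>carrier X. \<Phi> x i = \<Phi> y i \<longrightarrow> (x, y) \<in> E0"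
    using coordinate_below[OF E0(1)] by blast
  obtain W where W: "W \<in> entourages X"
    "\<And>g x. g \<in> carrier G \<Longrightarrow> x \<in> carrier X \<Longrightarrow> (act g x, x) \<in> W \<Longrightarrow> \<Psi> g i = \<one>\<^bsub>H i\<^esub>"
    using discrete_below[OF i(1)] by blast
  obtain C where C: "C \<in> entourages X" "C \<subseteq> W \<inter> E0"
    "\<And>x y z. (x, y) \<in> C \<Longrightarrow> (y, z) \<in> C \<Longrightarrow> (x, z) \<in> W \<inter> E0"
    "\<And>w x y z. (w, x) \<in> C \<Longrightarrow> (x, y) \<in> C \<Longrightarrow> (y, z) \<in> C \<Longrightarrow> (w, z) \<in> W \<inter> E0"
    using X.entourage_third[OF X.entourage_Int[OF W(1) E0(1)]] by blast
  obtain D where D: "D \<in> entourages X" "D \<subseteq> C"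
    "\<And>g x y. g \<in> carrier G \<Longrightarrow> (x, y) \<in> D \<Longrightarrow> (act g x, act g y) \<in> D"
    using invariant_below[OF C(1)] by metis
  define R where "R = {(x, act g x) | x g. x \<in> carrier X \<and> g \<in> carrier G \<and> \<Psi> g i = \<one>\<^bsub>H i\<^esub>}"
  interpret \<Psi>i: group_hom G "H i" "\<lambda>g. \<Psi> g i" by (rule \<Psi>_hom[OF i(1)])
  interpret Ai: group_action "H i" "carrier (S i)" "a i" by (rule lim.level_action[OF i(1)])
  have fibre: "f (act g x) = f x" if "g \<in> carrier G" "x \<in> carrier X" for g x
    using f_eq_iff[of x "act g x"] that action_closed by auto
  have "lifting_scale X Y f E E0 D R"
  proof unfold_locales
    show "R \<subseteq> E0"
    proof (rule subrelI)
      fix x y assume "(x, y) \<in> R"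
      then obtain g where g: "x \<in> carrier X" "g \<in> carrier G" "\<Psi> g i = \<one>\<^bsub>H i\<^esub>" "y = act g x"
        by (auto simp: R_def)
      then have "\<Phi> y i = \<Phi> x i"
        using equivariant[of g x i] i(1) Ai.action_one[OF \<Phi>_closed[OF g(1) i(1)]] by simp
      then show "(x, y) \<in> E0" using i(2) g action_closed by metis
    qed
  next
    fix x assume "x \<in> carrier X"
    then have "(x, act \<one>\<^bsub>G\<^esub> x) \<in> R" by (auto simp: R_def intro!: exI[of _ "\<one>\<^bsub>G\<^esub>"])
    then show "(x, x) \<in> R" using action_one \<open>x \<in> carrier X\<close> by simp
  next
    fix x y assume "(x, y) \<in> R"
    then obtain g where g: "x \<in> carrier X" "g \<in> carrier G" "\<Psi> g i = \<one>\<^bsub>H i\<^esub>" "y = act g x"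
      by (auto simp: R_def)
    then have "x = act (inv\<^bsub>G\<^esub> g) y" "y \<in> carrier X" "\<Psi> (inv\<^bsub>G\<^esub> g) i = \<one>\<^bsub>H i\<^esub>"
      using action_inv(1) action_closed by auto
    then show "(y, x) \<in> R" using g(2) unfolding R_def by blast
  next
    fix x y z assume "(x, y) \<in> R" "(y, z) \<in> R"
    then obtain g h where g: "x \<in> carrier X" "g \<in> carrier G" "\<Psi> g i = \<one>\<^bsub>H i\<^esub>" "y = act g x"
      "h \<in> carrier G" "\<Psi> h i = \<one>\<^bsub>H i\<^esub>" "z = act h y"
      by (auto simp: R_def)
    then have "z = act (h \<otimes>\<^bsub>G\<^esub> g) x" "\<Psi> (h \<otimes>\<^bsub>G\<^esub> g) i = \<one>\<^bsub>H i\<^esub>"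
      using composition_rule by auto
    then show "(x, z) \<in> R" using g unfolding R_def by blast
  next
    fix x y assume "(x, y) \<in> R"
    then show "f x = f y" using fibre by (auto simp: R_def)
  next
    fix w x y z assume "(w, x) \<in> D" "(x, y) \<in> D" "(y, z) \<in> D" "f w = f z"
    then have wz: "(w, z) \<in> W" "w \<in> carrier X" "z \<in> carrier X"
      using C(4) D(2) X.entourage_carrier[OF D(1)] by blast+
    then obtain g where g: "g \<in> carrier G" "z = act g w" using f_eq_iff \<open>f w = f z\<close> by metis
    then have "\<Psi> g i = \<one>\<^bsub>H i\<^esub>" using W(2) wz X.entourage_sym[OF W(1)] by blast
    then show "(w, z) \<in> R" using g wz unfolding R_def by blast
  next
    fix x y x' assume xy: "(x, y) \<in> D" and "(x, x') \<in> R"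
    then obtain g where g: "g \<in> carrier G" "\<Psi> g i = \<one>\<^bsub>H i\<^esub>" "x' = act g x"
      by (auto simp: R_def)
    then have "(x', act g y) \<in> D" "(y, act g y) \<in> R"
      using D(3) xy X.entourage_carrier[OF D(1) xy] by (auto simp: R_def)
    then show "\<exists>y'. (x', y') \<in> D \<and> (y, y') \<in> R" by blast
  next
    fix x y x' assume xy: "(x, y) \<in> D" "x' \<in> carrier X" "f x' = f x"
    then obtain g where g: "g \<in> carrier G" "x' = act g x"
      using f_eq_iff[of x x'] X.entourage_carrier[OF D(1) xy(1)] by auto
    then show "\<exists>y'. (x', y') \<in> D \<and> f y' = f y"
      using D(3)[OF g(1) xy(1)] fibre[OF g(1)] X.entourage_carrier[OF D(1) xy(1)] by blast
  next
    show "(x, z) \<in> E0" if "(x, y) \<in> D" "(y, z) \<in> D" for x y z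
      using C(3) D(2) that by blast
  qed (use E E0 D(1) f_image f_closed in auto)
  then show ?thesis by blast
qed

text \<open>
  The group element moving \<open>x\<close> to \<open>y\<close> moves \<open>x\<close> less than every entourage, so it is trivial in every
  discrete level. The space \<open>X\<close> itself may fail to be Hausdorff.
\<close>

theorem fibre_separated:
  assumes x: "x \<in> carrier X" and y: "y \<in> carrier X" and "f x = f y"
    and near: "\<And>E. E \<in> entourages X \<Longrightarrow> (x, y) \<in> E"
  shows "x = y"
proof -
  obtain g where g: "g \<in> carrier G" "y = act g x" using f_eq_iff[OF x y] assms(3) by blast
  have "\<Psi> g i = \<one>\<^bsub>H i\<^esub>" if "i \<in> I" for i
    using discrete_below[OF that] near g x X.entourage_sym by metis
  then show ?thesis using \<Psi>_trivial[OF g(1)] g action_one[OF x] by simp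
qed

text \<open>
  Fibres are complete: relative to a point \<open>x\<^sub>0\<close> of the fibre, the net is given by group elements whose
  images in each discrete level are eventually constant, and \<open>G\<close> is the inverse limit of the levels.
\<close>

theorem fibre_complete:
  assumes xs: "\<And>E. E \<in> entourages X \<Longrightarrow> x E \<in> carrier X \<and> f (x E) = y"
    and cauchy: "\<And>E. E \<in> entourages X \<Longrightarrow> \<exists>D\<in>entourages X. \<exists>z. \<forall>D'\<in>entourages X. D' \<subseteq> D \<longrightarrow> (x D', z) \<in> E"
  shows "\<exists>l\<in>carrier X. f l = y \<and>
    (\<forall>E\<in>entourages X. \<exists>D\<in>entourages X. \<forall>D'\<in>entourages X. D' \<subseteq> D \<longrightarrow> (x D', l) \<in> E)"
proof -
  define x0 where "x0 = x (carrier X \<times> carrier X)"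
  have x0: "x0 \<in> carrier X" "f x0 = y" using xs X.entourage_top by (simp_all add: x0_def)
  have "\<forall>E\<in>entourages X. \<exists>g\<in>carrier G. x E = act g x0"
    using f_eq_iff[OF x0(1)] xs x0 by metis
  then obtain g where g: "\<And>E. E \<in> entourages X \<Longrightarrow> g E \<in> carrier G"
    "\<And>E. E \<in> entourages X \<Longrightarrow> x E = act (g E) x0" by metis
  have "\<exists>D\<in>entourages X. \<forall>D'\<in>entourages X. D' \<subseteq> D \<longrightarrow> \<Psi> (g D') i = \<Psi> (g D) i" if i: "i \<in> I" for i
  proof -
    obtain W where W: "W \<in> entourages X"
      "\<And>k x. k \<in> carrier G \<Longrightarrow> x \<in> carrier X \<Longrightarrow> (act k x, x) \<in> W \<Longrightarrow> \<Psi> k i = \<one>\<^bsub>H i\<^esub>"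
      using discrete_below[OF i] by blast
    obtain C where C: "C \<in> entourages X"
      "\<And>x y z. (x, y) \<in> C \<Longrightarrow> (y, z) \<in> C \<Longrightarrow> (x, z) \<in> W"
      by (rule X.entourage_half[OF W(1)]) blast
    obtain D z where D: "D \<in> entourages X" "\<And>D'. D' \<in> entourages X \<Longrightarrow> D' \<subseteq> D \<Longrightarrow> (x D', z) \<in> C"
      using cauchy[OF C(1)] by blast
    interpret \<Psi>i: group_hom G "H i" "\<lambda>g. \<Psi> g i" by (rule \<Psi>_hom[OF i])
    have "\<Psi> (g D') i = \<Psi> (g D) i" if D': "D' \<in> entourages X" "D' \<subseteq> D" for D'
    proof -
      have "(x D', x D) \<in> W"
        using C(2) D(2)[OF D'] X.entourage_sym[OF C(1) D(2)[OF D(1)]] by blast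
      moreover have "x D' = act (g D' \<otimes>\<^bsub>G\<^esub> inv\<^bsub>G\<^esub> (g D)) (x D)"
        using g D' D(1) composition_rule[of "x D" "g D'" "inv\<^bsub>G\<^esub> (g D)"] action_inv(1)[of "g D" x0] x0
          action_closed[of "g D" x0] by auto
      ultimately have "\<Psi> (g D' \<otimes>\<^bsub>G\<^esub> inv\<^bsub>G\<^esub> (g D)) i = \<one>\<^bsub>H i\<^esub>"
        using W(2)[of "g D' \<otimes>\<^bsub>G\<^esub> inv\<^bsub>G\<^esub> (g D)" "x D"] g D' D(1) xs by simp
      then have "\<Psi> (g D') i \<otimes>\<^bsub>H i\<^esub> inv\<^bsub>H i\<^esub> (\<Psi> (g D) i) = \<one>\<^bsub>H i\<^esub>"
        using g D' D(1) by simp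
      then show ?thesis
        using \<Psi>i.H.inv_equality[of "\<Psi> (g D') i" "inv\<^bsub>H i\<^esub> (\<Psi> (g D) i)"] g D' D(1) by simp
    qed
    then show ?thesis using D(1) by blast
  qed
  then have "\<forall>i\<in>I. \<exists>D. D \<in> entourages X \<and> (\<forall>D'\<in>entourages X. D' \<subseteq> D \<longrightarrow> \<Psi> (g D') i = \<Psi> (g D) i)"
    by blast
  from bchoice[OF this] obtain N where N: "\<forall>i\<in>I. N i \<in> entourages X \<and>
      (\<forall>D'\<in>entourages X. D' \<subseteq> N i \<longrightarrow> \<Psi> (g D') i = \<Psi> (g (N i)) i)"
    by (elim exE)
  then have Ne: "N i \<in> entourages X" if "i \<in> I" for i
    using that by blast
  \<comment> \<open>the eventual values of the net in the levels\<close>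
  define h where "h = (\<lambda>i\<in>I. \<Psi> (g (N i)) i)"
  have h: "\<Psi> (g D) i = h i" if "i \<in> I" "D \<in> entourages X" "D \<subseteq> N i" for i D
  proof -
    have "\<Psi> (g D) i = \<Psi> (g (N i)) i" using N that by blast
    then show ?thesis using that(1) by (simp add: h_def)
  qed
  have "h \<in> threads I leq (\<lambda>i. carrier (H i)) \<theta>"
  proof -
    have "\<theta> i j (h j) = h i" if ij: "i \<in> I" "j \<in> I" "leq i j" for i j
    proof -
      let ?D = "N i \<inter> N j"
      have D: "?D \<in> entourages X" using X.entourage_Int[OF Ne[OF ij(1)] Ne[OF ij(2)]] .
      then have "\<theta> i j (\<Psi> (g ?D) j) = \<Psi> (g ?D) i"
        using \<Psi>_threads[OF g(1)[OF D]] ij by (simp add: threads_def)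
      then show ?thesis using h[OF ij(1) D] h[OF ij(2) D] by simp
    qed
    moreover have "h \<in> (\<Pi>\<^sub>E i\<in>I. carrier (H i))"
      using \<Psi>_closed[OF g(1)[OF Ne]] by (auto simp: h_def)
    ultimately show ?thesis by (simp add: threads_def)
  qed
  then obtain k where k: "k \<in> carrier G" "\<Psi> k = h" by (rule \<Psi>_surj)
  let ?l = "act k x0"
  have l: "?l \<in> carrier X" using k x0 action_closed by simp
  have "f ?l = y" using f_eq_iff[OF x0(1) l] k x0 by auto
  moreover have "\<exists>D\<in>entourages X. \<forall>D'\<in>entourages X. D' \<subseteq> D \<longrightarrow> (x D', ?l) \<in> E"
    if E: "E \<in> entourages X" for E
  proof -
    obtain i where i: "i \<in> I" "\<forall>x\<in>carrier X. \<forall>y\<in>carrier X. \<Phi> x i = \<Phi> y i \<longrightarrow> (x, y) \<in> E"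
      using coordinate_below[OF E] by blast
    have "(x D', ?l) \<in> E" if D': "D' \<in> entourages X" "D' \<subseteq> N i" for D'
    proof -
      have "\<Phi> (x D') i = \<Phi> ?l i"
        using g[OF D'(1)] equivariant[OF _ x0(1) i(1)] h[OF i(1) D'] k by simp
      then show ?thesis using i(2) xs[OF D'(1)] l by blast
    qed
    then show ?thesis using Ne[OF i(1)] by blast
  qed
  ultimately show ?thesis using l by blast
qed

end

section \<open>A cover induces a uniform homeomorphism of the limits of chain spaces\<close>

text \<open>
  The map on threads induced by applying \<open>f\<close> to chains. The coordinate of index \<open>F\<close> is computed from the
  coordinate whose index is the preimage of \<open>F\<close>; all the classes united are equal
  (\<open>f_tilde_coordinate\<close> below).
\<close>

definition tilde_map ::
    "'a uspace \<Rightarrow> 'b uspace \<Rightarrow> ('a \<Rightarrow> 'b) \<Rightarrow> (('a \<times> 'a) set \<Rightarrow> 'a list set) \<Rightarrow> ('b \<times> 'b) set \<Rightarrow> 'b list set" where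
  "tilde_map X Y f c =
     (\<lambda>F\<in>entourages Y. \<Union>xs\<in>c {(x, y) \<in> carrier X \<times> carrier X. (f x, f y) \<in> F}. chain_class Y F (map f xs))"

lemma entourage_chain_map:
  assumes "entourage_chain X E a b xs"
    and "\<And>x. x \<in> carrier X \<Longrightarrow> f x \<in> carrier Y" and "\<And>x y. (x, y) \<in> E \<Longrightarrow> (f x, f y) \<in> F"
  shows "entourage_chain Y F (f a) (f b) (map f xs)"
  using assms unfolding entourage_chain_def
  by (auto simp: hd_map last_map successively_map elim!: successively_mono)

lemma tilde_base_in_tilde:
  assumes "uniform_structure X" and "p \<in> carrier X"
  shows "tilde_base X p \<in> carrier (tilde X p)"
proof -
  interpret chain_system X p "entourages X"
    using assms by unfold_locales (auto simp: entourage_base_def)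
  show ?thesis
    unfolding tilde_eq_chain_limit
    by (rule pointsI) (auto simp: tilde_base_def basepoint intro!: bexI[of _ "[p]"])
qed

text \<open>
  What a cover offers without reference to its group: lifting of chains and homotopies at every scale,
  and fibres that are separated and complete.
\<close>

locale lifting_cover = X: unif_space X + Y: unif_space Y for X :: "'a uspace" and Y :: "'b uspace" +
  fixes f :: "'a \<Rightarrow> 'b"
  assumes f_cont: "unif_cont X Y f"
    and scale: "E \<in> entourages X \<Longrightarrow> \<exists>E0 D R. lifting_scale X Y f E E0 D R"
    and separated: "x \<in> carrier X \<Longrightarrow> y \<in> carrier X \<Longrightarrow> f x = f y \<Longrightarrow>
      (\<And>E. E \<in> entourages X \<Longrightarrow> (x, y) \<in> E) \<Longrightarrow> x = y"
    and complete: "(\<And>E. E \<in> entourages X \<Longrightarrow> u E \<in> carrier X \<and> f (u E) = z) \<Longrightarrow>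
      (\<And>E. E \<in> entourages X \<Longrightarrow> \<exists>D\<in>entourages X. \<exists>l. \<forall>D'\<in>entourages X. D' \<subseteq> D \<longrightarrow> (u D', l) \<in> E) \<Longrightarrow>
      \<exists>l\<in>carrier X. f l = z \<and>
        (\<forall>E\<in>entourages X. \<exists>D\<in>entourages X. \<forall>D'\<in>entourages X. D' \<subseteq> D \<longrightarrow> (u D', l) \<in> E)"
begin

lemma f_closed: "x \<in> carrier X \<Longrightarrow> f x \<in> carrier Y"
  using unif_contD(1)[OF f_cont] .

text \<open>
  On a chain connected space, two lifts of the same map are related by \<open>R\<close> along every chain that is
  fine enough, so they agree by separatedness of the fibres.
\<close>

lemma lifts_agree:
  assumes Z: "uniform_structure Z" and g: "unif_cont Z X g" and h: "unif_cont Z X h"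
    and lifts: "\<And>z. z \<in> carrier Z \<Longrightarrow> f (g z) = f (h z)"
    and start: "g z0 = h z0"
    and connected: "\<And>W z. W \<in> entourages Z \<Longrightarrow> z \<in> carrier Z \<Longrightarrow> \<exists>zs. entourage_chain Z W z0 z zs"
    and z: "z \<in> carrier Z"
  shows "g z = h z"
proof (rule separated)
  interpret Z: unif_space Z by unfold_locales fact
  show "g z \<in> carrier X" "h z \<in> carrier X" "f (g z) = f (h z)"
    using z unif_contD(1)[OF g] unif_contD(1)[OF h] lifts by blast+
  fix E assume E: "E \<in> entourages X"
  then obtain E0 D R where s: "lifting_scale X Y f E E0 D R" using scale by blast
  interpret lifting_scale X Y f E E0 D R by (rule s)
  obtain V where V: "V \<in> entourages Z" "\<forall>x y. (x, y) \<in> V \<longrightarrow> (g x, g y) \<in> D"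
    using unif_contD(2)[OF g D] by blast
  obtain W where W: "W \<in> entourages Z" "\<forall>x y. (x, y) \<in> W \<longrightarrow> (h x, h y) \<in> D"
    using unif_contD(2)[OF h D] by blast
  obtain zs where zs: "entourage_chain Z (V \<inter> W) z0 z zs"
    using connected[OF Z.entourage_Int[OF V(1) W(1)] z] by blast
  have "(g b, h b) \<in> R" if "entourage_chain Z (V \<inter> W) a b zs" "(g a, h a) \<in> R" for a b zs
    using that
  proof (induction zs arbitrary: a)
    case (Cons x zs)
    show ?case
    proof (cases "zs = []")
      case False
      then have c: "entourage_chain Z (V \<inter> W) (hd zs) b zs" "(a, hd zs) \<in> V" "(a, hd zs) \<in> W"
        using Cons.prems(1) by (auto simp: entourage_chain_Cons_iff)
      have gh: "(g a, g (hd zs)) \<in> D" "(h a, h (hd zs)) \<in> D" using c V W by blast+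
      obtain w where w: "(h a, w) \<in> D" "(g (hd zs), w) \<in> R" using R_D[OF gh(1) Cons.prems(2)] by blast
      have "f w = f (h (hd zs))"
        using R_fibre[OF w(2)] lifts entourage_chainD(5)[OF c(1)] by simp
      then have "(w, h (hd zs)) \<in> R"
        using D_D_fibre[of w "h a" "h (hd zs)"] gh(2) X.entourage_sym[OF D w(1)] by simp
      then show ?thesis using Cons.IH[OF c(1)] w(2) R_trans by blast
    qed (use Cons.prems in \<open>auto simp: entourage_chain_Cons_iff\<close>)
  qed simp
  moreover have "(g z0, h z0) \<in> R"
    using start R_refl[OF unif_contD(1)[OF g entourage_chainD(5)[OF zs]]] by simp
  ultimately show "(g z, h z) \<in> E" using zs R_E0 E0_subset by blast
qed

end

locale pointed_lifting_cover = lifting_cover X Y f for X :: "'a uspace" and Y :: "'b uspace" and f +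
  fixes p :: 'a
  assumes basepoint: "p \<in> carrier X"
begin

sublocale CX: chain_system X p "entourages X"
  by unfold_locales (auto simp: basepoint entourage_base_def)

sublocale CY: chain_system Y "f p" "entourages Y"
  by unfold_locales (auto simp: f_closed basepoint entourage_base_def)

abbreviation pre where "pre F \<equiv> {(x, y) \<in> carrier X \<times> carrier X. (f x, f y) \<in> F}"

abbreviation f_tilde where "f_tilde \<equiv> tilde_map X Y f"

lemma pre_entourage:
  assumes F: "F \<in> entourages Y"
  shows "pre F \<in> entourages X"
proof -
  obtain U where U: "U \<in> entourages X" "\<forall>x y. (x, y) \<in> U \<longrightarrow> (f x, f y) \<in> F"
    using unif_contD(2)[OF f_cont F] by blast
  then have "U \<subseteq> pre F" using X.entourage_carrier[OF U(1)] by blast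
  moreover have "sym (pre F)" using Y.entourage_sym[OF F] by (auto simp: sym_def)
  ultimately show ?thesis using X.entourage_superset[OF U(1)] by blast
qed

lemma chain_map:
  "entourage_chain X E a b xs \<Longrightarrow> E \<subseteq> pre F \<Longrightarrow> entourage_chain Y F (f a) (f b) (map f xs)"
  by (rule entourage_chain_map) (auto simp: f_closed)

lemma homotopic_map:
  "chain_homotopic X E xs ys \<Longrightarrow> E \<subseteq> pre F \<Longrightarrow> chain_homotopic Y F (map f xs) (map f ys)"
  by (erule chain_homotopic_map) (rule chain_map)

lemma f_tilde_coordinate:
  assumes c: "c \<in> CX.points" and F: "F \<in> entourages Y" and E: "E \<in> entourages X" "E \<subseteq> pre F"
    and xs: "xs \<in> c E"
  shows "f_tilde c F = chain_class Y F (map f xs)"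
proof -
  have xs': "xs \<in> c (pre F)"
    using CX.coordinate_mono[OF c E(1) pre_entourage[OF F] E(2) xs] .
  have "chain_class Y F (map f ys) = chain_class Y F (map f xs)" if "ys \<in> c (pre F)" for ys
  proof -
    have "chain_homotopic X (pre F) ys xs"
      using CX.coordinate_chain(1)[OF c pre_entourage[OF F] that] xs' by (simp add: chain_class_def)
    then show ?thesis
      using homotopic_map[of "pre F" ys xs F] by (simp add: chain_class_eq_iff)
  qed
  then have "(\<Union>ys\<in>c (pre F). chain_class Y F (map f ys)) = chain_class Y F (map f xs)"
    using xs' by blast
  then show ?thesis using F by (simp add: tilde_map_def)
qed

lemma f_tilde_mem:
  "c \<in> CX.points \<Longrightarrow> F \<in> entourages Y \<Longrightarrow> E \<in> entourages X \<Longrightarrow> E \<subseteq> pre F \<Longrightarrow> xs \<in> c E \<Longrightarrow>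
    map f xs \<in> f_tilde c F"
  using f_tilde_coordinate[of c F E xs] chain_class_self[of "map f xs" Y F] by simp

lemma f_tilde_points:
  assumes c: "c \<in> CX.points"
  shows "f_tilde c \<in> CY.points"
proof (rule CY.pointsI)
  show "f_tilde c \<in> extensional (entourages Y)" by (simp add: tilde_map_def)
  fix F assume F: "F \<in> entourages Y"
  obtain xs where xs: "xs \<in> c (pre F)" using CX.coordinate_nonempty[OF c pre_entourage[OF F]] .
  show "f_tilde c F \<in> carrier (chain_space Y (f p) F)"
    unfolding f_tilde_coordinate[OF c F pre_entourage[OF F] order_refl xs]
    using chain_map[OF CX.coordinate_chain(2)[OF c pre_entourage[OF F] xs] order_refl] by blast
next
  fix D F assume DF: "D \<in> entourages Y" "F \<in> entourages Y" "D \<subseteq> F"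
  obtain xs where xs: "xs \<in> c (pre D)" using CX.coordinate_nonempty[OF c pre_entourage[OF DF(1)]] .
  then show "\<exists>xs\<in>f_tilde c D. xs \<in> f_tilde c F"
    using f_tilde_mem[OF c DF(1) pre_entourage[OF DF(1)] _ xs]
      f_tilde_mem[OF c DF(2) pre_entourage[OF DF(1)] _ xs] DF(3) by blast
qed

lemma f_tilde_proj:
  assumes c: "c \<in> CX.points"
  shows "tilde_proj Y (f_tilde c) = f (tilde_proj X c)"
proof -
  have F: "carrier Y \<times> carrier Y \<in> entourages Y" (is "?F \<in> _") by (rule Y.entourage_top)
  obtain xs where xs: "xs \<in> c (pre ?F)" using CX.coordinate_nonempty[OF c pre_entourage[OF F]] .
  have "xs \<noteq> []"
    using entourage_chainD(1)[OF CX.coordinate_chain(2)[OF c pre_entourage[OF F] xs]] .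
  moreover have "tilde_proj X c = last xs"
    using CX.tilde_proj_eq[OF X.entourage_top c pre_entourage[OF F] xs] .
  moreover have "tilde_proj Y (f_tilde c) = last (map f xs)"
    using CY.tilde_proj_eq[OF F f_tilde_points[OF c] F]
      f_tilde_mem[OF c F pre_entourage[OF F] order_refl xs] .
  ultimately show ?thesis by (simp add: last_map)
qed

lemma f_tilde_base: "f_tilde (tilde_base X p) = tilde_base Y (f p)"
proof (rule CY.points_eqI)
  have c: "tilde_base X p \<in> CX.points"
    using tilde_base_in_tilde[OF X.uniform_structure basepoint] by (simp add: tilde_eq_chain_limit)
  show "f_tilde (tilde_base X p) \<in> CY.points" by (rule f_tilde_points[OF c])
  show "tilde_base Y (f p) \<in> CY.points"
    using tilde_base_in_tilde[OF Y.uniform_structure f_closed[OF basepoint]]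
    by (simp add: tilde_eq_chain_limit)
  fix F assume F: "F \<in> entourages Y"
  have "[p] \<in> tilde_base X p (pre F)" using pre_entourage[OF F] by (simp add: tilde_base_def)
  then have "map f [p] \<in> f_tilde (tilde_base X p) F"
    by (rule f_tilde_mem[OF c F pre_entourage[OF F] order_refl])
  then show "\<exists>ys. ys \<in> f_tilde (tilde_base X p) F \<and> ys \<in> tilde_base Y (f p) F"
    using F by (intro exI[of _ "[f p]"]) (simp add: tilde_base_def)
qed

lemma f_tilde_near:
  assumes F: "F \<in> entourages Y" and cd: "(c, d) \<in> CX.near (pre F)"
  shows "(f_tilde c, f_tilde d) \<in> CY.near F"
proof -
  have c: "c \<in> CX.points" and d: "d \<in> CX.points" using CX.near_points[OF cd] by auto
  note P = pre_entourage[OF F]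
  obtain xs ys where xs: "xs \<in> c (pre F)" and ys: "ys \<in> d (pre F)"
    using CX.coordinates_nonempty[OF c d P] .
  have ne: "xs \<noteq> []" "ys \<noteq> []"
    using entourage_chainD(1)[OF CX.coordinate_chain(2)[OF c P xs]]
      entourage_chainD(1)[OF CX.coordinate_chain(2)[OF d P ys]] by simp_all
  have "(last xs, last ys) \<in> pre F" "chain_homotopic X (pre F) (xs @ [last ys]) ys"
    using CX.near_iff[OF c d P xs ys] cd by auto
  then have "(f (last xs), f (last ys)) \<in> F" "chain_homotopic Y F (map f xs @ [f (last ys)]) (map f ys)"
    using homotopic_map[of "pre F" "xs @ [last ys]" ys F] by auto
  then show ?thesis
    using CY.near_iff[OF f_tilde_points[OF c] f_tilde_points[OF d] F
        f_tilde_mem[OF c F P order_refl xs] f_tilde_mem[OF d F P order_refl ys]] ne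
    by (simp add: last_map)
qed

text \<open>
  Representatives \<open>xs\<close> and \<open>ys\<close> of the \<open>D\<close>-coordinates of \<open>c\<close> and \<open>d\<close> have images that agree up to
  homotopy after one step in the image of \<open>D\<close>. This step lifts to a continuation of \<open>xs\<close> by a point
  \<open>v\<close>, and \<open>homotopy_lifting\<close> deforms \<open>xs @ [v]\<close> into \<open>ys\<close>.
\<close>

lemma f_tilde_near_inverse:
  assumes E: "E \<in> entourages X"
  shows "\<exists>F\<in>entourages Y. \<forall>c\<in>CX.points. \<forall>d\<in>CX.points.
    (f_tilde c, f_tilde d) \<in> CY.near F \<longrightarrow> (c, d) \<in> CX.near E"
proof -
  obtain C where C: "C \<in> entourages X" "C \<subseteq> E"
    "\<And>x y z. (x, y) \<in> C \<Longrightarrow> (y, z) \<in> C \<Longrightarrow> (x, z) \<in> E"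
    using X.entourage_half[OF E] by blast
  obtain E0 D R where s: "lifting_scale X Y f C E0 D R" using scale[OF C(1)] by blast
  interpret L: lifting_scale X Y f C E0 D R by (rule s)
  let ?F = "map_prod f f ` D"
  have DP: "D \<subseteq> pre ?F" using X.entourage_carrier[OF L.D] by force
  have DC: "D \<subseteq> C" using L.D_subset L.E0_subset by blast
  have "(c, d) \<in> CX.near E"
    if c: "c \<in> CX.points" and d: "d \<in> CX.points" and n: "(f_tilde c, f_tilde d) \<in> CY.near ?F" for c d
  proof -
    obtain xs ys where xs: "xs \<in> c D" and ys: "ys \<in> d D"
      using CX.coordinates_nonempty[OF c d L.D] .
    note cx = CX.coordinate_chain(2)[OF c L.D xs] and cy = CX.coordinate_chain(2)[OF d L.D ys]
    note nx = entourage_chainD(1)[OF cx] and ny = entourage_chainD(1)[OF cy]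
    have *: "(f (last xs), f (last ys)) \<in> ?F"
      "chain_homotopic Y ?F (map f xs @ [f (last ys)]) (map f ys)"
      using CY.near_iff[OF f_tilde_points[OF c] f_tilde_points[OF d] L.image_D
          f_tilde_mem[OF c L.image_D L.D DP xs] f_tilde_mem[OF d L.image_D L.D DP ys]] n nx ny
      by (simp_all add: last_map)
    then obtain u w where uw: "(u, w) \<in> D" "f (last xs) = f u" "f (last ys) = f w" by auto
    obtain v where v: "(last xs, v) \<in> D" "f v = f (last ys)"
      using L.lift_step[OF uw(1), of "last xs"] uw entourage_chainD(6)[OF cx] by auto
    have vX: "v \<in> carrier X" using X.entourage_carrier[OF L.D v(1)] by blast
    have cv: "entourage_chain X D p v (xs @ [v])"
      using cx v nx vX by (simp add: entourage_chain_snoc_iff)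
    have "L.deformable (xs @ [v]) ys"
      by (rule L.homotopy_lifting[OF cv cy]) (use *(2) v(2) in simp)
    then have df: "(v, last ys) \<in> R" "chain_homotopic X C (xs @ [v, last ys]) ys"
      by (simp_all add: L.deformable_def)
    have vy: "(v, last ys) \<in> C" using df(1) L.R_E0 L.E0_subset by blast
    then have xyE: "(last xs, last ys) \<in> E" using C(3) v(1) DC by blast
    have "chain_homotopic X E (xs @ [last ys]) (xs @ [v, last ys])"
      using X.chain_homotopic_skip[of E p v xs "last ys"] entourage_chain_mono[OF cv, of E] DC C(2)
        vy xyE nx entourage_chainD(6)[OF cy] by (auto intro: chain_homotopic_sym)
    also have "chain_homotopic X E (xs @ [v, last ys]) ys"
      using chain_homotopic_mono[OF df(2) C(2)] .
    finally show ?thesis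
      using CX.near_iff[OF c d E CX.coordinate_mono[OF c L.D E _ xs] CX.coordinate_mono[OF d L.D E _ ys]]
        DC C(2) xyE by blast
  qed
  then show ?thesis using L.image_D by blast
qed

text \<open>
  Points with the same image are near at every scale, by the previous lemma. Their endpoints are in one fibre,
  hence equal, and nearness of points with equal endpoints is equality of coordinates.
\<close>

lemma f_tilde_inj: "inj_on f_tilde CX.points"
proof (rule inj_onI)
  fix c d assume c: "c \<in> CX.points" and d: "d \<in> CX.points" and eq: "f_tilde c = f_tilde d"
  have n: "(c, d) \<in> CX.near E" if E: "E \<in> entourages X" for E
  proof -
    obtain F where F: "F \<in> entourages Y"
      "(f_tilde c, f_tilde d) \<in> CY.near F \<Longrightarrow> (c, d) \<in> CX.near E"
      using f_tilde_near_inverse[OF E] c d by blast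
    interpret U: unif_space "chain_limit Y (f p) (entourages Y)"
      by unfold_locales (rule CY.uniform_structure_chain_limit)
    show ?thesis
      using F(2) U.entourage_refl[OF CY.near_entourage[OF F(1)] f_tilde_points[OF c]] eq by simp
  qed
  have l: "last xs = last ys" if E: "E \<in> entourages X" and xs: "xs \<in> c E" and ys: "ys \<in> d E" for E xs ys
  proof (rule separated)
    show "last xs \<in> carrier X" "last ys \<in> carrier X"
      using entourage_chainD(6)[OF CX.coordinate_chain(2)[OF c E xs]]
        entourage_chainD(6)[OF CX.coordinate_chain(2)[OF d E ys]] by simp_all
    show "f (last xs) = f (last ys)"
      using f_tilde_proj[OF c] f_tilde_proj[OF d] eq
        CX.tilde_proj_eq[OF X.entourage_top c E xs] CX.tilde_proj_eq[OF X.entourage_top d E ys] by simp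
    fix D assume D: "D \<in> entourages X"
    obtain us vs where us: "us \<in> c D" and vs: "vs \<in> d D"
      using CX.coordinates_nonempty[OF c d D] .
    then show "(last xs, last ys) \<in> D"
      using CX.near_iff[OF c d D us vs] n[OF D] CX.last_coordinate_eq[OF c D E us xs]
        CX.last_coordinate_eq[OF d D E vs ys] by simp
  qed
  show "c = d"
  proof (rule CX.points_eqI[OF c d])
    fix E assume E: "E \<in> entourages X"
    obtain xs ys where xs: "xs \<in> c E" and ys: "ys \<in> d E"
      using CX.coordinates_nonempty[OF c d E] .
    have "chain_homotopic X E (xs @ [last xs]) ys"
      using CX.near_iff[OF c d E xs ys] n[OF E] l[OF E xs ys] by simp
    then have "chain_homotopic X E ys xs"
      using X.chain_homotopic_snoc_last[OF E CX.coordinate_chain(2)[OF c E xs]]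
      by (meson chain_homotopic_sym chain_homotopic_trans)
    then have "xs \<in> d E"
      using CX.coordinate_chain(1)[OF d E ys] by (simp add: chain_class_def)
    with xs show "\<exists>xs. xs \<in> c E \<and> xs \<in> d E" by blast
  qed
qed

text \<open>
  Surjectivity. The lifts of the coordinates of \<open>d\<close> end at points of one fibre, which form a Cauchy net;
  appending its limit to every lift makes the lifts compatible.
\<close>

lemma f_tilde_surj:
  assumes d: "d \<in> CY.points"
  shows "\<exists>c\<in>CX.points. f_tilde c = d"
proof -
  let ?e = "entourages X"
  have "\<forall>E\<in>?e. \<exists>t. case t of (E0, D, R) \<Rightarrow> lifting_scale X Y f E E0 D R" using scale by fast
  from bchoice[OF this] obtain \<sigma> where \<sigma>: "\<forall>E\<in>?e. case \<sigma> E of (E0, D, R) \<Rightarrow> lifting_scale X Y f E E0 D R"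
    by blast
  define E0 D R where "E0 E = fst (\<sigma> E)" and "D E = fst (snd (\<sigma> E))" and "R E = snd (snd (\<sigma> E))" for E
  have s: "lifting_scale X Y f E (E0 E) (D E) (R E)" if "E \<in> ?e" for E
    using \<sigma> that by (auto simp: E0_def D_def R_def split: prod.splits)
  have DE: "D E \<in> ?e" "D E \<subseteq> E" "map_prod f f ` D E \<in> entourages Y" "R E \<subseteq> E" if "E \<in> ?e" for E
  proof -
    interpret L: lifting_scale X Y f E "E0 E" "D E" "R E" by (rule s[OF that])
    show "D E \<in> ?e" "map_prod f f ` D E \<in> entourages Y" by (rule L.D, rule L.image_D)
    show "D E \<subseteq> E" "R E \<subseteq> E" using L.D_subset L.R_E0 L.E0_subset by blast+
  qed
  have "\<exists>xs. entourage_chain X (D E) p (last xs) xs \<and> map f xs \<in> d (map_prod f f ` D E)" if E: "E \<in> ?e" for E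
  proof -
    obtain ys where ys: "ys \<in> d (map_prod f f ` D E)"
      using CY.coordinate_nonempty[OF d DE(3)[OF E]] .
    then show ?thesis
      using lifting_scale.lift_chain[OF s[OF E] CY.coordinate_chain(2)[OF d DE(3)[OF E] ys] basepoint]
      by blast
  qed
  then obtain \<beta> where \<beta>: "\<And>E. E \<in> ?e \<Longrightarrow> entourage_chain X (D E) p (last (\<beta> E)) (\<beta> E)"
    "\<And>E. E \<in> ?e \<Longrightarrow> map f (\<beta> E) \<in> d (map_prod f f ` D E)"
    by metis
  \<comment> \<open>the Cauchy net of endpoints\<close>
  define x where "x E = last (\<beta> E)" for E
  have \<beta>ne: "\<beta> E \<noteq> []" and xX: "x E \<in> carrier X" if "E \<in> ?e" for E
    using entourage_chainD[OF \<beta>(1)[OF that]] by (simp_all add: x_def)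
  define y where "y = tilde_proj Y d"
  have fx: "f (x E) = y" if "E \<in> ?e" for E
    using CY.tilde_proj_eq[OF Y.entourage_top d DE(3)[OF that] \<beta>(2)[OF that]] \<beta>ne[OF that]
    by (simp add: x_def y_def last_map)
  have rel: "(x E', x E) \<in> R E" "chain_homotopic X E (\<beta> E' @ [x E]) (\<beta> E)"
    if E: "E \<in> ?e" and E': "E' \<in> ?e" "E' \<subseteq> D E" for E E'
  proof -
    interpret L: lifting_scale X Y f E "E0 E" "D E" "R E" by (rule s[OF E])
    have sub: "D E' \<subseteq> D E" using DE(2)[OF E'(1)] E'(2) by blast
    have "map f (\<beta> E') \<in> d (map_prod f f ` D E)"
      using CY.coordinate_mono[OF d DE(3)[OF E'(1)] DE(3)[OF E] image_mono[OF sub] \<beta>(2)[OF E'(1)]] .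
    then have "chain_homotopic Y (map_prod f f ` D E) (map f (\<beta> E')) (map f (\<beta> E))"
      using CY.coordinate_chain(1)[OF d DE(3)[OF E]] \<beta>(2)[OF E] by (metis chain_class_eq_iff)
    then have "L.deformable (\<beta> E') (\<beta> E)"
      using L.homotopy_lifting[OF entourage_chain_mono[OF \<beta>(1)[OF E'(1)] sub] \<beta>(1)[OF E]] by blast
    then show "(x E', x E) \<in> R E" "chain_homotopic X E (\<beta> E' @ [x E]) (\<beta> E)"
      by (simp_all add: L.deformable_def x_def)
  qed
  obtain l where l: "l \<in> carrier X" "f l = y"
    "\<And>E. E \<in> ?e \<Longrightarrow> \<exists>C\<in>?e. \<forall>C'\<in>?e. C' \<subseteq> C \<longrightarrow> (x C', l) \<in> E"
  proof -
    have "\<exists>C\<in>?e. \<exists>z. \<forall>C'\<in>?e. C' \<subseteq> C \<longrightarrow> (x C', z) \<in> E" if E: "E \<in> ?e" for E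
      using rel(1)[OF E] DE(1,4)[OF E] by blast
    then show thesis
      using complete[of x y] xX fx that by blast
  qed
  have xl: "(x E, l) \<in> R E" if E: "E \<in> ?e" for E
  proof -
    interpret L: lifting_scale X Y f E "E0 E" "D E" "R E" by (rule s[OF E])
    obtain C where C: "C \<in> ?e" "\<forall>C'\<in>?e. C' \<subseteq> C \<longrightarrow> (x C', l) \<in> D E" using l(3)[OF DE(1)[OF E]] by blast
    let ?C = "C \<inter> D E"
    have C': "?C \<in> ?e" using X.entourage_Int[OF C(1) DE(1)[OF E]] .
    have "(x ?C, l) \<in> R E" using C C' fx[OF C'] l(2) L.D_fibre by simp
    moreover have "(x ?C, x E) \<in> R E" using rel(1)[OF E C'] by simp
    ultimately show ?thesis using L.R_sym L.R_trans by blast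
  qed
  have \<beta>E: "entourage_chain X E p (x E') (\<beta> E')" if "E \<in> ?e" "E' \<in> ?e" "D E' \<subseteq> E" for E E'
    using entourage_chain_mono[OF \<beta>(1)] that by (simp add: x_def)
  have \<beta>l: "entourage_chain X E p l (\<beta> E @ [l])" if E: "E \<in> ?e" for E
    using \<beta>E[OF E E DE(2)[OF E]] \<beta>ne[OF E] xl[OF E] DE(4)[OF E] l(1)
    by (auto simp: entourage_chain_snoc_iff x_def)
  have hl: "\<beta> E' @ [l] \<in> chain_class X E (\<beta> E @ [l])"
    if E: "E \<in> ?e" and E': "E' \<in> ?e" "E' \<subseteq> D E" for E E'
  proof -
    have sub: "E' \<subseteq> E" "D E' \<subseteq> E" using E' DE(2)[OF E] DE(2)[OF E'(1)] by blast+
    have x: "(x E', x E) \<in> E" "(x E, l) \<in> E" "(x E', l) \<in> E"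
      using rel(1)[OF E E'] xl[OF E] xl[OF E'(1)] DE(4)[OF E] DE(4)[OF E'(1)] sub by blast+
    have c: "entourage_chain X E p (x E) (\<beta> E' @ [x E])"
      using \<beta>E[OF E E'(1) sub(2)] \<beta>ne[OF E'(1)] x xX[OF E] by (simp add: entourage_chain_snoc_iff x_def)
    have "chain_homotopic X E ((\<beta> E' @ [x E]) @ [l]) (\<beta> E @ [l])"
      using c x l(1) entourage_chain_snoc_iff[of "\<beta> E' @ [x E]" X E p l l]
      by (intro chain_homotopic_append_right[OF rel(2)[OF E E'], of p l]) auto
    moreover have "chain_homotopic X E ((\<beta> E' @ [x E]) @ [l]) (\<beta> E' @ [l])"
      using X.chain_homotopic_skip[OF c, of l] x \<beta>ne[OF E'(1)] l(1) by (simp add: x_def)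
    ultimately show ?thesis
      unfolding chain_class_def by (metis chain_homotopic_sym chain_homotopic_trans mem_Collect_eq)
  qed
  define c where "c = (\<lambda>E\<in>?e. chain_class X E (\<beta> E @ [l]))"
  have c: "c \<in> CX.points"
  proof (rule CX.pointsI)
    fix C E assume CE: "C \<in> ?e" "E \<in> ?e" "C \<subseteq> E"
    have "D C \<inter> D E \<in> ?e" using CE DE(1) X.entourage_Int by blast
    then show "\<exists>xs\<in>c C. xs \<in> c E"
      using hl[OF CE(1), of "D C \<inter> D E"] hl[OF CE(2), of "D C \<inter> D E"] CE by (auto simp: c_def)
  qed (use \<beta>l in \<open>auto simp: c_def\<close>)
  have "f_tilde c = d"
  proof (rule CY.points_eqI[OF f_tilde_points[OF c] d])
    fix F assume F: "F \<in> entourages Y"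
    let ?E = "D (pre F)"
    note P = pre_entourage[OF F]
    have E: "?E \<in> ?e" by (rule DE(1)[OF P])
    have sub: "D ?E \<subseteq> pre F" using DE(2)[OF P] DE(2)[OF E] by blast
    have "\<beta> ?E @ [l] \<in> c (pre F)" using hl[OF P E] P by (simp add: c_def)
    then have 1: "f_tilde c F = chain_class Y F (map f (\<beta> ?E) @ [y])"
      using f_tilde_coordinate[OF c F P order_refl, of "\<beta> ?E @ [l]"] l(2) by simp
    have "entourage_chain Y F (f p) y (map f (\<beta> ?E))"
      using chain_map[OF \<beta>(1)[OF E] sub] fx[OF E] by (simp add: x_def)
    then have "map f (\<beta> ?E) \<in> f_tilde c F"
      using 1 Y.chain_homotopic_snoc_last[OF F] by (simp add: chain_class_def)
    moreover have "map f (\<beta> ?E) \<in> d F"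
      using CY.coordinate_mono[OF d DE(3)[OF E] F _ \<beta>(2)[OF E]] sub by auto
    ultimately show "\<exists>ys. ys \<in> f_tilde c F \<and> ys \<in> d F" by blast
  qed
  then show ?thesis using c by blast
qed

theorem f_tilde_homeo: "unif_homeo (tilde X p) (tilde Y (f p)) f_tilde"
proof -
  let ?X = "chain_limit X p (entourages X)" and ?Y = "chain_limit Y (f p) (entourages Y)"
  interpret UY: unif_space ?Y by unfold_locales (rule CY.uniform_structure_chain_limit)
  have bij: "bij_betw f_tilde CX.points CY.points"
    using f_tilde_inj f_tilde_surj f_tilde_points unfolding bij_betw_def by blast
  have "unif_cont ?X ?Y f_tilde"
  proof (rule unif_contI)
    fix V assume "V \<in> entourages ?Y"
    then obtain F where "F \<in> entourages Y" "CY.near F \<subseteq> V" by (auto simp: CY.entourages_limit_iff)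
    then show "\<exists>U\<in>entourages ?X. \<forall>c d. (c, d) \<in> U \<longrightarrow> (f_tilde c, f_tilde d) \<in> V"
      using f_tilde_near CX.near_entourage[OF pre_entourage] by blast
  qed (rule f_tilde_points)
  moreover have "unif_cont ?Y ?X (inv_into CX.points f_tilde)"
  proof (rule unif_contI)
    show inv: "inv_into CX.points f_tilde d \<in> CX.points" if "d \<in> CY.points" for d
      using that bij by (metis bij_betw_def inv_into_into)
    fix V assume "V \<in> entourages ?X"
    then obtain E where "E \<in> entourages X" "CX.near E \<subseteq> V" by (auto simp: CX.entourages_limit_iff)
    then obtain F where F: "F \<in> entourages Y"
      "\<And>c d. c \<in> CX.points \<Longrightarrow> d \<in> CX.points \<Longrightarrow> (f_tilde c, f_tilde d) \<in> CY.near F \<Longrightarrow> (c, d) \<in> V"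
      using f_tilde_near_inverse[of E] by blast
    have "(inv_into CX.points f_tilde u, inv_into CX.points f_tilde v) \<in> V" if "(u, v) \<in> CY.near F" for u v
      using F(2)[OF inv inv] that CY.near_points[OF that] bij_betw_inv_into_right[OF bij] by simp
    then show "\<exists>U\<in>entourages ?Y. \<forall>u v. (u, v) \<in> U \<longrightarrow>
        (inv_into CX.points f_tilde u, inv_into CX.points f_tilde v) \<in> V"
      using CY.near_entourage[OF F(1)] by blast
  qed
  ultimately show ?thesis
    using bij unfolding unif_homeo_def tilde_eq_chain_limit by blast
qed

end

section \<open>Recognising covers\<close>

lemma acts_uniformlyI:
  assumes X: "uniform_structure X" and G: "group G"
    and ext: "\<And>g. g \<in> carrier G \<Longrightarrow> act g \<in> extensional (carrier X)"
    and one: "\<And>x. x \<in> carrier X \<Longrightarrow> act \<one>\<^bsub>G\<^esub> x = x"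
    and mult: "\<And>g h x. g \<in> carrier G \<Longrightarrow> h \<in> carrier G \<Longrightarrow> x \<in> carrier X \<Longrightarrow>
      act (g \<otimes>\<^bsub>G\<^esub> h) x = act g (act h x)"
    and cont: "\<And>g. g \<in> carrier G \<Longrightarrow> unif_cont X X (act g)"
  shows "acts_uniformly G X act"
proof -
  interpret group G by fact
  have closed: "act g x \<in> carrier X" if "g \<in> carrier G" "x \<in> carrier X" for g x
    using unif_contD(1)[OF cont] that by blast
  have inv: "act (inv\<^bsub>G\<^esub> g) (act g x) = x" "act g (act (inv\<^bsub>G\<^esub> g) x) = x"
    if "g \<in> carrier G" "x \<in> carrier X" for g x
    using mult[of "inv\<^bsub>G\<^esub> g" g x] mult[of g "inv\<^bsub>G\<^esub> g" x] that one by simp_all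
  have homeo: "unif_homeo X X (act g)" if g: "g \<in> carrier G" for g
    by (rule unif_homeoI[OF X X cont[OF g] cont[OF inv_closed[OF g]]]) (use g inv in simp_all)
  have Bij: "act g \<in> Bij (carrier X)" if "g \<in> carrier G" for g
    using homeo[OF that] ext[OF that] by (simp add: Bij_def unif_homeo_def)
  have "act (g \<otimes>\<^bsub>G\<^esub> h) = compose (carrier X) (act g) (act h)" if "g \<in> carrier G" "h \<in> carrier G" for g h
    using that ext mult by (intro extensionalityI[of _ "carrier X"]) (auto simp: compose_def)
  then have "act \<in> hom G (BijGroup (carrier X))"
    using Bij by (intro homI) (simp_all add: BijGroup_def)
  then have "group_action G (carrier X) act"
    using is_group group_BijGroup by (auto simp: group_action_def group_hom_def group_hom_axioms_def)
  then show ?thesis using homeo by (simp add: acts_uniformly_def)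
qed

text \<open>Closedness under each \<open>act g\<close> implies invariance, since it also applies to the inverse of \<open>g\<close>.\<close>

lemma acts_isomorphically_iff:
  assumes X: "uniform_structure X"
  shows "acts_isomorphically G X act \<longleftrightarrow> acts_uniformly G X act \<and>
    (\<forall>V\<in>entourages X. \<exists>D\<in>entourages X. D \<subseteq> V \<and>
      (\<forall>g\<in>carrier G. \<forall>x y. (x, y) \<in> D \<longrightarrow> (act g x, act g y) \<in> D))" (is "?L \<longleftrightarrow> ?R")
proof
  assume ?L
  then obtain B where B: "acts_uniformly G X act" "entourage_base X B"
    "\<forall>E\<in>B. \<forall>g\<in>carrier G. map_prod (act g) (act g) ` E = E"
    unfolding acts_isomorphically_def by (elim conjE exE) (rule that)
  have "\<exists>D\<in>entourages X. D \<subseteq> V \<and> (\<forall>g\<in>carrier G. \<forall>x y. (x, y) \<in> D \<longrightarrow> (act g x, act g y) \<in> D)"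
    if V: "V \<in> entourages X" for V
  proof -
    obtain E where E: "E \<in> B" "E \<subseteq> V" "E \<in> entourages X"
      using B(2) V unfolding entourage_base_def by blast
    have "(act g x, act g y) \<in> E" if "g \<in> carrier G" "(x, y) \<in> E" for g x y
    proof -
      have "map_prod (act g) (act g) ` E = E" using B(3) E(1) that(1) by simp
      then show ?thesis using that(2) by (metis map_prod_imageI)
    qed
    then show ?thesis using E by blast
  qed
  then show ?R using B(1) by blast
next
  assume R: ?R
  interpret X: unif_space X by unfold_locales fact
  interpret group_action G "carrier X" act
    using R by (simp add: acts_uniformly_def)
  interpret group G using group_hom group_hom.axioms(1) by blast
  let ?B = "{D \<in> entourages X. \<forall>g\<in>carrier G. \<forall>x y. (x, y) \<in> D \<longrightarrow> (act g x, act g y) \<in> D}"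
  have "map_prod (act g) (act g) ` D = D" if D: "D \<in> ?B" and g: "g \<in> carrier G" for D g
  proof
    show "map_prod (act g) (act g) ` D \<subseteq> D" using D g by auto
    show "D \<subseteq> map_prod (act g) (act g) ` D"
    proof (rule subrelI)
      fix x y assume xy: "(x, y) \<in> D"
      then have "(act (inv\<^bsub>G\<^esub> g) x, act (inv\<^bsub>G\<^esub> g) y) \<in> D" "x \<in> carrier X" "y \<in> carrier X"
        using D g X.entourage_carrier[of D x y] by auto
      then show "(x, y) \<in> map_prod (act g) (act g) ` D"
        using action_inv(2)[OF g] by (metis map_prod_imageI)
    qed
  qed
  moreover have "entourage_base X ?B"
    using R unfolding entourage_base_def by blast
  ultimately show ?L using R unfolding acts_isomorphically_def by blast
qed

text \<open>Converse of \<open>quotient_map_props\<close>; the homeomorphism applies \<open>f\<close> to a representative of the orbit.\<close>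

lemma quotient_mapI:
  assumes X: "uniform_structure X" and Y: "uniform_structure Y"
    and act: "group_action G (carrier X) act"
    and cont: "unif_cont X Y f" and surj: "f ` carrier X = carrier Y"
    and fib: "\<And>x y. x \<in> carrier X \<Longrightarrow> y \<in> carrier X \<Longrightarrow> f x = f y \<longleftrightarrow> (\<exists>g\<in>carrier G. y = act g x)"
    and image: "\<And>D. D \<in> entourages X \<Longrightarrow> map_prod f f ` D \<in> entourages Y"
  shows "\<exists>h. unif_homeo (orbit_space G X act) Y h \<and> (\<forall>x\<in>carrier X. f x = h (orbit G act x))"
proof -
  interpret X: unif_space X by unfold_locales fact
  interpret group_action G "carrier X" act by fact
  let ?Q = "orbit_space G X act" and ?o = "orbit G act"
  have Qc: "carrier ?Q = ?o ` carrier X"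
    by (auto simp: orbit_space_def orbits_def)
  have Qe: "W \<in> entourages ?Q \<longleftrightarrow> W \<subseteq> carrier ?Q \<times> carrier ?Q \<and> sym W \<and>
      (\<exists>D\<in>entourages X. map_prod ?o ?o ` D \<subseteq> W)" for W
    unfolding orbit_space_def entourages_uspace_of_base carrier_uspace_of_base by blast
  have fo: "f x = f y \<longleftrightarrow> ?o x = ?o y" if "x \<in> carrier X" "y \<in> carrier X" for x y
    using fib[OF that] orbit_eq_iff[OF that] by simp
  define h where "h = f \<circ> inv_into (carrier X) ?o"
  have h: "h (?o x) = f x" if x: "x \<in> carrier X" for x
  proof -
    have "?o x \<in> ?o ` carrier X" using x by blast
    then show ?thesis
      unfolding h_def comp_def using fo[of "inv_into (carrier X) ?o (?o x)" x] x
      by (metis f_inv_into_f inv_into_into)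
  qed
  have inj: "inj_on h (carrier ?Q)"
    using h fo by (auto simp: Qc inj_on_def)
  have hinv: "inv_into (carrier ?Q) h (f x) = ?o x" if x: "x \<in> carrier X" for x
    using inv_into_f_f[OF inj, of "?o x"] h[OF x] x by (simp add: Qc)
  have "h ` carrier ?Q = carrier Y"
    unfolding Qc surj[symmetric] image_image using h by (rule image_cong[OF refl])
  moreover have "unif_cont ?Q Y h"
  proof (rule unif_contI)
    show "h z \<in> carrier Y" if "z \<in> carrier ?Q" for z
      using that h unif_contD(1)[OF cont] by (auto simp: Qc)
    fix V assume "V \<in> entourages Y"
    then obtain D where D: "D \<in> entourages X" "\<forall>x y. (x, y) \<in> D \<longrightarrow> (f x, f y) \<in> V"
      using unif_contD(2)[OF cont] by blast
    let ?W = "map_prod ?o ?o ` D"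
    have "?W \<in> entourages ?Q"
      unfolding Qe Qc using D(1) X.entourage_carrier[OF D(1)] X.entourage_sym[OF D(1)]
      by (auto simp: sym_def)
    moreover have "(h u, h v) \<in> V" if uv: "(u, v) \<in> ?W" for u v
    proof -
      obtain x y where xy: "(x, y) \<in> D" "u = ?o x" "v = ?o y" using uv by auto
      then show ?thesis using D(2) h X.entourage_carrier[OF D(1) xy(1)] by simp
    qed
    ultimately show "\<exists>W\<in>entourages ?Q. \<forall>u v. (u, v) \<in> W \<longrightarrow> (h u, h v) \<in> V" by blast
  qed
  moreover have "unif_cont Y ?Q (inv_into (carrier ?Q) h)"
  proof (rule unif_contI)
    show "inv_into (carrier ?Q) h y \<in> carrier ?Q" if "y \<in> carrier Y" for y
      using that hinv Qc by (auto simp flip: surj)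
    fix W assume "W \<in> entourages ?Q"
    then obtain D where D: "D \<in> entourages X" "map_prod ?o ?o ` D \<subseteq> W" using Qe by blast
    have "(inv_into (carrier ?Q) h u, inv_into (carrier ?Q) h v) \<in> W" if uv: "(u, v) \<in> map_prod f f ` D" for u v
    proof -
      obtain x y where xy: "(x, y) \<in> D" "u = f x" "v = f y" using uv by auto
      then show ?thesis using D(2) hinv X.entourage_carrier[OF D(1) xy(1)] by auto
    qed
    then show "\<exists>U\<in>entourages Y. \<forall>u v. (u, v) \<in> U \<longrightarrow>
        (inv_into (carrier ?Q) h u, inv_into (carrier ?Q) h v) \<in> W"
      using image[OF D(1)] by blast
  qed
  ultimately have "unif_homeo ?Q Y h"
    using inj by (simp add: unif_homeo_def bij_betw_def)
  then show ?thesis using h by auto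
qed

lemma unif_homeo_comp:
  assumes X: "uniform_structure X" and Z: "uniform_structure Z"
    and f: "unif_homeo X Y f" and g: "unif_homeo Y Z g"
  shows "unif_homeo X Z (\<lambda>x. g (f x))"
proof -
  obtain f' where f': "unif_cont X Y f" "unif_cont Y X f'"
    "\<And>x. x \<in> carrier X \<Longrightarrow> f' (f x) = x" "\<And>y. y \<in> carrier Y \<Longrightarrow> f (f' y) = y"
    using f by (rule unif_homeoE) blast
  obtain g' where g': "unif_cont Y Z g" "unif_cont Z Y g'"
    "\<And>y. y \<in> carrier Y \<Longrightarrow> g' (g y) = y" "\<And>z. z \<in> carrier Z \<Longrightarrow> g (g' z) = z"
    using g by (rule unif_homeoE) blast
  show ?thesis
    by (rule unif_homeoI[OF X Z unif_cont_comp[OF f'(1) g'(1)] unif_cont_comp[OF g'(2) f'(2)]])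
      (simp_all add: f'(3,4) g'(3,4) unif_contD(1)[OF f'(1)] unif_contD(1)[OF g'(2)])
qed

lemma unif_homeo_inverse:
  assumes X: "uniform_structure X" and Y: "uniform_structure Y" and f: "unif_homeo X Y f"
  shows "unif_homeo Y X (inv_into (carrier X) f)"
proof -
  have bij: "bij_betw f (carrier X) (carrier Y)" using f by (simp add: unif_homeo_def)
  show ?thesis
    by (rule unif_homeoI[OF Y X, of _ f])
      (use f bij_betw_inv_into_left[OF bij] bij_betw_inv_into_right[OF bij] in \<open>auto simp: unif_homeo_def\<close>)
qed

text \<open>The action is conjugated by the homeomorphism; the discrete levels stay the same.\<close>

lemma is_cover_comp_homeo:
  assumes Z: "uniform_structure Z" and X: "uniform_structure X" and Y: "uniform_structure Y"
    and k: "unif_homeo Z X k" and cover: "is_cover TYPE('i \<times> 'x \<times> 'h \<times> 'g) X Y f"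
  shows "is_cover TYPE('i \<times> 'x \<times> 'h \<times> 'g) Z Y (\<lambda>z. f (k z))"
proof -
  interpret X: unif_space X by unfold_locales fact
  interpret Z: unif_space Z by unfold_locales fact
  obtain G :: "'g monoid" and act h where
    isom: "acts_isomorphically G X act"
    and prodisc: "acts_prodiscretely TYPE('i \<times> 'x \<times> 'h) G X act"
    and quot: "unif_homeo (orbit_space G X act) Y h" "\<forall>x\<in>carrier X. f x = h (orbit G act x)"
    using cover unfolding is_cover_def by blast
  have unif: "acts_uniformly G X act" using isom by (simp add: acts_isomorphically_def)
  then have ga: "group_action G (carrier X) act" by (simp add: acts_uniformly_def)
  interpret group_action G "carrier X" act by (rule ga)
  interpret group G using group_hom group_hom.axioms(1) by blast
  obtain k' where k': "unif_cont Z X k" "unif_cont X Z k'"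
    "\<And>z. z \<in> carrier Z \<Longrightarrow> k' (k z) = z" "\<And>x. x \<in> carrier X \<Longrightarrow> k (k' x) = x"
    using k by (rule unif_homeoE) blast
  note kc = unif_contD(1)[OF k'(1)] and kc' = unif_contD(1)[OF k'(2)]
  define act' where "act' g = (\<lambda>z\<in>carrier Z. k' (act g (k z)))" for g
  have act': "act' g z = k' (act g (k z))" "k (act' g z) = act g (k z)" "act' g z \<in> carrier Z"
    if "g \<in> carrier G" "z \<in> carrier Z" for g z
    using that k'(4) kc kc' action_closed by (simp_all add: act'_def)
  have unif': "acts_uniformly G Z act'"
  proof (rule acts_uniformlyI[OF Z is_group])
    show "act' g \<in> extensional (carrier Z)" for g by (simp add: act'_def)
    show "act' \<one>\<^bsub>G\<^esub> z = z" if "z \<in> carrier Z" for z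
      using act'(1)[OF one_closed that] action_one k'(3) kc that by simp
    show "act' (g \<otimes>\<^bsub>G\<^esub> g') z = act' g (act' g' z)"
      if "g \<in> carrier G" "g' \<in> carrier G" "z \<in> carrier Z" for g g' z
      using that act' composition_rule[OF kc] by simp
    show "unif_cont Z Z (act' g)" if g: "g \<in> carrier G" for g
    proof -
      have "unif_cont X X (act g)" using unif g by (simp add: acts_uniformly_def unif_homeo_def)
      then have "unif_cont Z Z (\<lambda>z. k' (act g (k z)))"
        using unif_cont_comp[OF unif_cont_comp[OF k'(1)] k'(2)] by blast
      then show ?thesis by (rule unif_cont_cong[OF Z]) (simp add: act'(1)[OF g])
    qed
  qed
  moreover have "\<exists>D\<in>entourages Z. D \<subseteq> V \<and>
      (\<forall>g\<in>carrier G. \<forall>x y. (x, y) \<in> D \<longrightarrow> (act' g x, act' g y) \<in> D)" if V: "V \<in> entourages Z" for V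
  proof -
    obtain U where U: "U \<in> entourages X" "\<forall>x y. (x, y) \<in> U \<longrightarrow> (k' x, k' y) \<in> V"
      using unif_contD(2)[OF k'(2) V] by blast
    obtain D where D: "D \<in> entourages X" "D \<subseteq> U"
      "\<forall>g\<in>carrier G. \<forall>x y. (x, y) \<in> D \<longrightarrow> (act g x, act g y) \<in> D"
      using isom U(1) unfolding acts_isomorphically_iff[OF X] by blast
    let ?D = "{(x, y) \<in> carrier Z \<times> carrier Z. (k x, k y) \<in> D}"
    obtain W where W: "W \<in> entourages Z" "\<forall>x y. (x, y) \<in> W \<longrightarrow> (k x, k y) \<in> D"
      using unif_contD(2)[OF k'(1) D(1)] by blast
    have "W \<subseteq> ?D" using W(2) Z.entourage_carrier[OF W(1)] by blast
    moreover have "sym ?D" using X.entourage_sym[OF D(1)] by (auto simp: sym_def)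
    ultimately have "?D \<in> entourages Z" using Z.entourage_superset[OF W(1)] by blast
    moreover have "?D \<subseteq> V"
    proof (rule subrelI)
      fix x y assume "(x, y) \<in> ?D"
      then show "(x, y) \<in> V" using U(2) D(2) k'(3) by (metis (no_types, lifting) SigmaD1 SigmaD2 case_prodD mem_Collect_eq subsetD)
    qed
    moreover have "(act' g x, act' g y) \<in> ?D" if "g \<in> carrier G" "(x, y) \<in> ?D" for g x y
    proof -
      have xy: "x \<in> carrier Z" "y \<in> carrier Z" "(k x, k y) \<in> D" using that(2) by auto
      then have "(act g (k x), act g (k y)) \<in> D" using D(3) that(1) by blast
      then show ?thesis using act'(2,3)[OF that(1)] xy by simp
    qed
    ultimately show ?thesis by (intro bexI[of _ ?D] conjI ballI allI impI)
  qed
  ultimately have "acts_isomorphically G Z act'"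
    unfolding acts_isomorphically_iff[OF Z] by (intro conjI ballI)
  moreover have "acts_prodiscretely TYPE('i \<times> 'x \<times> 'h) G Z act'"
  proof -
    obtain I :: "'i set" and leq and S :: "'i \<Rightarrow> 'x uspace" and b and H :: "'i \<Rightarrow> 'h monoid"
      and \<theta> a \<Phi> \<Psi> where sys: "discrete_action_system I leq S b H \<theta> a"
      and \<Phi>: "unif_homeo X (uspace_limit I leq S b) \<Phi>"
      and surj: "\<forall>i\<in>I. (\<lambda>x. \<Phi> x i) ` carrier X = carrier (S i)"
      and \<Psi>: "\<Psi> \<in> iso G (group_limit I leq H \<theta>)"
      and eqv: "\<forall>g\<in>carrier G. \<forall>x\<in>carrier X. \<forall>i\<in>I. \<Phi> (act g x) i = a i (\<Psi> g i) (\<Phi> x i)"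
      using prodisc unfolding acts_prodiscretely_def by (elim conjE exE) blast
    have "uniform_structure (uspace_limit I leq S b)"
      by (rule uniform_structure_limit) (use sys in \<open>unfold discrete_action_system_def, blast\<close>)
    then have "unif_homeo Z (uspace_limit I leq S b) (\<lambda>z. \<Phi> (k z))"
      by (rule unif_homeo_comp[OF Z _ k \<Phi>])
    moreover have "k ` carrier Z = carrier X"
      using k by (simp add: unif_homeo_def bij_betw_def)
    then have "(\<lambda>z. \<Phi> (k z) i) ` carrier Z = (\<lambda>x. \<Phi> x i) ` carrier X" for i
      by (simp add: image_image flip: \<open>k ` carrier Z = carrier X\<close>)
    then have "\<forall>i\<in>I. (\<lambda>z. \<Phi> (k z) i) ` carrier Z = carrier (S i)"
      using surj by simp
    moreover have "\<forall>g\<in>carrier G. \<forall>z\<in>carrier Z. \<forall>i\<in>I. \<Phi> (k (act' g z)) i = a i (\<Psi> g i) (\<Phi> (k z) i)"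
      using eqv act'(2) kc by simp
    ultimately show ?thesis
      unfolding acts_prodiscretely_def using sys \<Psi> unif' is_group
      by (intro conjI exI[of _ I] exI[of _ leq] exI[of _ S] exI[of _ b] exI[of _ H] exI[of _ \<theta>]
          exI[of _ a] exI[of _ "\<lambda>z. \<Phi> (k z)"] exI[of _ \<Psi>])
  qed
  moreover have "\<exists>h. unif_homeo (orbit_space G Z act') Y h \<and> (\<forall>z\<in>carrier Z. f (k z) = h (orbit G act' z))"
  proof (rule quotient_mapI[OF Z Y])
    note props = quotient_map_props[OF X Y ga quot]
    show "group_action G (carrier Z) act'" using unif' by (simp add: acts_uniformly_def)
    show "unif_cont Z Y (\<lambda>z. f (k z))" by (rule unif_cont_comp[OF k'(1) props(1)])
    have "k ` carrier Z = carrier X" using k by (simp add: unif_homeo_def bij_betw_def)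
    then show "(\<lambda>z. f (k z)) ` carrier Z = carrier Y"
      using props(2) image_image[of f k "carrier Z"] by simp
    show "f (k x) = f (k y) \<longleftrightarrow> (\<exists>g\<in>carrier G. y = act' g x)" if "x \<in> carrier Z" "y \<in> carrier Z" for x y
    proof -
      have "y = act' g x \<longleftrightarrow> k y = act g (k x)" if "g \<in> carrier G" for g
        using act'[OF that \<open>x \<in> carrier Z\<close>] k'(3)[OF \<open>y \<in> carrier Z\<close>] by auto
      then show ?thesis using props(3)[OF kc[OF that(1)] kc[OF that(2)]] by simp
    qed
    fix D assume D: "D \<in> entourages Z"
    obtain U where U: "U \<in> entourages X" "\<forall>x y. (x, y) \<in> U \<longrightarrow> (k' x, k' y) \<in> D"
      using unif_contD(2)[OF k'(2) D] by blast
    have "map_prod k k ` D \<in> entourages X"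
    proof (rule X.entourage_superset[OF U(1)])
      show "U \<subseteq> map_prod k k ` D"
      proof (rule subrelI)
        fix x y assume xy: "(x, y) \<in> U"
        then have "(x, y) = map_prod k k (k' x, k' y)"
          using k'(4) X.entourage_carrier[OF U(1) xy] by simp
        then show "(x, y) \<in> map_prod k k ` D" using U(2) xy by blast
      qed
      show "map_prod k k ` D \<subseteq> carrier X \<times> carrier X" using kc Z.entourage_carrier[OF D] by auto
      show "sym (map_prod k k ` D)" using Z.entourage_sym[OF D] by (auto simp: sym_def)
    qed
    from props(4)[OF this] show "map_prod (\<lambda>z. f (k z)) (\<lambda>z. f (k z)) ` D \<in> entourages Y"
      by (simp add: image_image map_prod_def case_prod_unfold)
  qed
  ultimately show ?thesis unfolding is_cover_def by blast
qed

lemma is_cover_imp_lifting_cover: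
  assumes X: "uniform_structure X" and Y: "uniform_structure Y"
    and cover: "is_cover TYPE('i \<times> 'x \<times> 'h \<times> 'g) X Y f"
  shows "lifting_cover X Y f"
proof -
  obtain G :: "'g monoid" and act h where
    isom: "acts_isomorphically G X act"
    and prodisc: "acts_prodiscretely TYPE('i \<times> 'x \<times> 'h) G X act"
    and quot: "unif_homeo (orbit_space G X act) Y h" "\<forall>x\<in>carrier X. f x = h (orbit G act x)"
    using cover unfolding is_cover_def by blast
  have ga: "group_action G (carrier X) act"
    using isom by (simp add: acts_isomorphically_def acts_uniformly_def)
  obtain I :: "'i set" and leq and S :: "'i \<Rightarrow> 'x uspace" and b and H :: "'i \<Rightarrow> 'h monoid"
    and \<theta> a \<Phi> \<Psi> where sys: "discrete_action_system I leq S b H \<theta> a"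
    and \<Phi>: "unif_homeo X (uspace_limit I leq S b) \<Phi>"
    and \<Psi>: "\<Psi> \<in> iso G (group_limit I leq H \<theta>)"
    and eqv: "\<forall>g\<in>carrier G. \<forall>x\<in>carrier X. \<forall>i\<in>I. \<Phi> (act g x) i = a i (\<Psi> g i) (\<Phi> x i)"
    using prodisc unfolding acts_prodiscretely_def by (elim conjE exE) blast
  note props = quotient_map_props[OF X Y ga quot]
  have "prodiscrete_quotient X Y G act I leq S b H \<theta> a \<Phi> \<Psi> f"
  proof (intro prodiscrete_quotient.intro prodiscrete_quotient_axioms.intro action_limit.intro unif_space.intro X Y ga sys \<Phi> \<Psi>)
    show "\<exists>D\<in>entourages X. D \<subseteq> V \<and> (\<forall>g\<in>carrier G. \<forall>x y. (x, y) \<in> D \<longrightarrow> (act g x, act g y) \<in> D)"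
      if "V \<in> entourages X" for V
      using isom that unfolding acts_isomorphically_iff[OF X] by blast
  qed (use eqv props(3,4) unif_contD(1)[OF props(1)] in blast)+
  then interpret prodiscrete_quotient X Y G act I leq S b H \<theta> a \<Phi> \<Psi> f .
  show ?thesis
    by (intro lifting_cover.intro lifting_cover_axioms.intro unif_space.intro X Y props(1)
        lifting_scale_exists fibre_separated fibre_complete)
qed

section \<open>Limits of discrete actions\<close>

definition limit_act ::
    "'i set \<Rightarrow> ('i \<Rightarrow> 'i \<Rightarrow> bool) \<Rightarrow> ('i \<Rightarrow> 'x uspace) \<Rightarrow> ('i \<Rightarrow> 'i \<Rightarrow> 'x \<Rightarrow> 'x) \<Rightarrow> ('i \<Rightarrow> 'h \<Rightarrow> 'x \<Rightarrow> 'x) \<Rightarrow>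
     ('i \<Rightarrow> 'h) \<Rightarrow> ('i \<Rightarrow> 'x) \<Rightarrow> 'i \<Rightarrow> 'x" where
  "limit_act I leq S b a g = (\<lambda>c\<in>carrier (uspace_limit I leq S b). \<lambda>i\<in>I. a i (g i) (c i))"

context action_limit
begin

abbreviation "G \<equiv> group_limit I leq H \<theta>"
abbreviation "L \<equiv> uspace_limit I leq S b"
abbreviation "act \<equiv> limit_act I leq S b a"

lemma uniform_structure_L: "uniform_structure L"
  by (rule uniform_structure_limit) (rule level_uniform)

lemma G_carrier: "carrier G = threads I leq (\<lambda>i. carrier (H i)) \<theta>"
  by (simp add: group_limit_def)

lemma G_component: "g \<in> carrier G \<Longrightarrow> i \<in> I \<Longrightarrow> g i \<in> carrier (H i)"
  by (auto simp: G_carrier threads_def)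

lemma G_mult: "i \<in> I \<Longrightarrow> (g \<otimes>\<^bsub>G\<^esub> h) i = g i \<otimes>\<^bsub>H i\<^esub> h i"
  by (simp add: group_limit_def)

lemma G_one: "i \<in> I \<Longrightarrow> \<one>\<^bsub>G\<^esub> i = \<one>\<^bsub>H i\<^esub>"
  by (simp add: group_limit_def)

lemma L_component: "c \<in> carrier L \<Longrightarrow> i \<in> I \<Longrightarrow> c i \<in> carrier (S i)"
  by (auto simp: uspace_limit_carrier threads_def)

lemma group_G: "group G"
proof -
  have grp: "group (product_group I H)" using level_group by simp
  have "subgroup (threads I leq (\<lambda>i. carrier (H i)) \<theta>) (product_group I H)"
  proof (rule group.subgroupI[OF grp])
    show "threads I leq (\<lambda>i. carrier (H i)) \<theta> \<subseteq> carrier (product_group I H)"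
      by (auto simp: threads_def)
    have "(\<lambda>i\<in>I. \<one>\<^bsub>H i\<^esub>) \<in> threads I leq (\<lambda>i. carrier (H i)) \<theta>"
      using level_group group_hom.hom_one[OF level_hom]
      by (auto simp: threads_def intro: monoid.one_closed group.is_monoid)
    then show "threads I leq (\<lambda>i. carrier (H i)) \<theta> \<noteq> {}" by blast
  next
    fix g assume g: "g \<in> threads I leq (\<lambda>i. carrier (H i)) \<theta>"
    then have gi: "g i \<in> carrier (H i)" if "i \<in> I" for i using that by (auto simp: threads_def)
    have "(\<lambda>i\<in>I. inv\<^bsub>H i\<^esub> g i) \<in> threads I leq (\<lambda>i. carrier (H i)) \<theta>"
      using g gi group_hom.hom_inv[OF level_hom] level_group
      by (auto simp: threads_def intro: group.inv_closed)
    then show "inv\<^bsub>product_group I H\<^esub> g \<in> threads I leq (\<lambda>i. carrier (H i)) \<theta>"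
      using inv_product_group[of g I H] g level_group by (simp add: threads_def)
  next
    fix g h assume gh: "g \<in> threads I leq (\<lambda>i. carrier (H i)) \<theta>" "h \<in> threads I leq (\<lambda>i. carrier (H i)) \<theta>"
    then have gi: "g i \<in> carrier (H i)" "h i \<in> carrier (H i)" if "i \<in> I" for i
      using that by (auto simp: threads_def)
    have "\<theta> i j (g j \<otimes>\<^bsub>H j\<^esub> h j) = g i \<otimes>\<^bsub>H i\<^esub> h i" if "i \<in> I" "j \<in> I" "leq i j" for i j
      using gh gi that group_hom.hom_mult[OF level_hom] by (simp add: threads_def)
    then show "g \<otimes>\<^bsub>product_group I H\<^esub> h \<in> threads I leq (\<lambda>i. carrier (H i)) \<theta>"
      using monoid.m_closed[OF group.is_monoid[OF level_group] gi] by (auto simp: threads_def)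
  qed
  then show ?thesis
    unfolding group_limit_def by (rule group.subgroup_imp_group[OF grp])
qed

lemma act_component: "c \<in> carrier L \<Longrightarrow> i \<in> I \<Longrightarrow> act g c i = a i (g i) (c i)"
  by (simp add: limit_act_def)

lemma act_closed:
  assumes g: "g \<in> carrier G" and c: "c \<in> carrier L"
  shows "act g c \<in> carrier L"
proof -
  have "b i j (act g c j) = act g c i" if ij: "i \<in> I" "j \<in> I" "leq i j" for i j
    using level_equivariant[OF ij G_component[OF g ij(2)] L_component[OF c ij(2)]] ij c g
    by (simp add: act_component G_carrier uspace_limit_carrier threads_def)
  moreover have "act g c \<in> (\<Pi>\<^sub>E i\<in>I. carrier (S i))"
    using c group_action.action_closed[OF level_action G_component[OF g] L_component[OF c]]
    by (auto simp: limit_act_def)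
  ultimately show ?thesis by (simp add: uspace_limit_carrier threads_def)
qed

lemma act_cont:
  assumes g: "g \<in> carrier G"
  shows "unif_cont L L (act g)"
proof (rule unif_contI)
  let ?T = "threads I leq (\<lambda>i. carrier (S i)) b"
  show "act g c \<in> carrier L" if "c \<in> carrier L" for c using act_closed[OF g that] .
  fix W assume "W \<in> entourages L"
  then obtain J V where JV: "finite J" "J \<subseteq> I" "\<forall>i\<in>J. V i \<in> entourages (S i)"
    "{(c, d) \<in> ?T \<times> ?T. \<forall>i\<in>J. (c i, d i) \<in> V i} \<subseteq> W"
    unfolding uspace_limit_def Let_def entourages_uspace_of_base by blast
  have "\<exists>U. U \<in> entourages (S i) \<and> (\<forall>x y. (x, y) \<in> U \<longrightarrow> (a i (g i) x, a i (g i) y) \<in> V i)"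
    if i: "i \<in> J" for i
  proof -
    have "unif_cont (S i) (S i) (a i (g i))"
      using level_unif[of i] G_component[OF g, of i] JV(2) i by (auto simp: acts_uniformly_def unif_homeo_def)
    then show ?thesis using unif_contD(2) JV(3) i by metis
  qed
  then have "\<forall>i\<in>J. \<exists>U. U \<in> entourages (S i) \<and> (\<forall>x y. (x, y) \<in> U \<longrightarrow> (a i (g i) x, a i (g i) y) \<in> V i)"
    by blast
  from bchoice[OF this] obtain U where U: "\<forall>i\<in>J. U i \<in> entourages (S i) \<and>
      (\<forall>x y. (x, y) \<in> U i \<longrightarrow> (a i (g i) x, a i (g i) y) \<in> V i)"
    by (elim exE)
  let ?U = "{(c, d) \<in> ?T \<times> ?T. \<forall>i\<in>J. (c i, d i) \<in> U i}"
  have "(d i, c i) \<in> U i" if "i \<in> J" "(c i, d i) \<in> U i" for c d i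
  proof -
    have iI: "i \<in> I" and Ui: "U i \<in> entourages (S i)" using that JV(2) U by blast+
    interpret Si: unif_space "S i" by unfold_locales (rule level_uniform[OF iI])
    show ?thesis using Si.entourage_sym[OF Ui that(2)] .
  qed
  then have "sym ?U" by (auto simp: sym_def)
  moreover have "\<forall>i\<in>J. U i \<in> entourages (S i)" using U by blast
  ultimately have "?U \<in> entourages L"
    using JV(1,2) unfolding uspace_limit_def Let_def entourages_uspace_of_base by blast
  moreover have "(act g c, act g d) \<in> W" if cd: "(c, d) \<in> ?U" for c d
  proof -
    have c: "c \<in> carrier L" and d: "d \<in> carrier L" using cd by (auto simp: uspace_limit_carrier)
    have "(act g c i, act g d i) \<in> V i" if "i \<in> J" for i
      using that cd U JV(2) act_component[OF c] act_component[OF d] by auto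
    then show ?thesis
      using JV(4) act_closed[OF g c] act_closed[OF g d] unfolding uspace_limit_carrier by blast
  qed
  ultimately show "\<exists>U\<in>entourages L. \<forall>c d. (c, d) \<in> U \<longrightarrow> (act g c, act g d) \<in> W" by blast
qed

lemma acts_uniformly_limit: "acts_uniformly G L act"
proof (rule acts_uniformlyI[OF uniform_structure_L group_G])
  have eqI: "c = d" if "c \<in> carrier L" "d \<in> carrier L" "\<And>i. i \<in> I \<Longrightarrow> c i = d i" for c d
    using that by (intro extensionalityI[of _ I]) (auto simp: uspace_limit_carrier threads_def PiE_iff)
  interpret G: group G by (rule group_G)
  show "act g \<in> extensional (carrier L)" for g by (simp add: limit_act_def)
  show "act \<one>\<^bsub>G\<^esub> c = c" if c: "c \<in> carrier L" for c
    by (rule eqI[OF act_closed[OF G.one_closed c] c])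
      (simp add: act_component[OF c] G_one group_action.action_one[OF level_action L_component[OF c]])
  show "act (g \<otimes>\<^bsub>G\<^esub> h) c = act g (act h c)"
    if g: "g \<in> carrier G" and h: "h \<in> carrier G" and c: "c \<in> carrier L" for g h c
    by (rule eqI[OF act_closed[OF G.m_closed[OF g h] c] act_closed[OF g act_closed[OF h c]]])
      (simp add: act_component[OF c] act_component[OF act_closed[OF h c]] G_mult
        group_action.composition_rule[OF level_action L_component[OF c] G_component[OF g] G_component[OF h]])
  show "unif_cont L L (act g)" if "g \<in> carrier G" for g using act_cont[OF that] .
qed

lemma acts_prodiscretely_limit:
  assumes "\<And>i. i \<in> I \<Longrightarrow> (\<lambda>c. c i) ` carrier L = carrier (S i)"
  shows "acts_prodiscretely TYPE('i \<times> 'x \<times> 'h) G L act"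
proof -
  have "unif_homeo L L (\<lambda>c. c)"
    by (rule unif_homeoI[OF uniform_structure_L uniform_structure_L, of _ "\<lambda>c. c"])
      (auto intro!: unif_contI)
  moreover have "(\<lambda>g. g) \<in> iso G (group_limit I leq H \<theta>)"
    by (auto simp: iso_def hom_def bij_betw_def group.is_monoid[OF group_G] monoid.m_closed)
  ultimately show ?thesis
    unfolding acts_prodiscretely_def
    using group_G acts_uniformly_limit system assms act_component
    by (intro conjI exI[of _ I] exI[of _ leq] exI[of _ S] exI[of _ b] exI[of _ H] exI[of _ \<theta>]
        exI[of _ a] exI[of _ "\<lambda>c. c"] exI[of _ "\<lambda>g. g"] ballI)
qed

end

section \<open>Loop classes acting on chain spaces\<close>

text \<open>For chains that can be concatenated, all the classes united are equal (\<open>class_mult_class\<close>).\<close>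

definition class_mult :: "'a uspace \<Rightarrow> ('a \<times> 'a) set \<Rightarrow> 'a list set \<Rightarrow> 'a list set \<Rightarrow> 'a list set" where
  "class_mult X E A C = (\<Union>xs\<in>A. \<Union>ys\<in>C. chain_class X E (xs @ ys))"

definition loop_group :: "'a uspace \<Rightarrow> 'a \<Rightarrow> ('a \<times> 'a) set \<Rightarrow> 'a list set monoid" where
  "loop_group X p E =
     \<lparr>carrier = {chain_class X E xs | xs. entourage_chain X E p p xs},
      monoid.mult = class_mult X E, one = chain_class X E [p]\<rparr>"

definition loop_act :: "'a uspace \<Rightarrow> 'a \<Rightarrow> ('a \<times> 'a) set \<Rightarrow> 'a list set \<Rightarrow> 'a list set \<Rightarrow> 'a list set" where
  "loop_act X p E g = (\<lambda>A\<in>carrier (chain_space X p E). class_mult X E g A)"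

lemma chain_homotopic_append_both:
  assumes "chain_homotopic X E xs xs'" and "chain_homotopic X E ys ys'"
    and "entourage_chain X E a b (xs @ ys)"
  shows "chain_homotopic X E (xs @ ys) (xs' @ ys')"
proof -
  have *: "chain_homotopic X E (xs @ ys) (xs' @ ys)"
    using chain_homotopic_append_right[OF assms(1,3)] .
  then have "entourage_chain X E a b (xs' @ ys)"
    using assms(3) chain_homotopic_chain_iff[OF *] by simp
  then show ?thesis
    using * chain_homotopic_append_left[OF assms(2)] chain_homotopic_trans by metis
qed

lemma chain_homotopic_rev:
  assumes "sym E" and "chain_homotopic X E xs ys"
  shows "chain_homotopic X E (rev xs) (rev ys)"
  using assms(2) unfolding chain_homotopic_def
proof (induction rule: equivclp_induct)
  case (step y z)
  have "chain_insert X E (rev as) (rev bs)" if ins: "chain_insert X E as bs" for as bs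
  proof -
    obtain p q us w vs where *: "entourage_chain X E p q as" "entourage_chain X E p q bs"
      "as = us @ vs" "bs = us @ w # vs"
      using ins by (elim chain_insertE)
    then have "rev as = rev vs @ rev us" "rev bs = rev vs @ w # rev us" by simp_all
    then show ?thesis
      unfolding chain_insert_def
      using entourage_chain_rev[OF *(1) assms(1)] entourage_chain_rev[OF *(2) assms(1)] by metis
  qed
  then show ?case using step by (meson equivclp_into_equivclp)
qed simp

lemma class_mult_class:
  assumes "entourage_chain X E a b (xs @ ys)"
  shows "class_mult X E (chain_class X E xs) (chain_class X E ys) = chain_class X E (xs @ ys)"
proof -
  have "chain_class X E (xs' @ ys') = chain_class X E (xs @ ys)"
    if "xs' \<in> chain_class X E xs" "ys' \<in> chain_class X E ys" for xs' ys'
  proof -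
    have "chain_homotopic X E (xs @ ys) (xs' @ ys')"
      using chain_homotopic_append_both[OF _ _ assms] that by (simp add: chain_class_def)
    then show ?thesis using chain_class_eq_iff by metis
  qed
  then have "class_mult X E (chain_class X E xs) (chain_class X E ys) =
      (\<Union>xs'\<in>chain_class X E xs. \<Union>ys'\<in>chain_class X E ys. chain_class X E (xs @ ys))"
    unfolding class_mult_def by (intro SUP_cong refl)
  also have "\<dots> = chain_class X E (xs @ ys)"
    using chain_class_self by blast
  finally show ?thesis .
qed

locale chain_level = unif_space X for X :: "'a uspace" +
  fixes p :: 'a and E :: "('a \<times> 'a) set"
  assumes basepoint: "p \<in> carrier X" and E: "E \<in> entourages X"
begin

abbreviation "\<pi> \<equiv> loop_group X p E"
abbreviation "S \<equiv> chain_space X p E"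

lemma loop_append:
  assumes "entourage_chain X E p p ls" and "entourage_chain X E p q xs"
  shows "entourage_chain X E p q (ls @ xs)"
  using assms entourage_chainD[OF assms(1)] entourage_chainD[OF assms(2)] entourage_refl[OF E basepoint]
  by (simp add: entourage_chain_append_iff)

lemma mult_classes:
  "entourage_chain X E p p ls \<Longrightarrow> entourage_chain X E p q xs \<Longrightarrow>
    class_mult X E (chain_class X E ls) (chain_class X E xs) = chain_class X E (ls @ xs)"
  by (rule class_mult_class[OF loop_append])

lemma loopE:
  assumes "g \<in> carrier \<pi>"
  obtains ls where "entourage_chain X E p p ls" "g = chain_class X E ls"
  using assms by (auto simp: loop_group_def)

lemma spaceE:
  assumes "A \<in> carrier S"
  obtains xs q where "entourage_chain X E p q xs" "A = chain_class X E xs"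
  using assms by (auto simp: carrier_chain_space)

lemma loopI: "entourage_chain X E p p ls \<Longrightarrow> chain_class X E ls \<in> carrier \<pi>"
  by (auto simp: loop_group_def)

lemma loop_mult: "g \<otimes>\<^bsub>\<pi>\<^esub> h = class_mult X E g h" and loop_one: "\<one>\<^bsub>\<pi>\<^esub> = chain_class X E [p]"
  by (simp_all add: loop_group_def)

lemma base_chain: "entourage_chain X E p p [p]"
  using basepoint by simp

lemma mult_one:
  assumes "entourage_chain X E p q xs"
  shows "class_mult X E (chain_class X E [p]) (chain_class X E xs) = chain_class X E xs"
  using mult_classes[OF base_chain assms] chain_homotopic_Cons_hd[OF E assms]
  by (simp add: chain_class_eq_iff)

lemma group_loops: "group \<pi>"
proof (rule groupI)
  fix g assume "g \<in> carrier \<pi>"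
  then obtain ls where ls: "entourage_chain X E p p ls" "g = chain_class X E ls" by (rule loopE)
  show "\<one>\<^bsub>\<pi>\<^esub> \<otimes>\<^bsub>\<pi>\<^esub> g = g" using mult_one[OF ls(1)] ls(2) by (simp add: loop_mult loop_one)
  have rev: "entourage_chain X E p p (rev ls)"
    using entourage_chain_rev[OF ls(1)] entourage_sym[OF E] by (auto simp: sym_def)
  then have "chain_class X E (rev ls) \<otimes>\<^bsub>\<pi>\<^esub> g = \<one>\<^bsub>\<pi>\<^esub>"
    using mult_classes[OF rev ls(1)] chain_homotopic_backtrack[OF E rev] ls(2)
    by (simp add: loop_mult loop_one chain_class_eq_iff)
  then show "\<exists>h\<in>carrier \<pi>. h \<otimes>\<^bsub>\<pi>\<^esub> g = \<one>\<^bsub>\<pi>\<^esub>" using loopI[OF rev] by blast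
  fix h assume "h \<in> carrier \<pi>"
  then obtain ms where ms: "entourage_chain X E p p ms" "h = chain_class X E ms" by (rule loopE)
  show "g \<otimes>\<^bsub>\<pi>\<^esub> h \<in> carrier \<pi>"
    using mult_classes[OF ls(1) ms(1)] loopI[OF loop_append[OF ls(1) ms(1)]] ls(2) ms(2)
    by (simp add: loop_mult)
  fix k assume "k \<in> carrier \<pi>"
  then obtain ns where ns: "entourage_chain X E p p ns" "k = chain_class X E ns" by (rule loopE)
  show "g \<otimes>\<^bsub>\<pi>\<^esub> h \<otimes>\<^bsub>\<pi>\<^esub> k = g \<otimes>\<^bsub>\<pi>\<^esub> (h \<otimes>\<^bsub>\<pi>\<^esub> k)"
    using mult_classes[OF ls(1) ms(1)] mult_classes[OF loop_append[OF ls(1) ms(1)] ns(1)]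
      mult_classes[OF ms(1) ns(1)] mult_classes[OF ls(1) loop_append[OF ms(1) ns(1)]] ls(2) ms(2) ns(2)
    by (simp add: loop_mult)
qed (use loopI[OF base_chain] in \<open>simp add: loop_one\<close>)

lemma act_class:
  "entourage_chain X E p p ls \<Longrightarrow> entourage_chain X E p q xs \<Longrightarrow>
    loop_act X p E (chain_class X E ls) (chain_class X E xs) = chain_class X E (ls @ xs)"
  using mult_classes[of ls q xs] chain_class_in_space[of X E p q xs] by (simp add: loop_act_def)

lemma star_act:
  assumes g: "g \<in> carrier \<pi>" and D: "D \<in> entourages X" "D \<subseteq> E"
    and AC: "(A, C) \<in> star_entourage X p E D"
  shows "(loop_act X p E g A, loop_act X p E g C) \<in> star_entourage X p E D"
proof -
  obtain ls where ls: "entourage_chain X E p p ls" "g = chain_class X E ls" using g by (rule loopE)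
  obtain as a where as: "entourage_chain X E p a as" "A = chain_class X E as"
    using AC star_entourage_subset[of X p E D] by (meson SigmaD1 spaceE subsetD)
  obtain cs c where cs: "entourage_chain X E p c cs" "C = chain_class X E cs"
    using AC star_entourage_subset[of X p E D] by (meson SigmaD2 spaceE subsetD)
  have *: "(a, c) \<in> D" "chain_homotopic X E (as @ [c]) cs"
    using AC star_entourage_iff[OF E D as(1) cs(1)] by (simp_all add: as(2) cs(2))
  have "entourage_chain X E p c (ls @ as @ [c])"
    using loop_append[OF ls(1), of c "as @ [c]"] cs(1) chain_homotopic_chain_iff[OF *(2)] by simp
  then have "chain_homotopic X E (ls @ as @ [c]) (ls @ cs)"
    using chain_homotopic_append_left[OF *(2)] by blast
  then show ?thesis
    using star_entourage_iff[OF E D loop_append[OF ls(1) as(1)] loop_append[OF ls(1) cs(1)]] *(1)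
      act_class[OF ls(1) as(1)] act_class[OF ls(1) cs(1)] by (simp add: ls(2) as(2) cs(2))
qed

text \<open>
  A loop moving some class \<open>[xs]\<close> by less than \<open>E\<close> fixes it, since both classes have the same endpoint;
  cancelling \<open>xs\<close> shows that the loop is trivial.
\<close>

lemma acts_discretely_loops: "acts_discretely \<pi> S (loop_act X p E)"
proof -
  have "acts_uniformly \<pi> S (loop_act X p E)"
  proof (rule acts_uniformlyI[OF uniform_structure_chain_space[OF E] group_loops])
    show "loop_act X p E g \<in> extensional (carrier S)" for g by (simp add: loop_act_def)
    fix A assume "A \<in> carrier S"
    then obtain xs q where xs: "entourage_chain X E p q xs" "A = chain_class X E xs" by (rule spaceE)
    show "loop_act X p E \<one>\<^bsub>\<pi>\<^esub> A = A"
      using act_class[OF base_chain xs(1)] chain_homotopic_Cons_hd[OF E xs(1)]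
      by (simp add: loop_one xs(2) chain_class_eq_iff)
    fix g h assume "g \<in> carrier \<pi>" "h \<in> carrier \<pi>"
    then obtain ls ms where ls: "entourage_chain X E p p ls" "g = chain_class X E ls"
      and ms: "entourage_chain X E p p ms" "h = chain_class X E ms" by (elim loopE)
    show "loop_act X p E (g \<otimes>\<^bsub>\<pi>\<^esub> h) A = loop_act X p E g (loop_act X p E h A)"
      using mult_classes[OF ls(1) ms(1)] act_class[OF loop_append[OF ls(1) ms(1)] xs(1)]
        act_class[OF ms(1) xs(1)] act_class[OF ls(1) loop_append[OF ms(1) xs(1)]]
      by (simp add: loop_mult ls(2) ms(2) xs(2))
  next
    fix g assume g: "g \<in> carrier \<pi>"
    show "unif_cont S S (loop_act X p E g)"
    proof (rule unif_contI)
      fix A assume "A \<in> carrier S"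
      then obtain xs q where xs: "entourage_chain X E p q xs" "A = chain_class X E xs" by (rule spaceE)
      obtain ls where ls: "entourage_chain X E p p ls" "g = chain_class X E ls" using g by (rule loopE)
      show "loop_act X p E g A \<in> carrier S"
        using act_class[OF ls(1) xs(1)] loop_append[OF ls(1) xs(1)] chain_class_in_space
        by (auto simp: ls(2) xs(2))
    next
      fix V assume "V \<in> entourages S"
      then obtain D where D: "D \<in> entourages X" "D \<subseteq> E" "star_entourage X p E D \<subseteq> V"
        by (rule entourages_chain_spaceE)
      then show "\<exists>U\<in>entourages S. \<forall>A C. (A, C) \<in> U \<longrightarrow> (loop_act X p E g A, loop_act X p E g C) \<in> V"
        using star_act[OF g D(1,2)] star_entourage_in_entourages[OF D(1,2)] by blast
    qed
  qed
  moreover have "g = \<one>\<^bsub>\<pi>\<^esub>"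
    if g: "g \<in> carrier \<pi>" and A: "A \<in> carrier S" and near: "(loop_act X p E g A, A) \<in> star_entourage X p E E"
    for g A
  proof -
    obtain ls where ls: "entourage_chain X E p p ls" "g = chain_class X E ls" using g by (rule loopE)
    obtain xs q where xs: "entourage_chain X E p q xs" "A = chain_class X E xs" using A by (rule spaceE)
    have lx: "entourage_chain X E p q (ls @ xs)" by (rule loop_append[OF ls(1) xs(1)])
    have "chain_homotopic X E ((ls @ xs) @ [q]) xs"
      using near star_entourage_iff[OF E E order_refl lx xs(1)] act_class[OF ls(1) xs(1)]
      by (simp add: ls(2) xs(2))
    then have fix_xs: "chain_homotopic X E (ls @ xs) xs"
      using chain_homotopic_snoc_last[OF E lx] by (meson chain_homotopic_sym chain_homotopic_trans)
    have rev: "entourage_chain X E q p (rev xs)"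
      using entourage_chain_rev[OF xs(1)] entourage_sym[OF E] by (auto simp: sym_def)
    have cancel: "chain_homotopic X E (xs @ rev xs) [p]"
      by (rule chain_homotopic_backtrack[OF E xs(1)])
    then have xr: "entourage_chain X E p p (xs @ rev xs)"
      using chain_homotopic_chain_iff base_chain by metis
    have "chain_homotopic X E ls (ls @ [p])"
      using chain_homotopic_snoc_last[OF E ls(1)] by (rule chain_homotopic_sym)
    also have "chain_homotopic X E (ls @ [p]) (ls @ xs @ rev xs)"
      using chain_homotopic_append_left[OF cancel loop_append[OF ls(1) xr]] by (rule chain_homotopic_sym)
    also have "chain_homotopic X E (ls @ xs @ rev xs) (xs @ rev xs)"
      using chain_homotopic_append_right[OF fix_xs, of p p "rev xs"] loop_append[OF ls(1) xr] by simp
    also note cancel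
    finally show ?thesis by (simp add: ls(2) loop_one chain_class_eq_iff)
  qed
  ultimately show ?thesis
    unfolding acts_discretely_def using star_entourage_in_entourages[OF E order_refl] by blast
qed

end

section \<open>The endpoint map of the limit of chain spaces is a cover\<close>

context chain_system
begin

lemma level: "E \<in> B \<Longrightarrow> chain_level X p E"
  by (simp add: chain_level_def chain_level_axioms_def unif_space_axioms basepoint base_entourage)

lemma star_bonding:
  assumes DE: "D \<in> entourages X" "E \<in> entourages X" "D \<subseteq> E"
    and V: "V \<in> entourages X" "V \<subseteq> E" and AC: "(A, C) \<in> star_entourage X p D (V \<inter> D)"
  shows "(chain_bonding X E A, chain_bonding X E C) \<in> star_entourage X p E V"
proof -
  have VD: "V \<inter> D \<in> entourages X" using entourage_Int V(1) DE(1) by blast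
  obtain as a cs c where as: "entourage_chain X D p a as" "A = chain_class X D as"
    and cs: "entourage_chain X D p c cs" "C = chain_class X D cs"
    using AC star_entourage_subset[of X p D "V \<inter> D"] unfolding carrier_chain_space by blast
  have "(a, c) \<in> V" "chain_homotopic X D (as @ [c]) cs"
    using AC star_entourage_iff[OF DE(1) VD _ as(1) cs(1)] by (simp_all add: as(2) cs(2))
  then show ?thesis
    using star_entourage_iff[OF DE(2) V entourage_chain_mono[OF as(1) DE(3)] entourage_chain_mono[OF cs(1) DE(3)]]
      chain_homotopic_mono[OF _ DE(3)] chain_bonding_class[OF DE(3)] by (simp add: as(2) cs(2))
qed

abbreviation "finer \<equiv> \<lambda>E D :: ('a \<times> 'a) set. D \<subseteq> E"
abbreviation "bond \<equiv> \<lambda>E D :: ('a \<times> 'a) set. chain_bonding X E"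

lemma compatible_bonding_classes:
  assumes "\<And>E A. E \<in> B \<Longrightarrow> A \<in> T E \<Longrightarrow> \<exists>xs. A = chain_class X E xs"
  shows "compatible_bonding B finer T bond"
proof -
  have "chain_bonding X E (chain_bonding X D A) = chain_bonding X E A"
    if "C \<in> B" "D \<subseteq> E" "C \<subseteq> D" "A \<in> T C" for C D E A
  proof -
    obtain xs where "A = chain_class X C xs" using assms[OF \<open>C \<in> B\<close> \<open>A \<in> T C\<close>] by blast
    moreover have "C \<subseteq> E" using that by blast
    ultimately show ?thesis using that chain_bonding_class by metis
  qed
  moreover have "chain_bonding X E A = A" if "E \<in> B" "A \<in> T E" for E A
    using assms[OF that] chain_bonding_class[OF order_refl] by metis
  ultimately show ?thesis unfolding compatible_bonding_def by simp
qed

lemma bonding_hom: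
  assumes E: "E \<in> B" and D: "D \<in> B" "D \<subseteq> E"
  shows "chain_bonding X E \<in> hom (loop_group X p D) (loop_group X p E)"
proof -
  interpret D: chain_level X p D by (rule level[OF D(1)])
  interpret E: chain_level X p E by (rule level[OF E])
  show ?thesis
  proof (rule homI)
    fix g h assume "g \<in> carrier (loop_group X p D)" "h \<in> carrier (loop_group X p D)"
    then obtain ls ms where ls: "entourage_chain X D p p ls" "g = chain_class X D ls"
      and ms: "entourage_chain X D p p ms" "h = chain_class X D ms" by (elim D.loopE)
    note ls' = entourage_chain_mono[OF ls(1) D(2)] and ms' = entourage_chain_mono[OF ms(1) D(2)]
    show "chain_bonding X E g \<in> carrier (loop_group X p E)"
      using E.loopI[OF ls'] chain_bonding_class[OF D(2)] ls(2) by simp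
    show "chain_bonding X E (g \<otimes>\<^bsub>loop_group X p D\<^esub> h) =
        chain_bonding X E g \<otimes>\<^bsub>loop_group X p E\<^esub> chain_bonding X E h"
      using D.mult_classes[OF ls(1) ms(1)] E.mult_classes[OF ls' ms'] chain_bonding_class[OF D(2)]
      by (simp add: D.loop_mult E.loop_mult ls(2) ms(2))
  qed
qed

lemma bonding_equivariant:
  assumes E: "E \<in> B" and D: "D \<in> B" "D \<subseteq> E"
    and g: "g \<in> carrier (loop_group X p D)" and A: "A \<in> carrier (chain_space X p D)"
  shows "chain_bonding X E (loop_act X p D g A) = loop_act X p E (chain_bonding X E g) (chain_bonding X E A)"
proof -
  interpret D: chain_level X p D by (rule level[OF D(1)])
  interpret E: chain_level X p E by (rule level[OF E])
  obtain ls where ls: "entourage_chain X D p p ls" "g = chain_class X D ls" using g by (rule D.loopE)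
  obtain xs q where xs: "entourage_chain X D p q xs" "A = chain_class X D xs" using A by (rule D.spaceE)
  show ?thesis
    using D.act_class[OF ls(1) xs(1)] chain_bonding_class[OF D(2)]
      E.act_class[OF entourage_chain_mono[OF ls(1) D(2)] entourage_chain_mono[OF xs(1) D(2)]]
    by (simp add: ls(2) xs(2))
qed

lemma bonding_cont:
  assumes E: "E \<in> B" and D: "D \<in> B" "D \<subseteq> E"
  shows "unif_cont (chain_space X p D) (chain_space X p E) (chain_bonding X E)"
proof (rule unif_contI)
  show "chain_bonding X E A \<in> carrier (chain_space X p E)" if "A \<in> carrier (chain_space X p D)" for A
    using that chain_bonding_class[OF D(2)] entourage_chain_mono[OF _ D(2)]
    by (auto simp: carrier_chain_space) blast
  fix W assume "W \<in> entourages (chain_space X p E)"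
  then obtain V where V: "V \<in> entourages X" "V \<subseteq> E" "star_entourage X p E V \<subseteq> W"
    by (rule entourages_chain_spaceE)
  have "star_entourage X p D (V \<inter> D) \<in> entourages (chain_space X p D)"
    using star_entourage_in_entourages entourage_Int[OF V(1) base_entourage[OF D(1)]] by simp
  then show "\<exists>U\<in>entourages (chain_space X p D). \<forall>A C. (A, C) \<in> U \<longrightarrow>
      (chain_bonding X E A, chain_bonding X E C) \<in> W"
    using star_bonding[OF base_entourage[OF D(1)] base_entourage[OF E] D(2) V(1,2)] V(3) by blast
qed

lemma loop_action_system:
  "discrete_action_system B finer (chain_space X p) bond (loop_group X p) bond (loop_act X p)"
  unfolding discrete_action_system_def
proof (intro conjI ballI impI)
  have "B \<noteq> {}" using base_below[OF entourage_top] by blast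
  then show "directed_set B finer"
    unfolding directed_set_def using base_directed by (intro conjI ballI impI) auto
  show "compatible_bonding B finer (\<lambda>E. carrier (chain_space X p E)) bond"
    by (rule compatible_bonding_classes) (auto simp: carrier_chain_space)
  show "compatible_bonding B finer (\<lambda>E. carrier (loop_group X p E)) bond"
    by (rule compatible_bonding_classes) (auto simp: loop_group_def)
qed (simp_all add: base_entourage uniform_structure_chain_space bonding_cont bonding_hom
    bonding_equivariant chain_level.group_loops[OF level] chain_level.acts_discretely_loops[OF level])

end

sublocale chain_system \<subseteq> deck: action_limit B "\<lambda>E D. D \<subseteq> E" "chain_space X p" "\<lambda>E D. chain_bonding X E"
    "loop_group X p" "\<lambda>E D. chain_bonding X E" "loop_act X p"
  by unfold_locales (rule loop_action_system)

text \<open>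
  The assumptions on the base in the definition of a coverable space, for the limit over the base
  itself. They make all points of \<open>X\<close>, and all steps in members of the base, visible in the limit.
\<close>

locale surjective_chain_system = chain_system +
  assumes top: "carrier X \<times> carrier X \<in> B"
    and surjective: "E \<in> B \<Longrightarrow> A \<in> carrier (chain_space X p E) \<Longrightarrow> \<exists>c\<in>points. c E = A"
begin

lemma deck_L: "deck.L = chain_limit X p B"
  by (simp add: chain_limit_def)

lemma proj_surj:
  assumes x: "x \<in> carrier X"
  shows "\<exists>c\<in>points. tilde_proj X c = x"
proof -
  have "entourage_chain X (carrier X \<times> carrier X) p x [p, x]"
    using x basepoint by (auto simp: entourage_chain_Cons_iff)
  from surjective[OF top chain_class_in_space[OF this]]
  obtain c where c: "c \<in> points" "c (carrier X \<times> carrier X) = chain_class X (carrier X \<times> carrier X) [p, x]"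
    by blast
  then have "[p, x] \<in> c (carrier X \<times> carrier X)" by simp
  from tilde_proj_eq[OF top c(1) top this] show ?thesis using c(1) by auto
qed

lemma deck_act_mem:
  assumes g: "g \<in> carrier deck.G" and c: "c \<in> points" and E: "E \<in> B" and xs: "xs \<in> c E"
  obtains ls where "entourage_chain X E p p ls" "ls @ xs \<in> deck.act g c E"
proof -
  interpret E: chain_level X p E by (rule level[OF E])
  obtain ls where ls: "entourage_chain X E p p ls" "g E = chain_class X E ls"
    using deck.G_component[OF g E] by (rule E.loopE)
  note cE = coordinate_chain[OF c E xs]
  have "deck.act g c E = chain_class X E (ls @ xs)"
    using deck.act_component[of c E g] c E E.act_class[OF ls(1) cE(2)] ls(2) cE(1) by (simp add: deck_L)
  then show thesis using that ls(1) by simp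
qed

lemma proj_deck_act:
  assumes g: "g \<in> carrier deck.G" and c: "c \<in> points"
  shows "tilde_proj X (deck.act g c) = tilde_proj X c"
proof -
  obtain xs where xs: "xs \<in> c (carrier X \<times> carrier X)" using coordinate_nonempty[OF c top] .
  obtain ls where ls: "ls @ xs \<in> deck.act g c (carrier X \<times> carrier X)"
    using deck_act_mem[OF g c top xs] .
  have gc: "deck.act g c \<in> points" using deck.act_closed[OF g] c by (simp add: deck_L)
  show ?thesis
    using tilde_proj_eq[OF top gc top ls] tilde_proj_eq[OF top c top xs]
      entourage_chainD(1)[OF coordinate_chain(2)[OF c top xs]] by simp
qed

text \<open>Two points over the same endpoint differ by the loops running along one and back along the other.\<close>

lemma deck_transitive:
  assumes c: "c \<in> points" and d: "d \<in> points" and eq: "tilde_proj X c = tilde_proj X d"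
  shows "\<exists>g\<in>carrier deck.G. d = deck.act g c"
proof -
  have "\<forall>E\<in>B. \<exists>xs. xs \<in> c E" "\<forall>E\<in>B. \<exists>xs. xs \<in> d E"
    using coordinate_nonempty c d by blast+
  then obtain \<alpha> \<beta> where \<alpha>: "\<And>E. E \<in> B \<Longrightarrow> \<alpha> E \<in> c E" and \<beta>: "\<And>E. E \<in> B \<Longrightarrow> \<beta> E \<in> d E"
    by metis
  define x where "x = tilde_proj X c"
  have ca: "entourage_chain X E p x (\<alpha> E)" and cb: "entourage_chain X E p x (\<beta> E)" if E: "E \<in> B" for E
    using coordinate_chain(2)[OF c E \<alpha>[OF E]] tilde_proj_eq[OF top c E \<alpha>[OF E]]
      coordinate_chain(2)[OF d E \<beta>[OF E]] tilde_proj_eq[OF top d E \<beta>[OF E]] eq by (simp_all add: x_def)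
  have symE: "sym E" if "E \<in> B" for E
    using entourage_sym[OF base_entourage[OF that]] by (auto simp: sym_def)
  have ra: "entourage_chain X E x p (rev (\<alpha> E))" if "E \<in> B" for E
    using entourage_chain_rev[OF ca symE] that by blast
  have loop: "entourage_chain X E p p (\<beta> E @ rev (\<alpha> E))" if E: "E \<in> B" for E
  proof -
    have "(x, x) \<in> E" using entourage_refl[OF base_entourage[OF E]] entourage_chainD(6)[OF ca[OF E]] by blast
    then show ?thesis
      using cb[OF E] ra[OF E] entourage_chainD[OF cb[OF E]] entourage_chainD[OF ra[OF E]]
      by (simp add: entourage_chain_append_iff)
  qed
  define g where "g = (\<lambda>E\<in>B. chain_class X E (\<beta> E @ rev (\<alpha> E)))"
  have "chain_bonding X E (g D) = g E" if DE: "E \<in> B" "D \<in> B" "D \<subseteq> E" for D E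
  proof -
    have "chain_homotopic X E (\<alpha> E) (\<alpha> D)" "chain_homotopic X E (\<beta> E) (\<beta> D)"
      using coordinate_mono[OF c DE(2,1,3) \<alpha>[OF DE(2)]] coordinate_chain(1)[OF c DE(1) \<alpha>[OF DE(1)]]
        coordinate_mono[OF d DE(2,1,3) \<beta>[OF DE(2)]] coordinate_chain(1)[OF d DE(1) \<beta>[OF DE(1)]]
      by (simp_all add: chain_class_def)
    then have "chain_homotopic X E (\<beta> E @ rev (\<alpha> E)) (\<beta> D @ rev (\<alpha> D))"
      using chain_homotopic_append_both[OF _ chain_homotopic_rev[OF symE[OF DE(1)]] loop[OF DE(1)]] by blast
    then show ?thesis
      using DE chain_bonding_class[OF DE(3)] chain_homotopic_sym by (simp add: g_def chain_class_eq_iff)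
  qed
  moreover have "g \<in> (\<Pi>\<^sub>E E\<in>B. carrier (loop_group X p E))"
    using chain_level.loopI[OF level loop] by (auto simp: g_def)
  ultimately have g: "g \<in> carrier deck.G"
    by (simp add: deck.G_carrier threads_def)
  have "d = deck.act g c"
  proof (rule points_eqI[OF d])
    show "deck.act g c \<in> points" using deck.act_closed[OF g] c by (simp add: deck_L)
    fix E assume E: "E \<in> B"
    interpret E: chain_level X p E by (rule level[OF E])
    have "deck.act g c E = chain_class X E ((\<beta> E @ rev (\<alpha> E)) @ \<alpha> E)"
      using deck.act_component[of c E g] c E E.act_class[OF loop[OF E] ca[OF E]]
        coordinate_chain(1)[OF c E \<alpha>[OF E]] by (simp add: deck_L g_def)
    moreover have "chain_homotopic X E ((\<beta> E @ rev (\<alpha> E)) @ \<alpha> E) (\<beta> E)"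
    proof -
      have cancel: "chain_homotopic X E (rev (\<alpha> E) @ \<alpha> E) [x]"
        using chain_homotopic_backtrack[OF E.E ra[OF E]] by simp
      have "entourage_chain X E p x (\<beta> E @ (rev (\<alpha> E) @ \<alpha> E))"
        using E.loop_append[OF loop[OF E] ca[OF E]] by simp
      from chain_homotopic_append_left[OF cancel this]
      have "chain_homotopic X E ((\<beta> E @ rev (\<alpha> E)) @ \<alpha> E) (\<beta> E @ [x])" by simp
      then show ?thesis
        using chain_homotopic_snoc_last[OF E.E cb[OF E]] chain_homotopic_trans by blast
    qed
    ultimately have "\<beta> E \<in> deck.act g c E" by (simp add: chain_class_def)
    then show "\<exists>xs. xs \<in> d E \<and> xs \<in> deck.act g c E" using \<beta>[OF E] by blast
  qed
  then show ?thesis using g by blast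
qed

lemma proj_cont: "unif_cont (chain_limit X p B) X (tilde_proj X)"
proof (rule unif_contI)
  fix c assume c: "c \<in> points"
  obtain xs where xs: "xs \<in> c (carrier X \<times> carrier X)" using coordinate_nonempty[OF c top] .
  show "tilde_proj X c \<in> carrier X"
    using tilde_proj_eq[OF top c top xs] entourage_chainD(6)[OF coordinate_chain(2)[OF c top xs]] by simp
next
  fix V assume "V \<in> entourages X"
  then obtain E where E: "E \<in> B" "E \<subseteq> V" using base_below by blast
  have "(tilde_proj X c, tilde_proj X d) \<in> V" if cd: "(c, d) \<in> near E" for c d
  proof -
    have c: "c \<in> points" and d: "d \<in> points" using near_points[OF cd] by auto
    obtain xs ys where xs: "xs \<in> c E" and ys: "ys \<in> d E" using coordinates_nonempty[OF c d E(1)] .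
    then show ?thesis
      using near_iff[OF c d E(1) xs ys] cd tilde_proj_eq[OF top c E(1) xs] tilde_proj_eq[OF top d E(1) ys] E(2)
      by auto
  qed
  then show "\<exists>U\<in>entourages (chain_limit X p B). \<forall>c d. (c, d) \<in> U \<longrightarrow> (tilde_proj X c, tilde_proj X d) \<in> V"
    using near_entourage[OF E(1)] by blast
qed

text \<open>A step in \<open>E\<close> from the endpoint of a point over \<open>x\<close> is realised by continuing the chain of its \<open>E\<close>-coordinate.\<close>

lemma proj_image_entourage:
  assumes W: "W \<in> entourages (chain_limit X p B)"
  shows "map_prod (tilde_proj X) (tilde_proj X) ` W \<in> entourages X"
proof -
  interpret L: unif_space "chain_limit X p B" by unfold_locales (rule uniform_structure_chain_limit)
  obtain E where E: "E \<in> B" "near E \<subseteq> W" using W by (auto simp: entourages_limit_iff)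
  show ?thesis
  proof (rule entourage_superset[OF base_entourage[OF E(1)]])
    show "E \<subseteq> map_prod (tilde_proj X) (tilde_proj X) ` W"
    proof (rule subrelI)
      fix x y assume xy: "(x, y) \<in> E"
      have X: "x \<in> carrier X" "y \<in> carrier X" using entourage_carrier[OF base_entourage[OF E(1)] xy] .
      obtain c where c: "c \<in> points" "tilde_proj X c = x" using proj_surj[OF X(1)] by blast
      obtain xs where xs: "xs \<in> c E" using coordinate_nonempty[OF c(1) E(1)] .
      have lx: "last xs = x" using tilde_proj_eq[OF top c(1) E(1) xs] c(2) by simp
      have "entourage_chain X E p y (xs @ [y])"
        using coordinate_chain(2)[OF c(1) E(1) xs] xy lx X
          entourage_chainD(1)[OF coordinate_chain(2)[OF c(1) E(1) xs]]
        by (simp add: entourage_chain_snoc_iff)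
      from surjective[OF E(1) chain_class_in_space[OF this]]
      obtain d where d: "d \<in> points" "d E = chain_class X E (xs @ [y])" by blast
      then have ys: "xs @ [y] \<in> d E" by simp
      have "(c, d) \<in> near E" using near_iff[OF c(1) d(1) E(1) xs ys] xy lx by simp
      moreover have "tilde_proj X d = y" using tilde_proj_eq[OF top d(1) E(1) ys] by simp
      ultimately have "(c, d) \<in> W" "(x, y) = map_prod (tilde_proj X) (tilde_proj X) (c, d)"
        using E(2) c(2) by auto
      then show "(x, y) \<in> map_prod (tilde_proj X) (tilde_proj X) ` W" by blast
    qed
    show "map_prod (tilde_proj X) (tilde_proj X) ` W \<subseteq> carrier X \<times> carrier X"
      using unif_contD(1)[OF proj_cont] L.entourage_carrier[OF W] by auto
    show "sym (map_prod (tilde_proj X) (tilde_proj X) ` W)"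
      using L.entourage_sym[OF W] by (auto simp: sym_def)
  qed
qed

lemma deck_near:
  assumes g: "g \<in> carrier deck.G" and E: "E \<in> B" and cd: "(c, d) \<in> near E"
  shows "(deck.act g c, deck.act g d) \<in> near E"
proof -
  have c: "c \<in> points" and d: "d \<in> points" using near_points[OF cd] by auto
  have "deck.act g c \<in> points" "deck.act g d \<in> points"
    using deck.act_closed[OF g] c d by (simp_all add: deck_L)
  moreover have "(deck.act g c E, deck.act g d E) \<in> star_entourage X p E E"
    using chain_level.star_act[OF level[OF E] deck.G_component[OF g E] base_entourage[OF E] order_refl]
      cd deck.act_component[of c E g] deck.act_component[of d E g] c d E
    by (simp add: near_def deck_L)
  ultimately show ?thesis by (simp add: near_def)
qed

theorem is_cover_proj:
  "is_cover TYPE(('a \<times> 'a) set \<times> 'a list set \<times> 'a list set \<times> (('a \<times> 'a) set \<Rightarrow> 'a list set))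
     (chain_limit X p B) X (tilde_proj X)"
proof -
  have unif: "acts_uniformly deck.G (chain_limit X p B) deck.act"
    using deck.acts_uniformly_limit by (simp only: deck_L)
  have "\<exists>D\<in>entourages (chain_limit X p B). D \<subseteq> V \<and>
      (\<forall>g\<in>carrier deck.G. \<forall>c d. (c, d) \<in> D \<longrightarrow> (deck.act g c, deck.act g d) \<in> D)"
    if V: "V \<in> entourages (chain_limit X p B)" for V
  proof -
    obtain E where E: "E \<in> B" "near E \<subseteq> V" using V by (auto simp: entourages_limit_iff)
    show ?thesis
      using near_entourage[OF E(1)] E(2) deck_near[OF _ E(1)] by (intro bexI[of _ "near E"] conjI ballI allI impI)
  qed
  then have "acts_isomorphically deck.G (chain_limit X p B) deck.act"
    using unif unfolding acts_isomorphically_iff[OF uniform_structure_chain_limit] by (intro conjI ballI)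
  moreover have "acts_prodiscretely TYPE(('a \<times> 'a) set \<times> 'a list set \<times> 'a list set)
      deck.G (chain_limit X p B) deck.act"
  proof -
    have "(\<lambda>c. c E) ` points = carrier (chain_space X p E)" if E: "E \<in> B" for E
      using surjective[OF E] coordinate_in_space[OF _ E] by blast
    then show ?thesis using deck.acts_prodiscretely_limit by (simp only: deck_L)
  qed
  moreover have "\<exists>h. unif_homeo (orbit_space deck.G (chain_limit X p B) deck.act) X h \<and>
      (\<forall>c\<in>points. tilde_proj X c = h (orbit deck.G deck.act c))"
  proof (rule quotient_mapI[OF uniform_structure_chain_limit uniform_structure])
    show "group_action deck.G points deck.act" using unif by (simp add: acts_uniformly_def)
    show "tilde_proj X ` points = carrier X"
      using proj_surj unif_contD(1)[OF proj_cont] by blast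
    show "tilde_proj X c = tilde_proj X d \<longleftrightarrow> (\<exists>g\<in>carrier deck.G. d = deck.act g c)"
      if "c \<in> points" "d \<in> points" for c d
      using deck_transitive[OF that] proj_deck_act[OF _ that(1)] by auto
  qed (rule proj_cont, rule proj_image_entourage)
  ultimately show ?thesis unfolding is_cover_def by blast
qed

end

section \<open>The universal cover\<close>

text \<open>A thread over a base extends uniquely to all entourages, by bonding from any finer member of the base.\<close>

lemma (in chain_system) restrict_homeo:
  "unif_homeo (tilde X p) (chain_limit X p B) (\<lambda>c. restrict c B)"
proof -
  interpret T: chain_system X p "entourages X"
    by unfold_locales (auto simp: basepoint entourage_base_def)
  let ?r = "\<lambda>c. restrict c B"
  define ext where "ext e = (\<lambda>E\<in>entourages X. \<Union>D\<in>{D \<in> B. D \<subseteq> E}. chain_bonding X E (e D))" for e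
  have ext: "ext e E = chain_class X E xs"
    if e: "e \<in> points" and E: "E \<in> entourages X" and D: "D \<in> B" "D \<subseteq> E" and xs: "xs \<in> e D" for e E D xs
  proof -
    have "chain_bonding X E (e D') = chain_class X E xs" if D': "D' \<in> B" "D' \<subseteq> E" for D'
    proof -
      obtain C where C: "C \<in> B" "C \<subseteq> D" "C \<subseteq> D'" using base_directed[OF D(1) D'(1)] by blast
      obtain zs where zs: "zs \<in> e C" using coordinate_nonempty[OF e C(1)] .
      have "zs \<in> e D" "zs \<in> e D'" using coordinate_mono[OF e C(1) _ _ zs] D D' C by blast+
      then have "e D' = chain_class X D' zs" "chain_homotopic X D xs zs"
        using coordinate_chain(1)[OF e D'(1)] coordinate_chain(1)[OF e D(1) xs]
        by (simp_all add: chain_class_def)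
      then show ?thesis
        using chain_bonding_class[OF D'(2)] chain_homotopic_mono[OF _ D(2)] by (metis chain_class_eq_iff)
    qed
    then have "(\<Union>D\<in>{D \<in> B. D \<subseteq> E}. chain_bonding X E (e D)) = (\<Union>D\<in>{D \<in> B. D \<subseteq> E}. chain_class X E xs)"
      by (intro SUP_cong) auto
    also have "\<dots> = chain_class X E xs" using D by blast
    finally show ?thesis using E by (simp add: ext_def)
  qed
  have ext_points: "ext e \<in> T.points" if e: "e \<in> points" for e
  proof (rule T.pointsI)
    show "ext e \<in> extensional (entourages X)" by (simp add: ext_def)
    fix E assume E: "E \<in> entourages X"
    obtain D where D: "D \<in> B" "D \<subseteq> E" using base_below[OF E] by blast
    obtain xs where xs: "xs \<in> e D" using coordinate_nonempty[OF e D(1)] .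
    show "ext e E \<in> carrier (chain_space X p E)"
      using ext[OF e E D xs] entourage_chain_mono[OF coordinate_chain(2)[OF e D(1) xs] D(2)]
        chain_class_in_space by metis
  next
    fix C E assume CE: "C \<in> entourages X" "E \<in> entourages X" "C \<subseteq> E"
    obtain D where D: "D \<in> B" "D \<subseteq> C" using base_below[OF CE(1)] by blast
    obtain xs where xs: "xs \<in> e D" using coordinate_nonempty[OF e D(1)] .
    have "D \<subseteq> E" using D CE by blast
    then show "\<exists>xs\<in>ext e C. xs \<in> ext e E"
      using ext[OF e CE(1) D xs] ext[OF e CE(2) D(1) _ xs] by (intro bexI[of _ xs]) simp_all
  qed
  have res_points: "?r c \<in> points" if c: "c \<in> T.points" for c
  proof (rule pointsI)
    show "?r c E \<in> carrier (chain_space X p E)" if "E \<in> B" for E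
      using T.coordinate_in_space[OF c base_entourage[OF that]] that by simp
    show "\<exists>xs\<in>?r c D. xs \<in> ?r c E" if DE: "D \<in> B" "E \<in> B" "D \<subseteq> E" for D E
    proof -
      obtain xs where xs: "xs \<in> c D" using T.coordinate_nonempty[OF c base_entourage[OF DE(1)]] .
      then show ?thesis
        using T.coordinate_mono[OF c base_entourage[OF DE(1)] base_entourage[OF DE(2)] DE(3) xs] DE
        by (intro bexI[of _ xs]) simp_all
    qed
  qed simp
  have res_ext: "?r (ext e) = e" if e: "e \<in> points" for e
  proof (rule points_eqI[OF res_points[OF ext_points[OF e]] e])
    fix E assume E: "E \<in> B"
    obtain xs where xs: "xs \<in> e E" using coordinate_nonempty[OF e E] .
    then show "\<exists>xs. xs \<in> ?r (ext e) E \<and> xs \<in> e E"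
      using ext[OF e base_entourage[OF E] E order_refl xs] E by (intro exI[of _ xs]) simp
  qed
  have ext_res: "ext (?r c) = c" if c: "c \<in> T.points" for c
  proof (rule T.points_eqI[OF ext_points[OF res_points[OF c]] c])
    fix E assume E: "E \<in> entourages X"
    obtain D where D: "D \<in> B" "D \<subseteq> E" using base_below[OF E] by blast
    obtain xs where xs: "xs \<in> c D" using T.coordinate_nonempty[OF c base_entourage[OF D(1)]] .
    then have "xs \<in> ext (?r c) E"
      using ext[OF res_points[OF c] E D, of xs] D(1) by simp
    then show "\<exists>xs. xs \<in> ext (?r c) E \<and> xs \<in> c E"
      using T.coordinate_mono[OF c base_entourage[OF D(1)] E D(2) xs] by blast
  qed
  have near_res: "(?r c, ?r d) \<in> near E \<longleftrightarrow> (c, d) \<in> T.near E"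
    if "c \<in> T.points" "d \<in> T.points" "E \<in> B" for c d E
    using that res_points by (simp add: near_def T.near_def)
  have "unif_cont (chain_limit X p (entourages X)) (chain_limit X p B) ?r"
  proof (rule unif_contI)
    fix V assume "V \<in> entourages (chain_limit X p B)"
    then obtain E where E: "E \<in> B" "near E \<subseteq> V" by (auto simp: entourages_limit_iff)
    have "(?r c, ?r d) \<in> V" if "(c, d) \<in> T.near E" for c d
      using that near_res[OF _ _ E(1)] T.near_points[OF that] E(2) by blast
    then show "\<exists>U\<in>entourages (chain_limit X p (entourages X)). \<forall>c d. (c, d) \<in> U \<longrightarrow> (?r c, ?r d) \<in> V"
      using T.near_entourage[OF base_entourage[OF E(1)]] by blast
  qed (rule res_points)
  moreover have "unif_cont (chain_limit X p B) (chain_limit X p (entourages X)) ext"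
  proof (rule unif_contI)
    fix V assume "V \<in> entourages (chain_limit X p (entourages X))"
    then obtain E where E: "E \<in> entourages X" "T.near E \<subseteq> V" by (auto simp: T.entourages_limit_iff)
    obtain D where D: "D \<in> B" "D \<subseteq> E" using base_below[OF E(1)] by blast
    have "(ext c, ext d) \<in> V" if cd: "(c, d) \<in> near D" for c d
    proof -
      have p: "c \<in> points" "d \<in> points" using near_points[OF cd] by auto
      have "(ext c, ext d) \<in> T.near D"
        using near_res[OF ext_points[OF p(1)] ext_points[OF p(2)] D(1)] res_ext p cd by simp
      then show ?thesis
        using T.near_mono[OF base_entourage[OF D(1)] E(1) D(2)] E(2) by blast
    qed
    then show "\<exists>U\<in>entourages (chain_limit X p B). \<forall>c d. (c, d) \<in> U \<longrightarrow> (ext c, ext d) \<in> V"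
      using near_entourage[OF D(1)] by blast
  qed (rule ext_points)
  ultimately show ?thesis
    unfolding tilde_eq_chain_limit
    by (intro unif_homeoI[OF T.uniform_structure_chain_limit uniform_structure_chain_limit])
      (use ext_res res_ext in simp_all)
qed

locale coverable_space = unif_space X for X :: "'a uspace" +
  fixes p :: 'a
  assumes basepoint: "p \<in> carrier X" and coverable: "coverable X p"
begin

sublocale T: chain_system X p "entourages X"
  by unfold_locales (auto simp: basepoint entourage_base_def)

lemma uniform_structure_tilde: "uniform_structure (tilde X p)"
  using T.uniform_structure_chain_limit by (simp add: tilde_eq_chain_limit)

lemma covering_base:
  obtains B where "entourage_base X B" "carrier X \<times> carrier X \<in> B"
    "\<And>E A. E \<in> B \<Longrightarrow> A \<in> carrier (chain_space X p E) \<Longrightarrow> \<exists>c\<in>T.points. c E = A"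
proof -
  obtain B where B: "entourage_base X B" "carrier X \<times> carrier X \<in> B"
    "\<forall>E\<in>B. (\<lambda>c. c E) ` T.points = carrier (chain_space X p E)"
    using coverable unfolding coverable_def tilde_eq_chain_limit by blast
  show thesis
  proof (rule that[OF B(1,2)])
    fix E A assume "E \<in> B" "A \<in> carrier (chain_space X p E)"
    then have "A \<in> (\<lambda>c. c E) ` T.points" using B(3) by simp
    then show "\<exists>c\<in>T.points. c E = A" by blast
  qed
qed

text \<open>
  Over a base given by coverability, the limit displays the prodiscrete action; it is identified with
  \<open>tilde X p\<close> by restriction of threads, which preserves endpoints.
\<close>

theorem universal_cover_is_cover:
  "is_cover TYPE(('a \<times> 'a) set \<times> 'a list set \<times> 'a list set \<times> (('a \<times> 'a) set \<Rightarrow> 'a list set))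
     (tilde X p) X (tilde_proj X)"
proof -
  obtain B where B: "entourage_base X B" "carrier X \<times> carrier X \<in> B"
    "\<And>E A. E \<in> B \<Longrightarrow> A \<in> carrier (chain_space X p E) \<Longrightarrow> \<exists>c\<in>T.points. c E = A"
    by (rule covering_base) blast
  interpret C: chain_system X p B
    by unfold_locales (rule basepoint, rule B(1))
  note homeo = C.restrict_homeo
  interpret C: surjective_chain_system X p B
  proof unfold_locales
    fix E A assume E: "E \<in> B" and A: "A \<in> carrier (chain_space X p E)"
    obtain c where c: "c \<in> T.points" "c E = A" using B(3)[OF E A] by blast
    have "restrict c B \<in> C.points"
      using homeo c(1) bij_betwE unfolding unif_homeo_def tilde_eq_chain_limit by blast
    then show "\<exists>c\<in>C.points. c E = A" using c(2) E by (intro bexI[of _ "restrict c B"]) simp_all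
  qed (rule B(2))
  have "(\<lambda>c. tilde_proj X (restrict c B)) = tilde_proj X"
    using B(2) by (simp add: tilde_proj_def fun_eq_iff)
  then show ?thesis
    using is_cover_comp_homeo[OF uniform_structure_tilde C.uniform_structure_chain_limit
        uniform_structure homeo C.is_cover_proj] by simp
qed

text \<open>
  Since the coordinates in a suitable base are realised by points, a chain representing one coordinate
  of \<open>c\<close> gives a chain of points from the base point to \<open>c\<close>, through its initial segments.
\<close>

theorem tilde_chain_connected:
  assumes W: "W \<in> entourages (tilde X p)" and c: "c \<in> carrier (tilde X p)"
  shows "\<exists>zs. entourage_chain (tilde X p) W (tilde_base X p) c zs"
proof -
  obtain B where B: "entourage_base X B"
    "\<And>E A. E \<in> B \<Longrightarrow> A \<in> carrier (chain_space X p E) \<Longrightarrow> \<exists>c\<in>T.points. c E = A"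
    by (rule covering_base) blast
  obtain E' where E': "E' \<in> entourages X" "T.near E' \<subseteq> W"
    using W by (auto simp: tilde_eq_chain_limit T.entourages_limit_iff)
  obtain E where EB: "E \<in> B" "E \<in> entourages X" "E \<subseteq> E'"
    using B(1) E'(1) unfolding entourage_base_def by blast
  have nW: "T.near E \<subseteq> W" using T.near_mono[OF EB(2) E'(1) EB(3)] E'(2) by blast
  have base: "tilde_base X p \<in> T.points"
    using tilde_base_in_tilde[OF uniform_structure basepoint] by (simp add: tilde_eq_chain_limit)
  have "\<exists>zs. entourage_chain (chain_limit X p (entourages X)) (T.near E) (tilde_base X p) c zs"
    if "c \<in> T.points" "xs \<in> c E" for c xs
    using that
  proof (induction xs arbitrary: c rule: rev_induct)
    case Nil
    then show ?case using entourage_chainD(1)[OF T.coordinate_chain(2)[OF Nil(1) EB(2) Nil(2)]] by simp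
  next
    case (snoc x xs)
    note cE = T.coordinate_chain(2)[OF snoc.prems(1) EB(2) snoc.prems(2)]
    show ?case
    proof (cases "xs = []")
      case True
      then have "x = p" using cE by simp
      moreover have "[p] \<in> tilde_base X p E" using EB(2) by (simp add: tilde_base_def)
      ultimately have "(tilde_base X p, c) \<in> T.near E"
        using T.near_iff[OF base snoc.prems(1) EB(2), of "[p]" "[p]"] snoc.prems(2) True
          entourage_refl[OF EB(2) basepoint] chain_homotopic_snoc_last[OF EB(2), of p p "[p]"] basepoint
        by simp
      then show ?thesis
        using base snoc.prems(1) by (intro exI[of _ "[tilde_base X p, c]"]) (simp add: entourage_chain_Cons_iff)
    next
      case False
      then have xs: "entourage_chain X E p (last xs) xs" "(last xs, x) \<in> E"
        using cE by (simp_all add: entourage_chain_snoc_iff)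
      obtain d where d: "d \<in> T.points" "d E = chain_class X E xs"
        using B(2)[OF EB(1) chain_class_in_space[OF xs(1)]] by blast
      then have dxs: "xs \<in> d E" by simp
      obtain zs where zs: "entourage_chain (chain_limit X p (entourages X)) (T.near E) (tilde_base X p) d zs"
        using snoc.IH[OF d(1) dxs] by blast
      have "(d, c) \<in> T.near E"
        using T.near_iff[OF d(1) snoc.prems(1) EB(2) dxs snoc.prems(2)] xs(2) by simp
      then show ?thesis
        using zs entourage_chainD[OF zs] snoc.prems(1)
        by (intro exI[of _ "zs @ [c]"]) (simp add: entourage_chain_snoc_iff)
    qed
  qed
  moreover obtain xs where "xs \<in> c E"
    using T.coordinate_nonempty[of c E] c EB(2) by (auto simp: tilde_eq_chain_limit)
  ultimately show ?thesis
    using c nW unfolding tilde_eq_chain_limit by (meson entourage_chain_mono)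
qed

end

section \<open>Lifting the universal cover through a cover\<close>

theorem theorem3:
  fixes X :: "'a uspace" and Y :: "'b uspace" and p :: 'a and q :: 'b and f :: "'a \<Rightarrow> 'b"
  assumes "uniform_structure X" and "p \<in> carrier X" and "coverable X p"
    and "uniform_structure Y" and "q \<in> carrier Y" and "coverable Y q"
    and "is_cover TYPE('i \<times> 'x \<times> 'h \<times> 'g) X Y f" and "f p = q"
  shows "\<exists>fB.
    (is_cover TYPE(('a \<times> 'a) set \<times> 'a list set \<times> 'a list set \<times> (('a \<times> 'a) set \<Rightarrow> 'a list set))
       (tilde Y q) X fB \<and>
     fB (tilde_base Y q) = p \<and>
     (\<forall>c\<in>carrier (tilde Y q). f (fB c) = tilde_proj Y c)) \<and>
    (\<forall>g. is_cover TYPE('j \<times> 'y \<times> 'k \<times> 'l) (tilde Y q) X g \<and>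
       g (tilde_base Y q) = p \<and>
       (\<forall>c\<in>carrier (tilde Y q). f (g c) = tilde_proj Y c) \<longrightarrow>
       (\<forall>c\<in>carrier (tilde Y q). g c = fB c))"
proof -
  interpret X: coverable_space X p
    by (intro coverable_space.intro coverable_space_axioms.intro unif_space.intro assms(1-3))
  interpret Y: coverable_space Y q
    by (intro coverable_space.intro coverable_space_axioms.intro unif_space.intro assms(4-6))
  interpret lifting_cover X Y f
    by (rule is_cover_imp_lifting_cover[OF assms(1,4,7)])
  interpret pointed_lifting_cover X Y f p
    by unfold_locales (rule assms(2))
  let ?inv = "inv_into (carrier (tilde X p)) f_tilde"
  define fB where "fB c = tilde_proj X (?inv c)" for c
  have homeo: "unif_homeo (tilde X p) (tilde Y q) f_tilde"
    using f_tilde_homeo assms(8) by simp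
  then have bij: "bij_betw f_tilde (carrier (tilde X p)) (carrier (tilde Y q))"
    by (simp add: unif_homeo_def)
  have base: "tilde_base X p \<in> carrier (tilde X p)" "tilde_base Y q \<in> carrier (tilde Y q)"
    by (rule tilde_base_in_tilde[OF assms(1,2)], rule tilde_base_in_tilde[OF assms(4,5)])
  have cover: "is_cover TYPE(('a \<times> 'a) set \<times> 'a list set \<times> 'a list set \<times> (('a \<times> 'a) set \<Rightarrow> 'a list set))
      (tilde Y q) X fB"
    unfolding fB_def
    by (rule is_cover_comp_homeo[OF Y.uniform_structure_tilde X.uniform_structure_tilde assms(1)
          unif_homeo_inverse[OF X.uniform_structure_tilde Y.uniform_structure_tilde homeo]
          X.universal_cover_is_cover])
  have "?inv (tilde_base Y q) = tilde_base X p"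
    using bij_betw_inv_into_left[OF bij base(1)] f_tilde_base assms(8) by simp
  moreover have "tilde_proj X (tilde_base X p) = p"
    using endpoint_chain_class[of X "carrier X \<times> carrier X" p p "[p]"] assms(2) X.entourage_top
    by (simp add: tilde_proj_def tilde_base_def)
  ultimately have fB_base: "fB (tilde_base Y q) = p"
    by (simp add: fB_def)
  have fB_lift: "f (fB c) = tilde_proj Y c" if c: "c \<in> carrier (tilde Y q)" for c
  proof -
    have "?inv c \<in> carrier (tilde X p)" "f_tilde (?inv c) = c"
      using bij c by (auto simp: bij_betw_def inv_into_into f_inv_into_f)
    then show ?thesis
      using f_tilde_proj[of "?inv c"] by (simp add: fB_def tilde_eq_chain_limit)
  qed
  have "g c = fB c"
    if g: "is_cover TYPE('j \<times> 'y \<times> 'k \<times> 'l) (tilde Y q) X g" "g (tilde_base Y q) = p"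
      "\<forall>c\<in>carrier (tilde Y q). f (g c) = tilde_proj Y c" and c: "c \<in> carrier (tilde Y q)" for g c
  proof (rule lifts_agree[OF Y.uniform_structure_tilde])
    show "unif_cont (tilde Y q) X g"
      using lifting_cover.f_cont[OF is_cover_imp_lifting_cover[OF Y.uniform_structure_tilde assms(1) g(1)]] .
    show "unif_cont (tilde Y q) X fB"
      using lifting_cover.f_cont[OF is_cover_imp_lifting_cover[OF Y.uniform_structure_tilde assms(1) cover]] .
    show "f (g d) = f (fB d)" if "d \<in> carrier (tilde Y q)" for d
      using g(3) fB_lift that by simp
    show "g (tilde_base Y q) = fB (tilde_base Y q)"
      using g(2) fB_base by simp
  qed (use Y.tilde_chain_connected c in blast)+
  then show ?thesis
    using cover fB_base fB_lift by blast
qed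

end
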